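(* Let $n>1$, $p=2$, and let $\tau\ge 0$, $s>0$ be such that $\tau>1+2s$. Assume also that $n<\tau<n+1$. Then there exist a weight $w\in A_2\cap D_\tau$ on $\mathbf{S}^n$ and a positive Borel measure $\mu$ on $\mathbf{S}^n$ such that $\mu$ is a Carleson measure for $H_s^2(w)$, but $\mu$ is not a Carleson measure for $K_s[L^2(w)]$.
   Context: $\mathbf{B}^n$ is the open unit ball of $\mathbf{C}^n$, $\mathbf{S}^n$ its boundary (the unit sphere), $\sigma$ the normalized Lebesgue measure on $\mathbf{S}^n$, and $z\overline{\zeta}=\sum_{i=1}^n z_i\overline{\zeta_i}$. Nonisotropic balls in $\mathbf{S}^n$ are $B(\zeta,r)=\{\eta\in\mathbf{S}^n: |1-\zeta\overline{\eta}|<r\}$, and $|E|$ is the Lebesgue measure of $E\subset \mathbf{S}^n$. A weight $w\ge 0$ on $\mathbf{S}^n$ is in $A_2$ if there is $C>0$ with $\left(\frac1{|B|}\int_B w\,d\sigma\right)\left(\frac1{|B|}\int_B w^{-1}d\sigma\right)\le C$ for every nonisotropic ball $B$. Write $W(E)=\int_E w\,d\sigma$ and $L^2(w)=L^2(\mathbf{S}^n, w\,d\sigma)$. The weight $w$ is in $D_\tau$ (doubling of order $\tau$) if there is $C>0$ with $W(2^kB)\le C2^{k\tau}W(B)$ for every nonisotropic ball $B$ and every integer $k\ge0$, where $2^kB(\zeta,r)=B(\zeta,2^kr)$. For $f$ holomorphic in $\mathbf{B}^n$ with homogeneous polynomial expansion $f=\sum_k f_k$, $(I+R)^sf=\sum_k(1+k)^sf_k$.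 $H_s^2(w)$ is the space of holomorphic $f$ in $\mathbf{B}^n$ with $\|f\|_{H_s^2(w)}=\sup_{0<r<1}\|((I+R)^sf)(r\,\cdot)\|_{L^2(w)}<+\infty$. The nonisotropic potential is $K_s[f](z)=\int_{\mathbf{S}^n}\frac{f(\eta)}{|1-z\overline{\eta}|^{n-s}}d\sigma(\eta)$, $z\in\overline{\mathbf{B}}^n$. $\mu$ is a Carleson measure for $H_s^2(w)$ if $H_s^2(w)$ is imbedded in $L^2(d\mu)$, i.e. there is $C>0$ with $\|f\|_{L^2(d\mu)}\le C\|f\|_{H_s^2(w)}$ for all $f\in H_s^2(w)$; for $\mu$ carried by $\mathbf{S}^n$ this is understood as $\sup_{0<r<1}\|f(r\,\cdot)\|_{L^2(d\mu)}\le C\|f\|_{H_s^2(w)}$. $\mu$ is a Carleson measure for $K_s[L^2(w)]$ if there is $C>0$ with $\|K_s[f]\|_{L^2(d\mu)}\le C\|f\|_{L^2(w)}$ for all $f\in L^2(w)$. *)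

theory Defs
  imports "HOL-Analysis.Analysis"
begin

definition cdot :: "complex ^ 'n \<Rightarrow> complex ^ 'n \<Rightarrow> complex" where
  "cdot z \<zeta> = (\<Sum>i\<in>UNIV. z $ i * cnj (\<zeta> $ i))"

text \<open>
  Normalized surface measure in polar coordinates: the measure of a Borel subset of the sphere is
  the normalized volume of the cone over it. The space of this measure is the unit sphere.
\<close>
definition sphere_measure :: "(complex ^ 'n) measure" where
  "sphere_measure =
     restrict_space (distr (uniform_measure lborel (ball 0 1)) borel sgn) (sphere 0 1)"

definition nonisotropic_ball :: "complex ^ 'n \<Rightarrow> real \<Rightarrow> (complex ^ 'n) set" where
  "nonisotropic_ball \<zeta> r = {\<eta> \<in> sphere 0 1. cmod (1 - cdot \<zeta> \<eta>) < r}"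

definition weight :: "(complex ^ 'n \<Rightarrow> real) \<Rightarrow> bool" where
  "weight w \<longleftrightarrow> w \<in> borel_measurable sphere_measure \<and> (\<forall>\<eta>\<in>sphere 0 1. 0 \<le> w \<eta>)"

definition weighted_measure :: "(complex ^ 'n \<Rightarrow> real) \<Rightarrow> (complex ^ 'n) measure" where
  "weighted_measure w = density sphere_measure (\<lambda>\<eta>. ennreal (w \<eta>))"

text \<open>
  The inverse of the weight is taken in \<^typ>\<open>ennreal\<close>, so that it is infinite where the weight
  vanishes. Integrability of the weight and of its inverse is required explicitly, because
  0 times infinity is 0 in \<^typ>\<open>ennreal\<close> and the zero weight would otherwise qualify.
\<close>
definition A2_weight :: "(complex ^ 'n \<Rightarrow> real) \<Rightarrow> bool" where
  "A2_weight w \<longleftrightarrow> weight w \<and>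
     (\<integral>\<^sup>+\<eta>. ennreal (w \<eta>) \<partial>sphere_measure) < \<infinity> \<and>
     (\<integral>\<^sup>+\<eta>. inverse (ennreal (w \<eta>)) \<partial>sphere_measure) < \<infinity> \<and>
     (\<exists>C>0. \<forall>\<zeta>\<in>sphere 0 1. \<forall>r>0.
        let B = nonisotropic_ball \<zeta> r in
        ((\<integral>\<^sup>+\<eta>\<in>B. ennreal (w \<eta>) \<partial>sphere_measure) / emeasure sphere_measure B) *
        ((\<integral>\<^sup>+\<eta>\<in>B. inverse (ennreal (w \<eta>)) \<partial>sphere_measure) / emeasure sphere_measure B)
          \<le> ennreal C)"

definition doubling_weight :: "real \<Rightarrow> (complex ^ 'n \<Rightarrow> real) \<Rightarrow> bool" where
  "doubling_weight \<tau> w \<longleftrightarrow> weight w \<and>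
     (\<exists>C>0. \<forall>\<zeta>\<in>sphere 0 1. \<forall>r>0. \<forall>k::nat.
        emeasure (weighted_measure w) (nonisotropic_ball \<zeta> (2 ^ k * r))
          \<le> ennreal (C * 2 powr (real k * \<tau>)) *
             emeasure (weighted_measure w) (nonisotropic_ball \<zeta> r))"

definition L2_norm :: "(complex ^ 'n) measure \<Rightarrow> (complex ^ 'n \<Rightarrow> complex) \<Rightarrow> ennreal" where
  "L2_norm M f =
     (let I = \<integral>\<^sup>+\<eta>. ennreal ((cmod (f \<eta>))\<^sup>2) \<partial>M
      in if I = \<infinity> then \<infinity> else ennreal (sqrt (enn2real I)))"

definition L2_space :: "(complex ^ 'n) measure \<Rightarrow> (complex ^ 'n \<Rightarrow> complex) set" where
  "L2_space M = {f \<in> borel_measurable M. L2_norm M f < \<infinity>}"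

definition holomorphic_Cn :: "(complex ^ 'n \<Rightarrow> complex) \<Rightarrow> (complex ^ 'n) set \<Rightarrow> bool" where
  "holomorphic_Cn f U \<longleftrightarrow>
     (\<forall>z\<in>U. \<exists>D. (f has_derivative D) (at z) \<and> (\<forall>c v. D (c *s v) = c * D v))"

definition homogeneous_poly :: "nat \<Rightarrow> (complex ^ 'n \<Rightarrow> complex) \<Rightarrow> bool" where
  "homogeneous_poly k p \<longleftrightarrow>
     (\<exists>a :: ('n \<Rightarrow> nat) \<Rightarrow> complex. \<forall>z.
        p z = (\<Sum>\<alpha> | sum \<alpha> UNIV = k. a \<alpha> * (\<Prod>i\<in>UNIV. (z $ i) ^ \<alpha> i)))"

definition homogeneous_parts :: "(complex ^ 'n \<Rightarrow> complex) \<Rightarrow> nat \<Rightarrow> complex ^ 'n \<Rightarrow> complex" where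
  "homogeneous_parts f = (THE F. (\<forall>k. homogeneous_poly k (F k)) \<and>
                                 (\<forall>z\<in>ball 0 1. (\<lambda>k. F k z) sums f z))"

definition radial_power :: "real \<Rightarrow> (complex ^ 'n \<Rightarrow> complex) \<Rightarrow> complex ^ 'n \<Rightarrow> complex" where
  "radial_power s f z =
     (\<Sum>k. complex_of_real ((1 + real k) powr s) * homogeneous_parts f k z)"

definition Hardy_Sobolev_norm ::
    "real \<Rightarrow> (complex ^ 'n \<Rightarrow> real) \<Rightarrow> (complex ^ 'n \<Rightarrow> complex) \<Rightarrow> ennreal" where
  "Hardy_Sobolev_norm s w f =
     (SUP r\<in>{0<..<1}. L2_norm (weighted_measure w) (\<lambda>\<eta>. radial_power s f (r *\<^sub>R \<eta>)))"

definition Hardy_Sobolev :: "real \<Rightarrow> (complex ^ 'n \<Rightarrow> real) \<Rightarrow> (complex ^ 'n \<Rightarrow> complex) set" where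
  "Hardy_Sobolev s w = {f. holomorphic_Cn f (ball 0 1) \<and> Hardy_Sobolev_norm s w f < \<infinity>}"

definition potential_integrand ::
    "real \<Rightarrow> (complex ^ 'n \<Rightarrow> complex) \<Rightarrow> complex ^ 'n \<Rightarrow> complex ^ 'n \<Rightarrow> complex" where
  "potential_integrand s f z \<eta> =
     f \<eta> / complex_of_real (cmod (1 - cdot z \<eta>) powr (real CARD('n) - s))"

definition potential :: "real \<Rightarrow> (complex ^ 'n \<Rightarrow> complex) \<Rightarrow> complex ^ 'n \<Rightarrow> complex" where
  "potential s f z = (LINT \<eta>|sphere_measure. potential_integrand s f z \<eta>)"

definition Borel_measure_on_sphere :: "(complex ^ 'n) measure \<Rightarrow> bool" where
  "Borel_measure_on_sphere \<mu> \<longleftrightarrow> sets \<mu> = sets (restrict_space borel (sphere 0 1))"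

definition Carleson_Hardy_Sobolev ::
    "real \<Rightarrow> (complex ^ 'n \<Rightarrow> real) \<Rightarrow> (complex ^ 'n) measure \<Rightarrow> bool" where
  "Carleson_Hardy_Sobolev s w \<mu> \<longleftrightarrow>
     (\<exists>C>0. \<forall>f\<in>Hardy_Sobolev s w.
        (SUP r\<in>{0<..<1}. L2_norm \<mu> (\<lambda>\<eta>. f (r *\<^sub>R \<eta>)))
          \<le> ennreal C * Hardy_Sobolev_norm s w f)"

text \<open>
  The Bochner integral is 0 for non-integrable integrands, so the norm inequality alone would
  treat a divergent potential as 0. Hence the potential is required to converge almost everywhere.
\<close>
definition Carleson_potential ::
    "real \<Rightarrow> (complex ^ 'n \<Rightarrow> real) \<Rightarrow> (complex ^ 'n) measure \<Rightarrow> bool" where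
  "Carleson_potential s w \<mu> \<longleftrightarrow>
     (\<exists>C>0. \<forall>f\<in>L2_space (weighted_measure w).
        (AE z in \<mu>. integrable sphere_measure (potential_integrand s f z)) \<and>
        L2_norm \<mu> (potential s f) \<le> ennreal C * L2_norm (weighted_measure w) f)"

end

theory Submission
  imports Defs "HOL-Complex_Analysis.Cauchy_Integral_Formula"
begin

text \<open>
  Let \<open>n = CARD('n)\<close> and fix a coordinate \<open>i\<close>. The complex line of this coordinate meets the sphere
  in a circle, and \<open>defect i \<eta> = 1 - (cmod (\<eta> $ i))\<^sup>2\<close> is comparable to the nonisotropic distance
  of \<open>\<eta>\<close> from this circle. The counterexample consists of the arc length on the circle
  (\<open>circle_measure\<close>) and the power \<open>w\<close> of the defect with exponent \<open>a = 2 * s - (n - 1)\<close>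
  (\<open>defect_weight\<close>), for which the circle is critical.

  Comparing cones over subsets of the sphere with boxes, the tube of radius \<open>t\<close> and length \<open>b\<close> around
  the circle has measure of the order \<open>b * t ^ (n - 1)\<close> (\<open>sphere_tube_upper\<close>, \<open>sphere_tube_lower\<close>).
  Hence the ball of centre \<open>\<zeta>\<close> and radius \<open>r\<close> has weighted measure of the order
  \<open>r ^ n * max r (defect i \<zeta>) powr a\<close> whenever \<open>a > - (n - 1)\<close> (\<open>defect_weight_ball\<close>). Since
  \<open>0 < s\<close> and \<open>1 + 2 * s < \<tau> < n + 1\<close> give \<open>\<bar>a\<bar> < n - 1\<close>, this applies to \<open>w\<close> and to its
  inverse and yields the Muckenhoupt condition; \<open>n < \<tau>\<close> and \<open>n + a = 1 + 2 * s < \<tau>\<close> yield the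
  doubling condition.

  The monomials are orthogonal in the weighted space, because the torus acts on it by rotations of the
  coordinates. The squared norm of \<open>(\<eta> $ i) ^ k\<close> is at least of the order
  \<open>(1 + k) powr (- (n - 1 + a)) = (1 + k) powr (- 2 * s)\<close> (\<open>moment_lower_bound\<close>), which the factor
  \<open>(1 + k) powr (2 * s)\<close> of the Hardy-Sobolev norm compensates exactly. Thus Bessel's inequality bounds
  the square sum of the Taylor coefficients of \<open>f\<close> on the complex line by the squared Hardy-Sobolev norm
  of \<open>f\<close>, and by Parseval's identity this is the Carleson embedding on the circle
  (\<open>Carleson_Hardy_Sobolev_circle_measure\<close>). The orthogonality concerns the homogeneous expansion of
  \<open>f\<close>, whose existence and uniqueness are established by restriction to complex lines
  (\<open>homogeneous_parts_eq_hom_part\<close>).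

  The potential has a positive kernel and does not benefit from orthogonality. For a function \<open>g\<close> of the
  defect, it is of the order of the integral of \<open>g t * t powr (s - 1)\<close> everywhere on the circle, whereas
  the squared norm is of the order of the integral of \<open>(g t)\<^sup>2 * t powr (2 * s - 1)\<close>. For
  \<open>g t = t powr (- s) / (1 - ln t)\<close> the norm is finite and the potential diverges
  (\<open>log_extremal_in_L2\<close>, \<open>log_extremal_potential_diverges\<close>).
\<close>

section \<open>Invariance of Lebesgue measure under linear isometries\<close>

lemma nn_integral_lborel_translate:
  fixes f :: "'a::euclidean_space \<Rightarrow> ennreal"
  assumes [measurable]: "f \<in> borel_measurable borel"
  shows "(\<integral>\<^sup>+x. f (x + a) \<partial>lborel) = (\<integral>\<^sup>+x. f x \<partial>lborel)"
proof -
  have "(\<integral>\<^sup>+x. f x \<partial>lborel) = (\<integral>\<^sup>+x. f x \<partial>distr lborel borel ((+) a))"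
    by (simp add: lborel_distr_plus)
  also have "\<dots> = (\<integral>\<^sup>+x. f (x + a) \<partial>lborel)"
    by (subst nn_integral_distr) (simp_all add: add.commute)
  finally show ?thesis by simp
qed

text \<open>
  The image measure of Lebesgue measure under the isometry is again translation invariant. Two
  translation invariant measures are proportional: for a Borel set \<open>A\<close> and the unit ball \<open>B\<close>, the
  product of the one measure of \<open>A\<close> with the other of \<open>B\<close> is a double integral, and shearing it in
  each variable in turn exchanges the roles of the two measures. The factor is 1 because the isometry
  fixes \<open>B\<close>.
\<close>
lemma distr_lborel_linear_isometry:
  fixes T :: "'a::euclidean_space \<Rightarrow> 'a"
  assumes lin: "linear T" and iso: "\<And>x. norm (T x) = norm x"
  shows "distr lborel borel T = lborel"
proof -
  have ort: "orthogonal_transformation T"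
    using lin iso by (simp add: orthogonal_transformation)
  have "continuous_on UNIV T"
    using lin by (simp add: linear_continuous_on linear_conv_bounded_linear)
  then have mT[measurable]: "T \<in> borel_measurable borel"
    by (rule borel_measurable_continuous_onI)
  have pre: "T -` ball 0 1 = ball 0 1"
    by (auto simp: iso)
  define B :: "'a set" where "B = ball 0 1"
  have [measurable]: "B \<in> sets borel" by (simp add: B_def)
  have B0: "emeasure lborel B \<noteq> 0" "emeasure lborel B \<noteq> \<infinity>"
    unfolding B_def using emeasure_lborel_ball_finite[of "0::'a" 1]
    by (auto simp: emeasure_ball zero_less_measure_iff unit_ball_vol_pos less_imp_neq[THEN not_sym])
  show ?thesis
  proof (rule measure_eqI)
    show "sets (distr lborel borel T) = sets (lborel::'a measure)" by simp
    fix A :: "'a set" assume "A \<in> sets (distr lborel borel T)"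
    then have [measurable]: "A \<in> sets borel" by simp
    let ?I = "\<lambda>A x. indicator A x :: ennreal"
    have shift: "(\<integral>\<^sup>+x. f (T x + y) \<partial>lborel) = (\<integral>\<^sup>+x. f (T x) \<partial>lborel)"
      if [measurable]: "f \<in> borel_measurable borel" for f :: "'a \<Rightarrow> ennreal" and y
    proof -
      obtain v where v: "T v = y"
        using orthogonal_transformation_surj[OF ort] by (metis surjD)
      have "(\<integral>\<^sup>+x. f (T x + y) \<partial>lborel) = (\<integral>\<^sup>+x. f (T (x + v)) \<partial>lborel)"
        using v by (simp add: linear_add[OF lin])
      also have "\<dots> = (\<integral>\<^sup>+x. f (T x) \<partial>lborel)"
        by (rule nn_integral_lborel_translate[where f = "\<lambda>x. f (T x)"]) measurable
      finally show ?thesis .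
    qed
    have "emeasure (distr lborel borel T) A * emeasure lborel B
      = (\<integral>\<^sup>+y. (\<integral>\<^sup>+x. ?I A (T x) * ?I B y \<partial>lborel) \<partial>lborel)"
    proof -
      have "emeasure (distr lborel borel T) A = (\<integral>\<^sup>+x. ?I A (T x) \<partial>lborel)"
        by (subst nn_integral_distr[symmetric, where M' = borel]) simp_all
      then show ?thesis
        by (simp add: nn_integral_multc nn_integral_cmult)
    qed
    also have "\<dots> = (\<integral>\<^sup>+y. (\<integral>\<^sup>+x. ?I A (T x + y) * ?I B y \<partial>lborel) \<partial>lborel)"
      by (rule nn_integral_cong, subst nn_integral_multc, simp, subst nn_integral_multc, simp)
         (simp add: shift[of "?I A"])
    also have "\<dots> = (\<integral>\<^sup>+x. (\<integral>\<^sup>+y. ?I A (T x + y) * ?I B y \<partial>lborel) \<partial>lborel)"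
      by (rule lborel_pair.Fubini') measurable
    also have "\<dots> = (\<integral>\<^sup>+x. (\<integral>\<^sup>+y. ?I A y * ?I B (y - T x) \<partial>lborel) \<partial>lborel)"
    proof (rule nn_integral_cong)
      fix x
      show "(\<integral>\<^sup>+y. ?I A (T x + y) * ?I B y \<partial>lborel) = (\<integral>\<^sup>+y. ?I A y * ?I B (y - T x) \<partial>lborel)"
        using nn_integral_lborel_translate[of "\<lambda>y. ?I A y * ?I B (y - T x)" "T x"]
        by (simp add: add.commute)
    qed
    also have "\<dots> = (\<integral>\<^sup>+y. (\<integral>\<^sup>+x. ?I A y * ?I B (y - T x) \<partial>lborel) \<partial>lborel)"
      by (rule lborel_pair.Fubini') measurable
    also have "\<dots> = (\<integral>\<^sup>+y. ?I A y * emeasure lborel B \<partial>lborel)"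
    proof (rule nn_integral_cong)
      fix y
      have "(\<integral>\<^sup>+x. ?I A y * ?I B (y - T x) \<partial>lborel) = ?I A y * (\<integral>\<^sup>+x. ?I B (y - T x) \<partial>lborel)"
        by (rule nn_integral_cmult) measurable
      also have "(\<integral>\<^sup>+x. ?I B (y - T x) \<partial>lborel) = (\<integral>\<^sup>+x. ?I B (T x + (- y)) \<partial>lborel)"
        by (rule nn_integral_cong) (auto simp: B_def dist_norm norm_minus_commute split: split_indicator)
      also have "\<dots> = (\<integral>\<^sup>+x. ?I B (T x) \<partial>lborel)"
        by (rule shift) measurable
      also have "\<dots> = (\<integral>\<^sup>+x. ?I B x \<partial>lborel)"
        by (rule nn_integral_cong) (auto simp: B_def iso split: split_indicator)
      also have "\<dots> = emeasure lborel B" by simp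
      finally show "(\<integral>\<^sup>+x. ?I A y * ?I B (y - T x) \<partial>lborel) = ?I A y * emeasure lborel B" .
    qed
    also have "\<dots> = emeasure lborel A * emeasure lborel B"
      by (subst nn_integral_multc) simp_all
    finally show "emeasure (distr lborel borel T) A = emeasure lborel A"
      using B0 by (metis ennreal_mult_cancel_left mult.commute infinity_ennreal_def)
  qed
qed

section \<open>The Hermitian product and unitary maps\<close>

lemma cdot_add_left: "cdot (x + y) z = cdot x z + cdot y z"
  by (simp add: cdot_def distrib_right sum.distrib)

lemma cdot_diff_left: "cdot (x - y) z = cdot x z - cdot y z"
  by (simp add: cdot_def left_diff_distrib sum_subtractf)

lemma cdot_diff_right: "cdot x (y - z) = cdot x y - cdot x z"
  by (simp add: cdot_def right_diff_distrib sum_subtractf)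

lemma cdot_smult_left: "cdot (c *s x) y = c * cdot x y"
  by (simp add: cdot_def sum_distrib_left mult.assoc)

lemma cdot_smult_right: "cdot x (c *s y) = cnj c * cdot x y"
  by (simp add: cdot_def sum_distrib_left mult_ac)

lemma cdot_commute: "cdot y x = cnj (cdot x y)"
  by (simp add: cdot_def mult.commute)

lemma Re_cdot: "Re (cdot x y) = x \<bullet> y"
  by (simp add: cdot_def inner_vec_def inner_complex_def)

lemma cdot_self: "cdot x x = of_real ((norm x)\<^sup>2)"
proof (rule complex_eqI)
  show "Re (cdot x x) = Re (of_real ((norm x)\<^sup>2))"
    by (simp add: Re_cdot power2_norm_eq_inner)
  show "Im (cdot x x) = Im (of_real ((norm x)\<^sup>2))"
    by (simp add: cdot_def mult.commute)
qed

lemma cdot_scaleR_left: "cdot (r *\<^sub>R x) y = of_real r * cdot x y"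
  by (simp add: cdot_def sum_distrib_left scaleR_conv_of_real[where 'a = complex] mult.assoc)

lemma complex_mult_cnj_norm: "z * cnj z = (of_real (cmod z))\<^sup>2"
  by (metis complex_norm_square of_real_power)

lemma norm_smult: "norm (c *s x) = cmod c * norm (x :: complex ^ 'n)"
proof -
  have "(norm (c *s x))\<^sup>2 = (cmod c * norm x)\<^sup>2"
    by (simp add: norm_vec_def L2_set_def sum_nonneg norm_mult power_mult_distrib sum_distrib_left)
  then show ?thesis by (rule power2_eq_imp_eq) simp_all
qed

lemma exists_unimodular_rotation: "\<exists>c. cmod c = 1 \<and> c * z = of_real (cmod z)"
proof (cases "z = 0")
  case True then show ?thesis by (intro exI[of _ 1]) simp
next
  case False
  then show ?thesis
    by (intro exI[of _ "cnj z / of_real (cmod z)"])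
       (simp add: norm_divide complex_mult_cnj_norm power2_eq_square mult.commute[of "cnj z"])
qed

lemma cdot_Cauchy_Schwarz: "cmod (cdot x y) \<le> norm x * norm y"
proof -
  obtain c where c: "cmod c = 1" "c * cdot x y = of_real (cmod (cdot x y))"
    using exists_unimodular_rotation by blast
  have "cmod (cdot x y) = (c *s x) \<bullet> y"
    unfolding Re_cdot[symmetric] cdot_smult_left c(2) by simp
  also have "\<dots> \<le> norm x * norm y"
    using norm_cauchy_schwarz[of "c *s x" y] by (simp add: norm_smult c)
  finally show ?thesis .
qed

lemma norm_diff_sphere:
  assumes "norm x = 1" "norm y = 1"
  shows "(norm (x - y))\<^sup>2 = 2 * Re (1 - cdot x y)"
  using assms by (simp add: power2_norm_eq_inner inner_diff_left inner_diff_right Re_cdot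
      norm_eq_1 inner_commute)

text \<open>
  Only real linearity is required, because this is what invariance of Lebesgue measure uses; complex
  linearity follows from the preservation of the Hermitian product.
\<close>
definition unitary_map :: "(complex ^ 'n \<Rightarrow> complex ^ 'n) \<Rightarrow> bool" where
  "unitary_map U \<longleftrightarrow> linear U \<and> (\<forall>x y. cdot (U x) (U y) = cdot x y)"

lemma unitary_map_norm: "unitary_map U \<Longrightarrow> norm (U x) = norm x"
proof -
  assume "unitary_map U"
  then have "Re (cdot (U x) (U x)) = Re (cdot x x)" by (simp add: unitary_map_def)
  then show ?thesis by (simp add: Re_cdot norm_eq_sqrt_inner)
qed

lemma unitary_map_linear: "unitary_map U \<Longrightarrow> linear U"
  by (simp add: unitary_map_def)

lemma unitary_map_sgn: "unitary_map U \<Longrightarrow> sgn (U x) = U (sgn x)"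
  by (simp add: sgn_div_norm unitary_map_norm linear_scale[OF unitary_map_linear])

lemma unitary_map_measurable: "unitary_map U \<Longrightarrow> U \<in> borel_measurable borel"
  by (intro borel_measurable_continuous_onI)
     (simp add: unitary_map_linear linear_continuous_on linear_conv_bounded_linear[symmetric])

lemma unitary_map_compose: "unitary_map U \<Longrightarrow> unitary_map V \<Longrightarrow> unitary_map (\<lambda>x. U (V x))"
  using linear_compose[of V U] by (auto simp: unitary_map_def o_def)

lemma unitary_map_rotations:
  assumes "\<And>i. cmod (c i) = 1"
  shows "unitary_map (\<lambda>x. \<chi> i. c i * x $ i)"
proof -
  have "c i * cnj (c i) = 1" for i
    using assms[of i] by (simp add: complex_mult_cnj_norm)
  then have "c i * x * (cnj (c i) * y) = x * y" for i x y
    by (metis mult.assoc mult.left_commute mult.left_neutral)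
  then have "cdot (\<chi> i. c i * x $ i) (\<chi> i. c i * y $ i) = cdot x y" for x y
    unfolding cdot_def by (intro sum.cong) simp_all
  moreover have "linear (\<lambda>x. \<chi> i. c i * x $ i)"
    by (rule linearI) (simp_all add: vec_eq_iff distrib_left)
  ultimately show ?thesis
    by (simp add: unitary_map_def)
qed

lemma unitary_map_phase: "cmod c = 1 \<Longrightarrow> unitary_map (\<lambda>x. c *s x)"
  using unitary_map_rotations[of "\<lambda>_. c"] by (simp add: vector_scalar_mult_def)

text \<open>
  A reflection needs only a real denominator to be unitary, and \<open>cdot v v\<close> is real.
\<close>
lemma unitary_map_reflection:
  fixes v :: "complex ^ 'n"
  assumes "v \<noteq> 0"
  shows "unitary_map (\<lambda>x. x - (2 * cdot x v / cdot v v) *s v)"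
proof -
  have nz: "cdot v v \<noteq> 0" using assms by (simp add: cdot_self)
  have real: "cnj (cdot v v) = cdot v v" by (simp add: cdot_self)
  have "linear (\<lambda>x. x - (2 * cdot x v / cdot v v) *s v)"
  proof (rule linearI)
    show "(x + y) - (2 * cdot (x + y) v / cdot v v) *s v
      = (x - (2 * cdot x v / cdot v v) *s v) + (y - (2 * cdot y v / cdot v v) *s v)" for x y
      by (simp add: vec_eq_iff cdot_add_left distrib_left add_divide_distrib distrib_right)
    show "r *\<^sub>R x - (2 * cdot (r *\<^sub>R x) v / cdot v v) *s v
      = r *\<^sub>R (x - (2 * cdot x v / cdot v v) *s v)" for r x
      by (simp add: vec_eq_iff cdot_scaleR_left scaleR_conv_of_real[where 'a = complex] right_diff_distrib)
  qed
  moreover have "cdot (x - (2 * cdot x v / cdot v v) *s v) (y - (2 * cdot y v / cdot v v) *s v)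
      = cdot x y" for x y
    using nz
    by (simp add: cdot_diff_left cdot_diff_right cdot_smult_left cdot_smult_right real
        cdot_commute[of v y, symmetric] cdot_commute[of y v, symmetric] field_simps)
  ultimately show ?thesis by (simp add: unitary_map_def)
qed

text \<open>
  A reflection exchanges two unit vectors if their Hermitian product is real; a phase factor applied
  to the first vector makes it so.
\<close>
lemma unitary_map_transitive:
  fixes a b :: "complex ^ 'n"
  assumes a: "norm a = 1" and b: "norm b = 1"
  obtains U where "unitary_map U" "U a = b"
proof -
  obtain c where c: "cmod c = 1" "c * cdot a b = of_real (cmod (cdot a b))"
    using exists_unimodular_rotation by blast
  define a' where "a' = c *s a"
  have na': "norm a' = 1" by (simp add: a'_def norm_smult c a)
  have rl: "cdot a' b = of_real (cmod (cdot a b))" by (simp add: a'_def cdot_smult_left c)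
  have rl': "cdot b a' = of_real (cmod (cdot a b))"
    using cdot_commute[of b a'] rl by simp
  show thesis
  proof (cases "a' = b")
    case True
    then show thesis using that[OF unitary_map_phase[OF c(1)]] by (simp add: a'_def)
  next
    case False
    define v where "v = a' - b"
    have v0: "v \<noteq> 0" using False by (simp add: v_def)
    have "cdot a' a' = 1" "cdot b b = 1"
      by (simp_all add: cdot_self na' b)
    then have "2 * cdot a' v = cdot v v"
      by (simp add: v_def cdot_diff_left cdot_diff_right rl rl')
    moreover have "cdot v v \<noteq> 0" using v0 by (simp add: cdot_self)
    ultimately have "a' - (2 * cdot a' v / cdot v v) *s v = b"
      by (simp add: v_def)
    then show thesis
      using that[OF unitary_map_compose[OF unitary_map_reflection[OF v0] unitary_map_phase[OF c(1)]]]
      by (simp add: a'_def)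
  qed
qed

section \<open>Unitary invariance of the surface measure\<close>

lemma space_sphere_measure [simp]: "space (sphere_measure :: (complex^'n) measure) = sphere 0 1"
  by (simp add: sphere_measure_def space_restrict_space)

lemma sets_sphere_measure [measurable_cong]:
  "sets (sphere_measure :: (complex^'n) measure) = sets (restrict_space borel (sphere 0 1))"
  unfolding sphere_measure_def by (rule sets_restrict_space_cong) simp

lemma sets_sphere_measure_iff:
  "A \<in> sets (sphere_measure :: (complex^'n) measure) \<longleftrightarrow> A \<in> sets borel \<and> A \<subseteq> sphere 0 1"
  unfolding sets_sphere_measure by (subst sets_restrict_space_iff) auto

lemma measurable_sgn_vec [measurable]: "sgn \<in> borel_measurable (borel :: 'a::euclidean_space measure)"
  unfolding sgn_div_norm[abs_def] by measurable

lemma unit_ball_emeasure: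
  "emeasure lborel (ball 0 1 :: (complex^'n) set) \<noteq> 0"
  "emeasure lborel (ball 0 1 :: (complex^'n) set) \<noteq> \<infinity>"
  using emeasure_lborel_ball_finite[of "0::complex^'n" 1]
  by (auto simp: emeasure_ball unit_ball_vol_pos less_imp_neq[THEN not_sym])

lemma emeasure_sphere_measure:
  fixes A :: "(complex^'n) set"
  assumes "A \<in> sets borel" "A \<subseteq> sphere 0 1"
  shows "emeasure sphere_measure A
    = emeasure lborel (ball 0 1 \<inter> sgn -` A) / emeasure lborel (ball 0 1 :: (complex^'n) set)"
proof -
  have sg: "sgn \<in> uniform_measure lborel (ball 0 1) \<rightarrow>\<^sub>M (borel :: (complex^'n) measure)"
    by simp
  have "emeasure sphere_measure A
      = emeasure (distr (uniform_measure lborel (ball 0 1)) borel sgn) A"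
    unfolding sphere_measure_def using assms by (intro emeasure_restrict_space) auto
  also have "\<dots> = emeasure (uniform_measure lborel (ball 0 1)) (sgn -` A)"
    using assms sg by (subst emeasure_distr) auto
  also have "\<dots> = emeasure lborel (ball 0 1 \<inter> sgn -` A) / emeasure lborel (ball 0 1 :: (complex^'n) set)"
    using assms measurable_sets[OF measurable_sgn_vec, of A]
    by (intro emeasure_uniform_measure) auto
  finally show ?thesis .
qed

lemma unitary_map_measurable_sphere:
  "unitary_map U \<Longrightarrow> U \<in> sphere_measure \<rightarrow>\<^sub>M sphere_measure"
  unfolding measurable_cong_sets[OF sets_sphere_measure sets_sphere_measure]
  by (intro measurable_restrict_space3) (auto simp: unitary_map_measurable unitary_map_norm)

lemma distr_sphere_measure_unitary:
  fixes U :: "complex^'n \<Rightarrow> complex^'n"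
  assumes U: "unitary_map U"
  shows "distr sphere_measure sphere_measure U = sphere_measure"
proof (rule measure_eqI)
  fix A assume "A \<in> sets (distr sphere_measure sphere_measure U)"
  then have A: "A \<in> sets sphere_measure" by simp
  then have A': "A \<in> sets borel" "A \<subseteq> sphere 0 1" by (simp_all add: sets_sphere_measure_iff)
  have mU: "U -` A \<in> sets borel"
    using measurable_sets[OF unitary_map_measurable[OF U] A'(1)] by simp
  have eq: "U -` A \<inter> sphere 0 1 = U -` A"
    using A'(2) by (auto simp: unitary_map_norm[OF U])
  have sg: "sgn -` A \<in> sets borel"
    using measurable_sets[OF measurable_sgn_vec A'(1)] by simp
  have "emeasure (distr sphere_measure sphere_measure U) A = emeasure sphere_measure (U -` A)"
    using unitary_map_measurable_sphere[OF U] A by (subst emeasure_distr) (simp_all add: eq)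
  also have "\<dots> = emeasure lborel (ball 0 1 \<inter> sgn -` U -` A) / emeasure lborel (ball 0 1 :: (complex^'n) set)"
    using mU eq by (intro emeasure_sphere_measure) auto
  also have "ball 0 1 \<inter> sgn -` U -` A = U -` (ball 0 1 \<inter> sgn -` A)"
    by (auto simp: unitary_map_norm[OF U] unitary_map_sgn[OF U])
  also have "emeasure lborel (U -` (ball 0 1 \<inter> sgn -` A))
      = emeasure (distr lborel borel U) (ball 0 1 \<inter> sgn -` A)"
    using sg unitary_map_measurable[OF U] by (subst emeasure_distr) auto
  also have "distr lborel borel U = lborel"
    by (rule distr_lborel_linear_isometry) (simp_all add: U unitary_map_linear unitary_map_norm)
  also have "emeasure lborel (ball 0 1 \<inter> sgn -` A) / emeasure lborel (ball 0 1 :: (complex^'n) set)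
      = emeasure sphere_measure A"
    by (rule emeasure_sphere_measure[symmetric]) (use A' in auto)
  finally show "emeasure (distr sphere_measure sphere_measure U) A = emeasure sphere_measure A" .
qed simp

lemma emeasure_sphere_unitary:
  fixes U :: "complex^'n \<Rightarrow> complex^'n"
  assumes U: "unitary_map U" and A: "A \<in> sets sphere_measure"
  shows "emeasure sphere_measure (U -` A \<inter> sphere 0 1) = emeasure sphere_measure A"
  using A unitary_map_measurable_sphere[OF U]
    by (subst (2) distr_sphere_measure_unitary[OF U, symmetric]) (subst emeasure_distr, auto)

lemma integral_sphere_unitary:
  fixes U :: "complex^'n \<Rightarrow> complex^'n" and f :: "_ \<Rightarrow> 'b::{banach, second_countable_topology}"
  assumes U: "unitary_map U" and f: "f \<in> borel_measurable sphere_measure"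
  shows "(LINT \<eta>|sphere_measure. f (U \<eta>)) = (LINT \<eta>|sphere_measure. f \<eta>)"
  using f unitary_map_measurable_sphere[OF U]
    by (subst (2) distr_sphere_measure_unitary[OF U, symmetric]) (subst integral_distr, auto)

lemma nonisotropic_ball_unitary:
  assumes U: "unitary_map U"
  shows "U -` nonisotropic_ball (U \<zeta>) r \<inter> sphere 0 1 = nonisotropic_ball \<zeta> r"
  using U by (auto simp: nonisotropic_ball_def unitary_map_norm[OF U]) (auto simp: unitary_map_def)

lemma continuous_on_cdot_right [continuous_intros]: "continuous_on S (cdot \<zeta>)"
  unfolding cdot_def[abs_def] by (intro continuous_intros)

lemma measurable_cdot [measurable]: "cdot \<zeta> \<in> borel_measurable borel"
  by (intro borel_measurable_continuous_onI continuous_intros)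

lemma sets_nonisotropic_ball [measurable]: "nonisotropic_ball \<zeta> r \<in> sets sphere_measure"
proof -
  have "nonisotropic_ball \<zeta> r = {\<eta> \<in> space borel. cmod (1 - cdot \<zeta> \<eta>) < r} \<inter> sphere 0 1"
    by (auto simp: nonisotropic_ball_def)
  then show ?thesis by (simp add: sets_sphere_measure_iff)
qed

text \<open>
  Splitting \<open>a\<close> and \<open>c\<close> into components along \<open>b\<close> and orthogonal to \<open>b\<close>, the orthogonal components
  have squared norms at most \<open>2 * cmod (1 - cdot a b)\<close> and \<open>2 * cmod (1 - cdot c b)\<close>, so that their
  contribution to \<open>cdot a c\<close> is of the same order as the two terms on the right.
\<close>
lemma nonisotropic_quasi_triangle:
  fixes a b c :: "complex^'n"
  assumes "norm a = 1" "norm b = 1" "norm c = 1"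
  shows "cmod (1 - cdot a c) \<le> 2 * (cmod (1 - cdot a b) + cmod (1 - cdot b c))"
proof -
  define x y where "x = cmod (1 - cdot a b)" and "y = cmod (1 - cdot b c)"
  define a' c' where "a' = a - cdot a b *s b" and "c' = c - cdot c b *s b"
  have sq: "(norm (u - cdot u b *s b))\<^sup>2 \<le> 2 * cmod (1 - cdot u b)" if "norm u = 1" for u
  proof -
    have one: "cdot u u = 1" "cdot b b = 1"
      using assms(2) that by (simp_all add: cdot_self)
    have "cdot (u - cdot u b *s b) (u - cdot u b *s b) = 1 - cdot u b * cnj (cdot u b)"
      by (simp add: cdot_diff_left cdot_diff_right cdot_smult_left cdot_smult_right one
          cdot_commute[of b u] algebra_simps)
    then have "of_real ((norm (u - cdot u b *s b))\<^sup>2) = (of_real (1 - (cmod (cdot u b))\<^sup>2) :: complex)"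
      unfolding cdot_self complex_mult_cnj_norm by simp
    then have "(norm (u - cdot u b *s b))\<^sup>2 = 1 - (cmod (cdot u b))\<^sup>2"
      by (simp only: of_real_eq_iff)
    also have "\<dots> = (1 - cmod (cdot u b)) * (1 + cmod (cdot u b))"
      by (simp add: algebra_simps power2_eq_square)
    also have "\<dots> \<le> cmod (1 - cdot u b) * 2"
    proof (rule mult_mono)
      show "1 - cmod (cdot u b) \<le> cmod (1 - cdot u b)"
        using norm_triangle_ineq2[of 1 "cdot u b"] by simp
      show "1 + cmod (cdot u b) \<le> 2"
        using cdot_Cauchy_Schwarz[of u b] assms(2) that by simp
    qed auto
    finally show ?thesis by simp
  qed
  have eq: "1 - cdot a c = (1 - cdot a b) + cdot a b * (1 - cdot b c) - cdot a' c'"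
    unfolding a'_def c'_def using assms(2)
    by (simp add: cdot_diff_left cdot_diff_right cdot_smult_left cdot_smult_right cdot_self
        cdot_commute[of b c] algebra_simps)
  have "cmod (cdot a' c') \<le> norm a' * norm c'" by (rule cdot_Cauchy_Schwarz)
  also have "\<dots> \<le> ((norm a')\<^sup>2 + (norm c')\<^sup>2) / 2"
    using sum_squares_bound[of "norm a'" "norm c'"] by simp
  also have "\<dots> \<le> x + y"
  proof -
    have "cmod (1 - cdot c b) = y"
      unfolding y_def using complex_mod_cnj[of "1 - cdot b c"] by (simp add: cdot_commute[of c b])
    then show ?thesis using sq[OF assms(1)] sq[OF assms(3)] by (simp add: a'_def c'_def x_def)
  qed
  finally have 1: "cmod (cdot a' c') \<le> x + y" .
  have "cmod (cdot a b * (1 - cdot b c)) \<le> 1 * y"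
    unfolding norm_mult y_def using cdot_Cauchy_Schwarz[of a b] assms by (intro mult_right_mono) auto
  then have "cmod (1 - cdot a c) \<le> x + y + (x + y)"
    unfolding eq using 1 norm_triangle_ineq4[of "(1 - cdot a b) + cdot a b * (1 - cdot b c)" "cdot a' c'"]
      norm_triangle_ineq[of "1 - cdot a b" "cdot a b * (1 - cdot b c)"] by (simp add: x_def)
  then show ?thesis by (simp add: x_def y_def)
qed

section \<open>Volumes of tubes around a circle\<close>

lemma mem_cbox_complex_vec:
  fixes x :: "complex ^ 'n"
  shows "x \<in> cbox l u \<longleftrightarrow> (\<forall>i. Re (l $ i) \<le> Re (x $ i) \<and> Re (x $ i) \<le> Re (u $ i)
     \<and> Im (l $ i) \<le> Im (x $ i) \<and> Im (x $ i) \<le> Im (u $ i))"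
  by (auto simp: mem_box Basis_vec_def inner_axis Basis_complex_def)

lemma emeasure_lborel_cbox_complex_vec:
  fixes l u :: "complex ^ 'n"
  assumes "\<And>i. Re (l $ i) \<le> Re (u $ i)" "\<And>i. Im (l $ i) \<le> Im (u $ i)"
  shows "emeasure lborel (cbox l u)
    = ennreal (\<Prod>i\<in>UNIV. (Re (u $ i) - Re (l $ i)) * (Im (u $ i) - Im (l $ i)))"
proof -
  have B: "Basis = (\<lambda>(i, u). axis i u :: complex ^ 'n) ` (UNIV \<times> {1, \<i>})"
    by (auto simp: Basis_vec_def Basis_complex_def)
  have inj: "inj_on (\<lambda>(i, u). axis i u :: complex ^ 'n) (UNIV \<times> {1, \<i>})"
    by (auto simp: inj_on_def axis_eq_axis)
  have "(\<Prod>b\<in>Basis. (u - l) \<bullet> b) = (\<Prod>(i, v)\<in>UNIV \<times> {1, \<i>}. (u - l) \<bullet> (axis i v :: complex ^ 'n))"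
    unfolding B by (subst prod.reindex[OF inj]) (simp add: case_prod_unfold)
  also have "\<dots> = (\<Prod>i\<in>UNIV. \<Prod>v\<in>{1, \<i>}. (u - l) \<bullet> (axis i v :: complex ^ 'n))"
    by (rule prod.cartesian_product[symmetric])
  also have "\<dots> = (\<Prod>i\<in>UNIV. (Re (u $ i) - Re (l $ i)) * (Im (u $ i) - Im (l $ i)))"
    by (simp add: inner_axis)
  finally show ?thesis
    using assms by (subst emeasure_lborel_cbox) (auto simp: Basis_vec_def Basis_complex_def inner_axis)
qed

lemma prod_if_singled_out:
  fixes A B :: real
  shows "(\<Prod>j\<in>(UNIV :: 'n::finite set). if j = i then A else B) = A * B ^ (CARD('n) - 1)"
proof -
  have "(\<Prod>j\<in>(UNIV :: 'n set). if j = i then A else B) = A * (\<Prod>j\<in>UNIV - {i}. if j = i then A else B)"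
    by (subst prod.remove[of _ i]) auto
  also have "(\<Prod>j\<in>UNIV - {i}. if j = i then A else B) = (\<Prod>j\<in>UNIV - {i}. B)"
    by (rule prod.cong) auto
  finally show ?thesis by (simp add: card_Diff_singleton)
qed

lemma power_CARD_rec: "r * r ^ (CARD('n::finite) - 1) = (r::real) ^ CARD('n)"
  by (simp add: power_eq_if)

text \<open>
  On the sphere this is the sum of the squared moduli of the other coordinates, hence the squared
  distance to the complex line of the coordinate \<open>i\<close>. It is comparable to the nonisotropic distance
  to the circle in which that line meets the sphere.
\<close>
definition defect :: "'n \<Rightarrow> complex ^ 'n \<Rightarrow> real" where
  "defect i \<eta> = 1 - (cmod (\<eta> $ i))\<^sup>2"

lemma measurable_coordinate [measurable (raw)]:
  fixes f :: "'a \<Rightarrow> complex ^ 'n"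
  assumes "f \<in> borel_measurable M"
  shows "(\<lambda>x. f x $ i) \<in> borel_measurable M"
  by (rule borel_measurable_continuous_on[OF _ assms, of "\<lambda>x. x $ i"]) (intro continuous_intros)

lemma measurable_defect [measurable]: "defect i \<in> borel_measurable borel"
  unfolding defect_def[abs_def]
  by (intro borel_measurable_continuous_onI continuous_intros)

lemma norm_power2_split:
  "(norm (z :: complex ^ 'n))\<^sup>2 = (cmod (z $ i))\<^sup>2 + (\<Sum>j\<in>UNIV - {i}. (cmod (z $ j))\<^sup>2)"
proof -
  have "(norm z)\<^sup>2 = (\<Sum>j\<in>UNIV. (cmod (z $ j))\<^sup>2)"
    by (simp add: norm_vec_def L2_set_def sum_nonneg)
  then show ?thesis by (simp add: sum.remove[of UNIV i])
qed

lemma defect_sphere: "norm \<eta> = 1 \<Longrightarrow> defect i \<eta> = (\<Sum>j\<in>UNIV - {i}. (cmod (\<eta> $ j))\<^sup>2)"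
  using norm_power2_split[of \<eta> i] by (simp add: defect_def)

lemma defect_nonneg: "norm \<eta> = 1 \<Longrightarrow> 0 \<le> defect i \<eta>"
  by (simp add: defect_sphere sum_nonneg)

lemma defect_le_1: "defect i \<eta> \<le> 1"
  by (simp add: defect_def)

lemma defect_sgn:
  assumes "z \<noteq> 0"
  shows "defect i (sgn z) = (\<Sum>j\<in>UNIV - {i}. (cmod (z $ j))\<^sup>2) / (norm z)\<^sup>2"
proof -
  have "(cmod (sgn z $ j))\<^sup>2 = (cmod (z $ j))\<^sup>2 / (norm z)\<^sup>2" for j
    by (simp add: sgn_div_norm power_mult_distrib power_inverse divide_inverse)
  then show ?thesis
    using assms by (simp add: defect_sphere norm_sgn sum_divide_distrib)
qed

lemma defect_rotation: "(\<And>i. cmod (c i) = 1) \<Longrightarrow> defect i (\<chi> j. c j * \<eta> $ j) = defect i \<eta>"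
  by (simp add: defect_def norm_mult)

lemma defect_phase: "cmod c = 1 \<Longrightarrow> defect i (c *s \<eta>) = defect i \<eta>"
  by (simp add: defect_def norm_mult)

lemma unit_ball_measure_pos: "0 < measure lborel (ball 0 1 :: (complex ^ 'n) set)"
  by (simp add: content_ball unit_ball_vol_pos)

lemma emeasure_unit_ball:
  "emeasure lborel (ball 0 1 :: (complex ^ 'n) set) = ennreal (measure lborel (ball 0 1 :: (complex ^ 'n) set))"
  using unit_ball_emeasure[where 'n='n] by (intro emeasure_eq_ennreal_measure) auto

lemma sets_sphere_Collect:
  assumes "Measurable.pred borel P"
  shows "{\<eta> :: complex ^ 'n \<in> sphere 0 1. P \<eta>} \<in> sets borel"
proof -
  have "{\<eta> :: complex ^ 'n \<in> sphere 0 1. P \<eta>} = {\<eta> \<in> space borel. P \<eta>} \<inter> sphere 0 1" by auto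
  moreover have "{\<eta> \<in> space borel. P \<eta>} \<in> sets borel" using assms by (simp add: pred_def)
  ultimately show ?thesis by simp
qed

text \<open>
  The coordinate \<open>i\<close> lies within \<open>b\<close> of the real line spanned by \<open>cnj u\<close>. The tube shell below keeps
  the half on the side of \<open>cnj u\<close> and stays away from the circle, so that powers of the defect are
  under control on it.
\<close>
abbreviation sphere_tube :: "'n \<Rightarrow> complex \<Rightarrow> real \<Rightarrow> real \<Rightarrow> (complex ^ 'n) set" where
  "sphere_tube i u b t \<equiv> {\<eta> \<in> sphere 0 1. \<bar>Im (u * \<eta> $ i)\<bar> \<le> b \<and> defect i \<eta> \<le> t}"

abbreviation tube_shell :: "'n \<Rightarrow> real \<Rightarrow> complex \<Rightarrow> real \<Rightarrow> real \<Rightarrow> (complex ^ 'n) set" where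
  "tube_shell i k u b t \<equiv> {\<eta> \<in> sphere 0 1. 0 < Re (u * \<eta> $ i) \<and> \<bar>Im (u * \<eta> $ i)\<bar> \<le> b \<and>
     k * t \<le> defect i \<eta> \<and> defect i \<eta> \<le> t}"

lemma sphere_tube_phase:
  fixes i :: "'n::finite"
  assumes u: "cmod u = 1" and P: "{\<eta> \<in> sphere 0 1. P (\<eta> $ i) (defect i \<eta>)} \<in> sets sphere_measure"
  shows "emeasure sphere_measure {\<eta> :: complex ^ 'n \<in> sphere 0 1. P (u * \<eta> $ i) (defect i \<eta>)}
    = emeasure sphere_measure {\<eta> :: complex ^ 'n \<in> sphere 0 1. P (\<eta> $ i) (defect i \<eta>)}"
proof -
  have "(\<lambda>x. u *s x) -` {\<eta> :: complex ^ 'n \<in> sphere 0 1. P (\<eta> $ i) (defect i \<eta>)} \<inter> sphere 0 1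
    = {\<eta> :: complex ^ 'n \<in> sphere 0 1. P (u * \<eta> $ i) (defect i \<eta>)}"
    by (auto simp: defect_phase u norm_smult)
  then show ?thesis
    using emeasure_sphere_unitary[OF unitary_map_phase[OF u] P] by simp
qed

text \<open>
  The cone over a tube lies in a box that has width of order \<open>b\<close> in one real direction of the
  coordinate \<open>i\<close>, bounded width in the other, and width of order \<open>sqrt t\<close> in the real directions of
  all other coordinates. The phase \<open>u\<close> is rotated away first to align the box with the axes.
\<close>
lemma sphere_tube_upper:
  fixes i :: "'n::finite"
  obtains C where "C > 0" "\<And>u b t. cmod u = 1 \<Longrightarrow> b \<ge> 0 \<Longrightarrow> t \<ge> 0 \<Longrightarrow>
    emeasure sphere_measure (sphere_tube i u b t)
      \<le> ennreal (C * b * t ^ (CARD('n) - 1))"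
proof -
  define V where "V = measure lborel (ball 0 1 :: (complex ^ 'n) set)"
  have V: "V > 0" "emeasure lborel (ball 0 1 :: (complex ^ 'n) set) = ennreal V"
    by (simp_all add: V_def unit_ball_measure_pos emeasure_unit_ball)
  define C where "C = 4 * 4 ^ (CARD('n) - 1) / V"
  show thesis
  proof (rule that)
    show "C > 0" using V by (simp add: C_def)
    fix u :: complex and b t :: real assume u: "cmod u = 1" and b: "b \<ge> 0" and t: "t \<ge> 0"
    define A where "A = {\<eta> :: complex ^ 'n \<in> sphere 0 1. \<bar>Im (\<eta> $ i)\<bar> \<le> b \<and> defect i \<eta> \<le> t}"
    have mA: "A \<in> sets borel"
      unfolding A_def by (rule sets_sphere_Collect) measurable
    define r :: "complex ^ 'n" where
      "r = (\<chi> j. if j = i then Complex 1 b else Complex (sqrt t) (sqrt t))"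
    have "ball 0 1 \<inter> sgn -` A \<subseteq> cbox (- r) r"
    proof
      fix z assume z: "z \<in> ball 0 1 \<inter> sgn -` A"
      then have nz: "norm z < 1" and sA: "sgn z \<in> A" by auto
      have z0: "z \<noteq> 0" using sA by (auto simp: A_def)
      have im: "\<bar>Im (z $ i)\<bar> \<le> b"
      proof -
        have "\<bar>Im (z $ i)\<bar> = norm z * \<bar>Im (sgn z $ i)\<bar>"
          using z0 by (simp add: sgn_div_norm abs_mult)
        also have "\<dots> \<le> 1 * b"
          using sA nz by (intro mult_mono) (auto simp: A_def)
        finally show ?thesis by simp
      qed
      have re: "\<bar>Re (z $ i)\<bar> \<le> 1"
        using abs_Re_le_cmod[of "z $ i"] Finite_Cartesian_Product.norm_nth_le[of z i] nz by linarith
      have oth: "cmod (z $ j) \<le> sqrt t" if "j \<noteq> i" for j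
      proof -
        have "(cmod (z $ j))\<^sup>2 \<le> (\<Sum>j\<in>UNIV - {i}. (cmod (z $ j))\<^sup>2)"
          using that by (intro member_le_sum) auto
        also have "\<dots> = defect i (sgn z) * (norm z)\<^sup>2"
          using z0 by (simp add: defect_sgn)
        also have "\<dots> \<le> t * 1"
          using sA nz t by (intro mult_mono) (auto simp: A_def power_le_one)
        finally show ?thesis by (simp add: real_le_rsqrt)
      qed
      show "z \<in> cbox (- r) r"
        unfolding mem_cbox_complex_vec
      proof
        fix j
        show "Re ((- r) $ j) \<le> Re (z $ j) \<and> Re (z $ j) \<le> Re (r $ j) \<and>
          Im ((- r) $ j) \<le> Im (z $ j) \<and> Im (z $ j) \<le> Im (r $ j)"
          using im re oth[of j] abs_Re_le_cmod[of "z $ j"] abs_Im_le_cmod[of "z $ j"]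
          by (cases "j = i") (auto simp: r_def)
      qed
    qed
    then have "emeasure lborel (ball 0 1 \<inter> sgn -` A) \<le> emeasure lborel (cbox (- r) r)"
      by (intro emeasure_mono) auto
    also have "\<dots> = ennreal (\<Prod>j\<in>UNIV. if j = i then 4 * b else 4 * t)"
      using b t by (subst emeasure_lborel_cbox_complex_vec)
        (auto simp: r_def intro!: arg_cong[of _ _ ennreal] prod.cong)
    also have "\<dots> = ennreal (4 * b * (4 * t) ^ (CARD('n) - 1))"
      by (simp add: prod_if_singled_out)
    finally have le: "emeasure lborel (ball 0 1 \<inter> sgn -` A) \<le> ennreal (4 * b * (4 * t) ^ (CARD('n) - 1))" .
    have mA': "A \<in> sets sphere_measure"
      using mA by (auto simp: sets_sphere_measure_iff A_def)
    have "emeasure sphere_measure (sphere_tube i u b t)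
      = emeasure sphere_measure A"
      using sphere_tube_phase[OF u, where P = "\<lambda>x y. \<bar>Im x\<bar> \<le> b \<and> y \<le> t" and i = i] mA' by (simp add: A_def)
    also have "\<dots> = emeasure lborel (ball 0 1 \<inter> sgn -` A) / ennreal V"
      using mA by (subst emeasure_sphere_measure) (auto simp: A_def V)
    also have "\<dots> \<le> ennreal (4 * b * (4 * t) ^ (CARD('n) - 1)) / ennreal V"
      by (rule divide_right_mono_ennreal[OF le])
    also have "\<dots> = ennreal (C * b * t ^ (CARD('n) - 1))"
      using b t V by (subst divide_ennreal) (auto simp: C_def power_mult_distrib)
    finally show "emeasure sphere_measure (sphere_tube i u b t)
      \<le> ennreal (C * b * t ^ (CARD('n) - 1))" .
  qed
qed

text \<open>
  Conversely the cone over a shell contains a box of these proportions. Keeping the real and imaginary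
  parts of the other coordinates between \<open>q\<close> and \<open>2 * q\<close> bounds the defect from below.
\<close>
lemma sphere_tube_lower:
  fixes i :: "'n::finite"
  assumes n: "CARD('n) > 1"
  obtains k c where "0 < k" "k < 1" "0 < c" "\<And>u b t. cmod u = 1 \<Longrightarrow> 0 < b \<Longrightarrow> b \<le> 1 \<Longrightarrow> 0 < t \<Longrightarrow> t \<le> 1 \<Longrightarrow>
    ennreal (c * b * t ^ (CARD('n) - 1)) \<le> emeasure sphere_measure (tube_shell i k u b t)"
proof -
  define V where "V = measure lborel (ball 0 1 :: (complex ^ 'n) set)"
  have V: "V > 0" "emeasure lborel (ball 0 1 :: (complex ^ 'n) set) = ennreal V"
    by (simp_all add: V_def unit_ball_measure_pos emeasure_unit_ball)
  define m where "m = real (CARD('n) - 1)"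
  have m: "m \<ge> 1" using n by (simp add: m_def)
  \<comment> \<open>With \<open>d = 1 / (128 * m)\<close> the squared moduli of the other coordinates add up to between \<open>t / 64\<close> and \<open>t / 16\<close>; dividing by the squared norm, which is between 1/16 and 1, leaves a defect of at most \<open>t\<close>.\<close>
  define k where "k = 1 / (64 * m)"
  define d where "d = 1 / (128 * m)"
  define c where "c = 1 / 16 * d ^ (CARD('n) - 1) / V"
  have d: "0 < d" "d * m = 1 / 128" using m by (simp_all add: d_def)
  show thesis
  proof (rule that)
    show "0 < k" "k < 1" using m by (simp_all add: k_def)
    show "0 < c" using V d by (simp add: c_def)
    fix u :: complex and b t :: real
    assume u: "cmod u = 1" and b: "0 < b" "b \<le> 1" and t: "0 < t" "t \<le> 1"
    define A where "A = {\<eta> :: complex ^ 'n \<in> sphere 0 1. 0 < Re (\<eta> $ i) \<and> \<bar>Im (\<eta> $ i)\<bar> \<le> b \<and>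
      k * t \<le> defect i \<eta> \<and> defect i \<eta> \<le> t}"
    have mA: "A \<in> sets borel"
      unfolding A_def by (rule sets_sphere_Collect) measurable
    define q where "q = sqrt (d * t)"
    have q: "q > 0" "q\<^sup>2 = d * t" using d t by (simp_all add: q_def)
    define l r :: "complex ^ 'n" where
      "l = (\<chi> j. if j = i then Complex (1/4) 0 else Complex q q)" and
      "r = (\<chi> j. if j = i then Complex (1/2) (b/4) else Complex (2*q) (2*q))"
    have "cbox l r \<subseteq> ball 0 1 \<inter> sgn -` A"
    proof
      fix z assume z: "z \<in> cbox l r"
      have zj: "Re (l $ j) \<le> Re (z $ j)" "Re (z $ j) \<le> Re (r $ j)"
        "Im (l $ j) \<le> Im (z $ j)" "Im (z $ j) \<le> Im (r $ j)" for j
        using z by (auto simp: mem_cbox_complex_vec)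
      have zi: "1/4 \<le> Re (z $ i)" "Re (z $ i) \<le> 1/2" "0 \<le> Im (z $ i)" "Im (z $ i) \<le> b/4"
        using zj[of i] by (auto simp: l_def r_def)
      have oth: "2 * (d * t) \<le> (cmod (z $ j))\<^sup>2" "(cmod (z $ j))\<^sup>2 \<le> 8 * (d * t)" if "j \<noteq> i" for j
      proof -
        have e: "q \<le> Re (z $ j)" "Re (z $ j) \<le> 2 * q" "q \<le> Im (z $ j)" "Im (z $ j) \<le> 2 * q"
          using zj[of j] that by (auto simp: l_def r_def)
        then have "q\<^sup>2 \<le> (Re (z $ j))\<^sup>2" "(Re (z $ j))\<^sup>2 \<le> (2*q)\<^sup>2" "q\<^sup>2 \<le> (Im (z $ j))\<^sup>2" "(Im (z $ j))\<^sup>2 \<le> (2*q)\<^sup>2"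
          using q(1) by - (rule power_mono; linarith)+
        then show "2 * (d * t) \<le> (cmod (z $ j))\<^sup>2" "(cmod (z $ j))\<^sup>2 \<le> 8 * (d * t)"
          by (auto simp: cmod_power2 q power_mult_distrib)
      qed
      define S where "S = (\<Sum>j\<in>UNIV - {i}. (cmod (z $ j))\<^sup>2)"
      have card: "real (card (UNIV - {i})) = m" by (simp add: m_def card_Diff_singleton)
      have S1: "2 * (d * t) * m \<le> S"
        using sum_mono[of "UNIV - {i}" "\<lambda>_. 2 * (d * t)" "\<lambda>j. (cmod (z $ j))\<^sup>2"] oth card
        by (simp add: S_def mult.commute)
      have S2: "S \<le> 8 * (d * t) * m"
        using sum_mono[of "UNIV - {i}" "\<lambda>j. (cmod (z $ j))\<^sup>2" "\<lambda>_. 8 * (d * t)"] oth card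
        by (simp add: S_def mult.commute)
      have dtm: "d * t * m = t / 128"
        using d(2) by (metis mult.assoc mult.commute times_divide_eq_right mult.right_neutral)
      have S1': "t / 64 \<le> S" and S2': "S \<le> t / 16" using S1 S2 unfolding mult.assoc[of _ "d * t"] dtm by simp_all
      have nz: "(norm z)\<^sup>2 = (cmod (z $ i))\<^sup>2 + S" unfolding S_def by (rule norm_power2_split)
      have "(Re (z $ i))\<^sup>2 \<le> (1/2)\<^sup>2" "(Im (z $ i))\<^sup>2 \<le> (1/4)\<^sup>2"
        using zi b by (intro power_mono; simp)+
      then have "(norm z)\<^sup>2 < 1" 
        using S2' t unfolding nz cmod_power2 by (simp add: power2_eq_square)
      then have nz1: "norm z < 1" by (simp add: power_less_one_iff abs_square_less_1)
      have nz4: "1/4 \<le> norm z"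
        using zi(1) abs_Re_le_cmod[of "z $ i"] Finite_Cartesian_Product.norm_nth_le[of z i] by linarith
      then have z0: "z \<noteq> 0" by auto
      have nz16: "1/16 \<le> (norm z)\<^sup>2" using power_mono[OF nz4, of 2] by (simp add: power2_eq_square)
      have dl: "defect i (sgn z) = S / (norm z)\<^sup>2" using z0 by (simp add: defect_sgn S_def)
      have "S / (norm z)\<^sup>2 \<le> t"
      proof -
        have "S \<le> t * (1/16)" using S2' by simp
        also have "\<dots> \<le> t * (norm z)\<^sup>2" using nz16 t by (intro mult_left_mono) auto
        finally show ?thesis using z0 by (simp add: pos_divide_le_eq)
      qed
      moreover have "k * t \<le> S / (norm z)\<^sup>2"
      proof -
        have "k * t * (norm z)\<^sup>2 \<le> k * t * 1"
          using \<open>(norm z)\<^sup>2 < 1\<close> t m by (intro mult_left_mono) (auto simp: k_def)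
        also have "\<dots> \<le> t / 64" using m t by (simp add: k_def field_simps)
        also have "\<dots> \<le> S" by (rule S1')
        finally show ?thesis using z0 by (simp add: pos_le_divide_eq)
      qed
      moreover have "0 < Re (sgn z $ i)"
        using zi z0 by (simp add: sgn_div_norm)
      moreover have "\<bar>Im (sgn z $ i)\<bar> \<le> b"
      proof -
        have "b * (1/4) \<le> b * norm z" using nz4 b by (intro mult_left_mono) auto
        then have "Im (z $ i) \<le> b * norm z" using zi by linarith
        then show ?thesis
          using zi z0 by (simp add: sgn_div_norm abs_mult field_simps)
      qed
      ultimately have "sgn z \<in> A" by (simp add: A_def dl norm_sgn z0)
      then show "z \<in> ball 0 1 \<inter> sgn -` A" using nz1 by simp
    qed
    moreover have sg: "ball 0 1 \<inter> sgn -` A \<in> sets lborel"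
      using measurable_sets[OF measurable_sgn_vec mA] by auto
    ultimately have "emeasure lborel (cbox l r) \<le> emeasure lborel (ball 0 1 \<inter> sgn -` A)"
      by (rule emeasure_mono)
    moreover have "emeasure lborel (cbox l r) = ennreal (\<Prod>j\<in>UNIV. if j = i then b / 16 else d * t)"
      using b t q by (subst emeasure_lborel_cbox_complex_vec)
        (auto simp: l_def r_def power2_eq_square intro!: arg_cong[of _ _ ennreal] prod.cong)
    ultimately have le: "ennreal (b / 16 * (d * t) ^ (CARD('n) - 1)) \<le> emeasure lborel (ball 0 1 \<inter> sgn -` A)"
      by (simp add: prod_if_singled_out)
    have mA': "A \<in> sets sphere_measure"
      using mA by (auto simp: sets_sphere_measure_iff A_def)
    have "ennreal (c * b * t ^ (CARD('n) - 1)) = ennreal (b / 16 * (d * t) ^ (CARD('n) - 1)) / ennreal V"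
      using b t V d by (subst divide_ennreal) (auto simp: c_def power_mult_distrib)
    also have "\<dots> \<le> emeasure lborel (ball 0 1 \<inter> sgn -` A) / ennreal V"
      by (rule divide_right_mono_ennreal[OF le])
    also have "\<dots> = emeasure sphere_measure A"
      using mA by (subst emeasure_sphere_measure) (auto simp: A_def V)
    also have "\<dots> = emeasure sphere_measure (tube_shell i k u b t)"
      using sphere_tube_phase[OF u, where P = "\<lambda>x y. 0 < Re x \<and> \<bar>Im x\<bar> \<le> b \<and> k * t \<le> y \<and> y \<le> t" and i = i] mA'
      by (simp add: A_def)
    finally show "ennreal (c * b * t ^ (CARD('n) - 1)) \<le> emeasure sphere_measure (tube_shell i k u b t)" .
  qed
qed

section \<open>Powers of the defect\<close>

text \<open>
  Almost every point of the region \<open>h x \<le> T\<close> lies in exactly one dyadic shell; on the shell of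
  index \<open>j\<close> the integrand is at most \<open>b j\<close>, and the shell is contained in the sublevel set whose
  measure appears on the right. This reduces integrals of functions of the defect to the volumes of
  tubes.
\<close>
lemma nn_integral_dyadic_le:
  fixes h :: "'a \<Rightarrow> real" and F :: "'a \<Rightarrow> ennreal"
  assumes [measurable]: "h \<in> borel_measurable M" "B \<in> sets M"
    and T: "T > 0" and h0: "\<And>x. x \<in> B \<Longrightarrow> 0 \<le> h x"
    and null: "emeasure M {x \<in> B. h x \<le> 0} = 0"
    and bound: "\<And>x j. x \<in> B \<Longrightarrow> T / 2 ^ Suc j < h x \<Longrightarrow> h x \<le> T / 2 ^ j \<Longrightarrow> F x \<le> b j"
  shows "(\<integral>\<^sup>+x\<in>{x \<in> B. h x \<le> T}. F x \<partial>M) \<le> (\<Sum>j. b j * emeasure M {x \<in> B. h x \<le> T / 2 ^ j})"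
proof -
  have sB: "{x \<in> B. h x \<le> t} \<in> sets M" for t
  proof -
    have "{x \<in> B. h x \<le> t} = {x \<in> space M. h x \<le> t} \<inter> B"
      using sets.sets_into_space[OF assms(2)] by auto
    then show ?thesis by simp
  qed
  have "AE x in M. x \<notin> {x \<in> B. h x \<le> 0}"
    using null sB by (intro AE_not_in) (simp add: null_sets_def)
  then have "(\<integral>\<^sup>+x\<in>{x \<in> B. h x \<le> T}. F x \<partial>M)
    \<le> (\<integral>\<^sup>+x. (\<Sum>j. b j * indicator {x \<in> B. h x \<le> T / 2 ^ j} x) \<partial>M)"
  proof (intro nn_integral_mono_AE, eventually_elim)
    case (elim x)
    show ?case
    proof (cases "x \<in> B \<and> h x \<le> T")
      case True
      then have pos: "h x > 0" using elim by auto
      obtain m where m: "T / 2 ^ m < h x"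
      proof -
        obtain m where "(1/2) ^ m < h x / T"
          using real_arch_pow_inv[of "h x / T" "1/2"] pos T by auto
        then show thesis using that[of m] T by (simp add: field_simps)
      qed
      define k where "k = (LEAST m. T / 2 ^ m < h x)"
      have k: "T / 2 ^ k < h x" unfolding k_def by (rule LeastI, rule m)
      then have "k \<noteq> 0" using True by (cases "k = 0") auto
      then obtain j where j: "k = Suc j" by (cases k) auto
      then have le: "h x \<le> T / 2 ^ j"
        using not_less_Least[of j "\<lambda>m. T / 2 ^ m < h x"] unfolding k_def by auto
      have "F x * indicator {x \<in> B. h x \<le> T} x \<le> F x" by (auto simp: indicator_def)
      also have "\<dots> \<le> b j * indicator {x \<in> B. h x \<le> T / 2 ^ j} x"
        using bound[of x j] True k j le by simp
      also have "\<dots> \<le> (\<Sum>j. b j * indicator {x \<in> B. h x \<le> T / 2 ^ j} x)"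
      proof -
        have "f j \<le> suminf f" for f :: "nat \<Rightarrow> ennreal"
          using sum_le_suminf[of f "{j}"] by simp
        then show ?thesis .
      qed
      finally show ?thesis .
    qed auto
  qed
  also have "\<dots> = (\<Sum>j. b j * emeasure M {x \<in> B. h x \<le> T / 2 ^ j})"
    using sB by (subst nn_integral_suminf) (auto simp: nn_integral_cmult)
  finally show ?thesis .
qed

lemma powr_compare:
  fixes x y K a :: real
  assumes "x > 0" "K \<ge> 1" "x / K \<le> y" "y \<le> K * x"
  shows "x powr a / K powr \<bar>a\<bar> \<le> y powr a" "y powr a \<le> K powr \<bar>a\<bar> * x powr a"
proof -
  have y: "y > 0" using assms by (meson divide_pos_pos less_le_trans zero_less_one)
  have "y powr a \<le> K powr \<bar>a\<bar> * x powr a \<and> x powr a \<le> K powr \<bar>a\<bar> * y powr a"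
  proof (cases "a \<ge> 0")
    case True
    have "x \<le> K * y" using assms by (simp add: field_simps)
    then have "x powr a \<le> (K * y) powr a" "y powr a \<le> (K * x) powr a"
      using assms y True by (auto intro!: powr_mono2)
    then show ?thesis using True assms y by (simp add: powr_mult)
  next
    case False
    have "(K * y) powr a \<le> x powr a" "(K * x) powr a \<le> y powr a"
      using assms y False by (auto intro!: powr_mono2' simp: field_simps)
    then show ?thesis using False assms y
      by (simp add: powr_mult powr_minus field_simps)
  qed
  then show "x powr a / K powr \<bar>a\<bar> \<le> y powr a" "y powr a \<le> K powr \<bar>a\<bar> * x powr a"
    using assms by (simp_all add: field_simps)
qed

text \<open>
  The value 1 on the circle, a null set, makes the weights of opposite exponents pointwise inverse to
  each other; the plain power would vanish there.
\<close>
definition defect_weight :: "'n \<Rightarrow> real \<Rightarrow> complex ^ 'n \<Rightarrow> real" where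
  "defect_weight i a \<eta> = (if defect i \<eta> = 0 then 1 else defect i \<eta> powr a)"

lemma measurable_defect_weight [measurable]: "defect_weight i a \<in> borel_measurable borel"
  unfolding defect_weight_def[abs_def] by measurable

lemma measurable_sphere_measure [simp]:
  "f \<in> borel_measurable borel \<Longrightarrow> f \<in> borel_measurable (sphere_measure :: (complex ^ 'n) measure)"
  unfolding measurable_cong_sets[OF sets_sphere_measure refl]
  by (rule measurable_restrict_space1)

lemma defect_weight_pos: "norm \<eta> = 1 \<Longrightarrow> defect_weight i a \<eta> > 0"
  using defect_nonneg[of \<eta> i] by (auto simp: defect_weight_def)

lemma inverse_defect_weight:
  "norm \<eta> = 1 \<Longrightarrow> inverse (ennreal (defect_weight i a \<eta>)) = ennreal (defect_weight i (- a) \<eta>)"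
  using defect_weight_pos[of \<eta> i a]
  by (simp add: inverse_ennreal) (simp add: defect_weight_def powr_minus)

lemma defect_weight_compare:
  assumes "x > 0" "K \<ge> 1" "x / K \<le> defect i \<eta>" "defect i \<eta> \<le> K * x"
  shows "x powr a / K powr \<bar>a\<bar> \<le> defect_weight i a \<eta>" "defect_weight i a \<eta> \<le> K powr \<bar>a\<bar> * x powr a"
proof -
  have "x / K > 0" using assms by simp
  then have "defect i \<eta> \<noteq> 0" using assms(3) by linarith
  then show "x powr a / K powr \<bar>a\<bar> \<le> defect_weight i a \<eta>" "defect_weight i a \<eta> \<le> K powr \<bar>a\<bar> * x powr a"
    using powr_compare[OF assms] by (auto simp: defect_weight_def)
qed

abbreviation defect_mass :: "'n \<Rightarrow> real \<Rightarrow> (complex ^ 'n) set \<Rightarrow> ennreal" where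
  "defect_mass i a A \<equiv> (\<integral>\<^sup>+\<eta>\<in>A. ennreal (defect_weight i a \<eta>) \<partial>sphere_measure)"

text \<open>
  The shell at defect \<open>T / 2 ^ j\<close> has measure at most a multiple of \<open>R * (T / 2 ^ j) ^ (CARD('n) - 1)\<close>,
  so the dyadic bounds form a geometric series; its ratio is below 1 because the exponent
  \<open>real CARD('n) - 1 + a\<close> is positive.
\<close>
lemma defect_weight_tube:
  fixes i :: "'n::finite"
  assumes n: "CARD('n) > 1" and a: "a > - (real CARD('n) - 1)"
  obtains C where "C > 0" "\<And>u R T. cmod u = 1 \<Longrightarrow> R \<ge> 0 \<Longrightarrow> T > 0 \<Longrightarrow>
    defect_mass i a (sphere_tube i u R T) \<le> ennreal (C * R * T powr (real CARD('n) - 1 + a))"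
proof -
  obtain C0 where C0: "C0 > 0" and tube: "\<And>u b t. cmod u = 1 \<Longrightarrow> b \<ge> 0 \<Longrightarrow> t \<ge> 0 \<Longrightarrow>
    emeasure sphere_measure (sphere_tube i u b t)
      \<le> ennreal (C0 * b * t ^ (CARD('n) - 1))"
    using sphere_tube_upper by blast
  define e where "e = real CARD('n) - 1 + a"
  have e: "e > 0" using a by (simp add: e_def)
  define q where "q = 2 powr (- e)"
  have q: "0 < q" "q < 1" using e by (auto simp: q_def powr_less_one)
  define C where "C = 2 powr \<bar>a\<bar> * C0 / (1 - q)"
  show thesis
  proof (rule that)
    show "C > 0" using C0 q by (simp add: C_def)
    fix u :: complex and R T :: real assume u: "cmod u = 1" and R: "R \<ge> 0" and T: "T > 0"
    define B where "B = {\<eta> :: complex ^ 'n \<in> sphere 0 1. \<bar>Im (u * \<eta> $ i)\<bar> \<le> R}"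
    have "B \<in> sets borel" unfolding B_def by (rule sets_sphere_Collect) measurable
    then have mB: "B \<in> sets sphere_measure" by (auto simp: sets_sphere_measure_iff B_def)
    have tubeB: "emeasure sphere_measure {\<eta> \<in> B. defect i \<eta> \<le> t} \<le> ennreal (C0 * R * t ^ (CARD('n) - 1))"
      if "t \<ge> 0" for t
      using tube[OF u R that] by (simp add: B_def conj_ac)
    have Bs: "sphere_tube i u R T
       = {\<eta> \<in> B. defect i \<eta> \<le> T}"
      by (auto simp: B_def)
    define b where "b j = 2 powr \<bar>a\<bar> * (T / 2 ^ j) powr a" for j
    have "(\<integral>\<^sup>+\<eta>\<in>{\<eta> \<in> B. defect i \<eta> \<le> T}. ennreal (defect_weight i a \<eta>) \<partial>sphere_measure)
      \<le> (\<Sum>j. ennreal (b j) * emeasure sphere_measure {\<eta> \<in> B. defect i \<eta> \<le> T / 2 ^ j})"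
    proof (rule nn_integral_dyadic_le)
      show "0 \<le> defect i \<eta>" if "\<eta> \<in> B" for \<eta> using that by (auto simp: B_def defect_nonneg)
      have "emeasure sphere_measure {\<eta> \<in> B. defect i \<eta> \<le> 0} \<le> 0"
        using tubeB[of 0] n by (simp add: power_0_left)
      then show "emeasure sphere_measure {\<eta> \<in> B. defect i \<eta> \<le> 0} = 0" by simp
      fix \<eta> j assume "\<eta> \<in> B" "T / 2 ^ Suc j < defect i \<eta>" "defect i \<eta> \<le> T / 2 ^ j"
      moreover from this(3) have "defect i \<eta> \<le> 2 * (T / 2 ^ j)"
        using T by (smt (verit) divide_pos_pos zero_less_power)
      ultimately have "defect_weight i a \<eta> \<le> b j"
        unfolding b_def using T by (intro defect_weight_compare) auto
      then show "ennreal (defect_weight i a \<eta>) \<le> ennreal (b j)" by (rule ennreal_leI)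
    qed (use mB T in auto)
    also have "\<dots> \<le> (\<Sum>j. ennreal (b j) * ennreal (C0 * R * (T / 2 ^ j) ^ (CARD('n) - 1)))"
      using T by (intro suminf_le mult_left_mono tubeB) auto
    also have "\<dots> = (\<Sum>j. ennreal (2 powr \<bar>a\<bar> * C0 * R * T powr e * q ^ j))"
    proof (rule suminf_cong)
      fix j
      have "(T / 2 ^ j) powr a * (T / 2 ^ j) ^ (CARD('n) - 1) = (T / 2 ^ j) powr e"
        using T n by (simp add: e_def powr_add[symmetric] powr_realpow[symmetric] of_nat_diff add.commute)
      also have "\<dots> = T powr e * q ^ j"
        using T by (simp add: q_def powr_divide powr_realpow[symmetric] powr_powr powr_minus_divide mult.commute)
      finally have "b j * (C0 * R * (T / 2 ^ j) ^ (CARD('n) - 1)) = 2 powr \<bar>a\<bar> * C0 * R * T powr e * q ^ j"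
        by (simp add: b_def mult_ac)
      moreover have "ennreal (b j) * ennreal (C0 * R * (T / 2 ^ j) ^ (CARD('n) - 1))
        = ennreal (b j * (C0 * R * (T / 2 ^ j) ^ (CARD('n) - 1)))"
        using C0 R T by (intro ennreal_mult[symmetric]) (auto simp: b_def)
      ultimately show "ennreal (b j) * ennreal (C0 * R * (T / 2 ^ j) ^ (CARD('n) - 1))
        = ennreal (2 powr \<bar>a\<bar> * C0 * R * T powr e * q ^ j)"
        by (simp only:)
    qed
    also have "\<dots> = ennreal (C * R * T powr e)"
    proof -
      have "(\<lambda>j. 2 powr \<bar>a\<bar> * C0 * R * T powr e * q ^ j) sums (2 powr \<bar>a\<bar> * C0 * R * T powr e * (1 / (1 - q)))"
        using q by (intro sums_mult geometric_sums) simp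
      then show ?thesis
        using C0 R q by (intro suminf_ennreal_eq) (auto simp: C_def)
    qed
    finally show "defect_mass i a (sphere_tube i u R T) \<le> ennreal (C * R * T powr (real CARD('n) - 1 + a))"
      unfolding Bs e_def .
  qed
qed

section \<open>Nonisotropic balls and their weighted measure\<close>

lemma cdot_axis: "cdot (axis i c) \<eta> = c * cnj (\<eta> $ i)"
proof -
  have "cdot (axis i c) \<eta> = (\<Sum>j\<in>UNIV. if j = i then c * cnj (\<eta> $ i) else 0)"
    unfolding cdot_def by (rule sum.cong) (auto simp: axis_def)
  then show ?thesis by simp
qed

lemma norm_axis_complex [simp]: "norm (axis i c :: complex ^ 'n) = cmod c"
  using norm_power2_split[of "axis i c" i] by (simp add: axis_def)

lemma nonisotropic_ball_axis_tube:
  assumes u: "cmod u = 1" and eta: "\<eta> \<in> nonisotropic_ball (axis i u) r"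
  shows "\<bar>Im (cnj u * \<eta> $ i)\<bar> < r" "defect i \<eta> < 2 * r"
proof -
  have "cmod (1 - cnj u * \<eta> $ i) = cmod (1 - cdot (axis i u) \<eta>)"
    using complex_mod_cnj[of "1 - cnj u * \<eta> $ i"] by (simp add: cdot_axis)
  then have lt: "cmod (1 - cnj u * \<eta> $ i) < r" and n: "norm \<eta> = 1"
    using eta by (auto simp: nonisotropic_ball_def)
  have "\<bar>Im (cnj u * \<eta> $ i)\<bar> = \<bar>Im (1 - cnj u * \<eta> $ i)\<bar>" by simp
  also have "\<dots> \<le> cmod (1 - cnj u * \<eta> $ i)" by (rule abs_Im_le_cmod)
  finally show "\<bar>Im (cnj u * \<eta> $ i)\<bar> < r" using lt by simp
  have "1 - cmod (\<eta> $ i) \<le> cmod (1 - cnj u * \<eta> $ i)"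
    using norm_triangle_ineq2[of 1 "cnj u * \<eta> $ i"] u by (simp add: norm_mult)
  then have lt': "(1 - cmod (\<eta> $ i)) * 2 < 2 * r" using lt by simp
  have le: "cmod (\<eta> $ i) \<le> 1" using Finite_Cartesian_Product.norm_nth_le[of \<eta> i] n by simp
  have "defect i \<eta> = (1 - cmod (\<eta> $ i)) * (1 + cmod (\<eta> $ i))"
    by (simp add: defect_def power2_eq_square algebra_simps)
  also have "\<dots> \<le> (1 - cmod (\<eta> $ i)) * 2"
    using le by (intro mult_left_mono) auto
  finally show "defect i \<eta> < 2 * r" using lt' by (rule le_less_trans)
qed

lemma nonisotropic_ball_axis_contains:
  assumes u: "cmod u = 1" and eta: "norm \<eta> = 1" "0 < Re (u * \<eta> $ i)" "\<bar>Im (u * \<eta> $ i)\<bar> \<le> b"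
    and b: "0 \<le> b" "b \<le> 1" and t: "defect i \<eta> \<le> t"
  shows "cmod (1 - cdot (axis i (cnj u)) \<eta>) \<le> t + 2 * b"
proof -
  let ?z = "u * \<eta> $ i"
  have "cmod ?z = cmod (\<eta> $ i)" using u by (simp add: norm_mult)
  then have sq: "1 - (Re ?z)\<^sup>2 = defect i \<eta> + (Im ?z)\<^sup>2"
    unfolding defect_def \<open>cmod ?z = cmod (\<eta> $ i)\<close>[symmetric] using cmod_power2[of ?z] by linarith
  have z1: "cmod ?z \<le> 1" 
    using u Finite_Cartesian_Product.norm_nth_le[of \<eta> i] eta by (simp add: norm_mult)
  have re1: "Re ?z \<le> 1" using z1 complex_Re_le_cmod[of ?z] by linarith
  have "(Re ?z)\<^sup>2 \<le> Re ?z" using re1 eta(2) by (simp add: power2_eq_square mult_le_cancel_left1 del: times_complex.sel)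
  moreover have "(Im ?z)\<^sup>2 \<le> b\<^sup>2" using eta(3) by (simp add: abs_le_square_iff[symmetric] b del: times_complex.sel)
  moreover have "b\<^sup>2 \<le> b" using b by (simp add: power2_eq_square mult_left_le)
  ultimately have "1 - Re ?z \<le> t + b" using sq t by linarith
  moreover have "cmod (1 - ?z) \<le> \<bar>1 - Re ?z\<bar> + \<bar>Im ?z\<bar>"
    using cmod_le[of "1 - ?z"] by simp
  ultimately have "cmod (1 - ?z) \<le> t + 2 * b" using eta(3) re1 by linarith
  moreover have "cmod (1 - ?z) = cmod (1 - cdot (axis i (cnj u)) \<eta>)"
    using complex_mod_cnj[of "1 - ?z"] by (simp add: cdot_axis)
  ultimately show ?thesis by simp
qed

text \<open>
  By unitary invariance the centre may be put on the circle. There a nonisotropic ball lies in a tube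
  with \<open>b = r\<close> and \<open>t = 2 * r\<close>, and it contains the tube shell with \<open>b = t = r / 4\<close>. The
  exponent of \<open>r\<close> is 1 for the direction of the circle plus \<open>CARD('n) - 1\<close> for the defect. The bound
  \<open>r \<le> 3\<close> covers all radii, since a ball of radius more than 2 is the whole sphere.
\<close>
lemma nonisotropic_ball_measure:
  assumes n: "CARD('n::finite) > 1"
  obtains c C where "c > 0" "C > 0"
    "\<And>\<zeta> r. norm (\<zeta> :: complex ^ 'n) = 1 \<Longrightarrow> 0 < r \<Longrightarrow> r \<le> 3 \<Longrightarrow>
      ennreal (c * r ^ CARD('n)) \<le> emeasure sphere_measure (nonisotropic_ball \<zeta> r)"
    "\<And>\<zeta> r. norm (\<zeta> :: complex ^ 'n) = 1 \<Longrightarrow> 0 < r \<Longrightarrow> 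
      emeasure sphere_measure (nonisotropic_ball \<zeta> r) \<le> ennreal (C * r ^ CARD('n))"
proof -
  fix i :: 'n
  obtain C0 where C0: "C0 > 0" and up: "\<And>u b t. cmod u = 1 \<Longrightarrow> b \<ge> 0 \<Longrightarrow> t \<ge> 0 \<Longrightarrow>
    emeasure sphere_measure (sphere_tube i u b t)
      \<le> ennreal (C0 * b * t ^ (CARD('n) - 1))"
    using sphere_tube_upper by blast
  obtain k c0 where k: "0 < k" "k < 1" "0 < c0" and low: "\<And>u b t. cmod u = 1 \<Longrightarrow> 0 < b \<Longrightarrow> b \<le> 1 \<Longrightarrow> 0 < t \<Longrightarrow> t \<le> 1 \<Longrightarrow>
    ennreal (c0 * b * t ^ (CARD('n) - 1)) \<le> emeasure sphere_measure (tube_shell i k u b t)"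
    using sphere_tube_lower[OF n] by blast
  have move: "emeasure sphere_measure (nonisotropic_ball \<zeta> r) = emeasure sphere_measure (nonisotropic_ball (axis i 1) r)"
    if z: "norm \<zeta> = 1" for \<zeta> :: "complex ^ 'n" and r
  proof -
    obtain U where U: "unitary_map U" "U \<zeta> = axis i 1"
      using unitary_map_transitive[of \<zeta> "axis i 1"] z by auto
    then show ?thesis
      using emeasure_sphere_unitary[OF U(1), of "nonisotropic_ball (axis i 1) r"]
        nonisotropic_ball_unitary[OF U(1), of \<zeta> r] by (simp add: sets_nonisotropic_ball)
  qed
  note pw = power_CARD_rec[where 'n = 'n]
  show thesis
  proof (rule that)
    show "c0 / 4 ^ CARD('n) > 0" "C0 * 2 ^ (CARD('n) - 1) > 0" using k C0 by auto
    fix \<zeta> :: "complex ^ 'n" and r :: real assume z: "norm \<zeta> = 1" and r: "0 < r"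
    have "emeasure sphere_measure (nonisotropic_ball (axis i 1) r)
      \<le> emeasure sphere_measure (sphere_tube i 1 r (2 * r))"
    proof (rule emeasure_mono)
      show "nonisotropic_ball (axis i 1) r
        \<subseteq> sphere_tube i 1 r (2 * r)"
        using nonisotropic_ball_axis_tube[of 1 _ i r] by (fastforce simp: nonisotropic_ball_def)
      have "sphere_tube i 1 r (2 * r) \<in> sets borel"
        by (rule sets_sphere_Collect) measurable
      then show "sphere_tube i 1 r (2 * r) \<in> sets sphere_measure"
        by (auto simp: sets_sphere_measure_iff)
    qed
    also have "\<dots> \<le> ennreal (C0 * r * (2 * r) ^ (CARD('n) - 1))"
      using r by (intro up) auto
    also have "C0 * r * (2 * r) ^ (CARD('n) - 1) = C0 * 2 ^ (CARD('n) - 1) * r ^ CARD('n)"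
      unfolding pw[of r, symmetric] by (simp add: power_mult_distrib)
    finally show "emeasure sphere_measure (nonisotropic_ball \<zeta> r) \<le> ennreal (C0 * 2 ^ (CARD('n) - 1) * r ^ CARD('n))"
      by (simp add: move[OF z])
    assume r3: "r \<le> 3"
    have "c0 / 4 ^ CARD('n) * r ^ CARD('n) = c0 * (r/4) * (r/4) ^ (CARD('n) - 1)"
      by (simp only: mult.assoc pw) (simp add: power_divide)
    also have "ennreal \<dots> \<le> emeasure sphere_measure (tube_shell i k 1 (r/4) (r/4))"
      using r r3 by (intro low) auto
    also have "\<dots> \<le> emeasure sphere_measure (nonisotropic_ball (axis i 1) r)"
    proof (rule emeasure_mono)
      show "tube_shell i k 1 (r/4) (r/4)
        \<subseteq> nonisotropic_ball (axis i 1) r"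
        using nonisotropic_ball_axis_contains[of 1 _ i "r/4" "r/4"] r r3
        by (fastforce simp: nonisotropic_ball_def)
    qed (rule sets_nonisotropic_ball)
    finally show "ennreal (c0 / 4 ^ CARD('n) * r ^ CARD('n)) \<le> emeasure sphere_measure (nonisotropic_ball \<zeta> r)"
      by (simp add: move[OF z])
  qed
qed

text \<open>
  The root of the defect is the norm of the projection to the other coordinates, hence
  1-Lipschitz, and on the sphere the squared Euclidean distance is twice the real part of
  \<open>1 - cdot \<zeta> \<eta>\<close>.
\<close>
lemma sqrt_defect_ball:
  fixes \<zeta> :: "complex ^ 'n" and i :: 'n
  assumes z: "norm \<zeta> = 1" and eta: "\<eta> \<in> nonisotropic_ball \<zeta> r"
  shows "\<bar>sqrt (defect i \<eta>) - sqrt (defect i \<zeta>)\<bar> \<le> sqrt (2 * r)"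
proof -
  define P where "P x = x - axis i (x $ i)" for x :: "complex ^ 'n"
  have P2: "(norm (P x))\<^sup>2 = (\<Sum>j\<in>UNIV - {i}. (cmod (x $ j))\<^sup>2)" for x
  proof -
    have "P x $ j = (if j = i then 0 else x $ j)" for j by (simp add: P_def axis_def)
    then show ?thesis unfolding norm_power2_split[of "P x" i] by simp
  qed
  have Pd: "norm (P x) = sqrt (defect i x)" if "norm x = 1" for x
    by (rule real_sqrt_unique[symmetric]) (simp_all add: P2 defect_sphere[OF that])
  have Pl: "norm (P x) \<le> norm x" for x
    using P2[of x] norm_power2_split[of x i] by (intro power2_le_imp_le[OF _ norm_ge_zero]) (simp only:, simp)
  have Pm: "P x - P y = P (x - y)" for x y
    by (simp add: P_def vec_eq_iff axis_def)
  have n: "norm \<eta> = 1" "cmod (1 - cdot \<zeta> \<eta>) < r" using eta by (auto simp: nonisotropic_ball_def)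
  have "(norm (\<zeta> - \<eta>))\<^sup>2 \<le> 2 * r"
    unfolding norm_diff_sphere[OF z n(1)] using complex_Re_le_cmod[of "1 - cdot \<zeta> \<eta>"] n(2) by linarith
  then have "norm (\<eta> - \<zeta>) \<le> sqrt (2 * r)"
    by (simp add: norm_minus_commute real_le_rsqrt)
  moreover have "\<bar>norm (P \<eta>) - norm (P \<zeta>)\<bar> \<le> norm (\<eta> - \<zeta>)"
    using norm_triangle_ineq3[of "P \<eta>" "P \<zeta>"] Pl[of "\<eta> - \<zeta>"] by (simp add: Pm)
  ultimately show ?thesis by (simp add: Pd n z)
qed

text \<open>
  The nearest point of the circle has nonisotropic distance at most \<open>defect i \<zeta>\<close> from \<open>\<zeta>\<close>, and the
  quasi-triangle inequality gives the factor \<open>18 = 2 * (8 + 1)\<close>. If the coordinate \<open>i\<close> of \<open>\<zeta>\<close>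
  vanishes, every point of the circle will do.
\<close>
lemma nonisotropic_ball_near_circle:
  fixes \<zeta> :: "complex ^ 'n" and i :: 'n
  assumes z: "norm \<zeta> = 1" and near: "defect i \<zeta> < 8 * r"
  obtains u where "cmod u = 1" "nonisotropic_ball \<zeta> r \<subseteq> nonisotropic_ball (axis i u) (18 * r)"
proof -
  define u where "u = (if \<zeta> $ i = 0 then 1 else sgn (\<zeta> $ i))"
  have u: "cmod u = 1" by (simp add: u_def norm_sgn)
  have z1: "cmod (\<zeta> $ i) \<le> 1" using Finite_Cartesian_Product.norm_nth_le[of \<zeta> i] z by simp
  have "u * cnj (\<zeta> $ i) = of_real (cmod (\<zeta> $ i))"
    by (simp add: u_def sgn_div_norm scaleR_conv_of_real complex_mult_cnj_norm power2_eq_square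
        mult.assoc inverse_eq_divide)
  then have "cmod (1 - cdot (axis i u) \<zeta>) = cmod (of_real (1 - cmod (\<zeta> $ i)))"
    by (simp add: cdot_axis)
  also have "\<dots> = 1 - cmod (\<zeta> $ i)" using z1 by (simp only: norm_of_real)
  also have "\<dots> \<le> defect i \<zeta>"
    using z1 by (simp add: defect_def power2_eq_square mult_left_le)
  finally have d: "cmod (1 - cdot (axis i u) \<zeta>) < 8 * r" using near by simp
  show thesis
  proof (rule that[OF u], rule subsetI)
    fix \<eta> assume e: "\<eta> \<in> nonisotropic_ball \<zeta> r"
    then have n: "norm \<eta> = 1" "cmod (1 - cdot \<zeta> \<eta>) < r" by (auto simp: nonisotropic_ball_def)
    have "cmod (1 - cdot (axis i u) \<eta>) \<le> 2 * (cmod (1 - cdot (axis i u) \<zeta>) + cmod (1 - cdot \<zeta> \<eta>))"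
      by (rule nonisotropic_quasi_triangle) (simp_all add: u z n)
    also have "\<dots> < 2 * (8 * r + r)"
      using d n by (intro mult_strict_left_mono add_strict_mono) auto
    finally have "cmod (1 - cdot (axis i u) \<eta>) < 18 * r" by simp
    then show "\<eta> \<in> nonisotropic_ball (axis i u) (18 * r)" using n by (simp add: nonisotropic_ball_def)
  qed
qed

lemma defect_comparable_far:
  fixes \<zeta> :: "complex ^ 'n" and i :: 'n
  assumes z: "norm \<zeta> = 1" and far: "8 * r \<le> defect i \<zeta>" and eta: "\<eta> \<in> nonisotropic_ball \<zeta> r"
  shows "defect i \<zeta> / 4 \<le> defect i \<eta>" "defect i \<eta> \<le> 4 * defect i \<zeta>"
proof -
  have e: "norm \<eta> = 1" using eta by (simp add: nonisotropic_ball_def)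
  define x y where "x = sqrt (defect i \<zeta>)" and "y = sqrt (defect i \<eta>)"
  have xy: "x\<^sup>2 = defect i \<zeta>" "y\<^sup>2 = defect i \<eta>" "0 \<le> x" "0 \<le> y"
    using defect_nonneg[OF z, of i] defect_nonneg[OF e, of i] by (simp_all add: x_def y_def)
  have "sqrt (2 * r) \<le> sqrt ((x / 2)\<^sup>2)"
    unfolding real_sqrt_le_iff using far xy by (simp add: power_divide)
  then have "sqrt (2 * r) \<le> x / 2" using xy by simp
  then have d: "\<bar>y - x\<bar> \<le> x / 2"
    using sqrt_defect_ball[OF z eta, of i] by (simp add: x_def y_def)
  have "(x / 2)\<^sup>2 \<le> y\<^sup>2" using d xy by (intro power_mono) linarith+
  then show "defect i \<zeta> / 4 \<le> defect i \<eta>" using xy by (simp add: power_divide)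
  have "y\<^sup>2 \<le> (2 * x)\<^sup>2" using d xy by (intro power_mono) linarith+
  then show "defect i \<eta> \<le> 4 * defect i \<zeta>" using xy by (simp add: power_mult_distrib)
qed

lemma set_nn_integral_bounds:
  assumes A: "A \<in> sets M" and c: "0 \<le> c"
  shows "(\<And>x. x \<in> A \<Longrightarrow> c \<le> f x) \<Longrightarrow> ennreal c * emeasure M A \<le> (\<integral>\<^sup>+x\<in>A. ennreal (f x) \<partial>M)"
    and "(\<And>x. x \<in> A \<Longrightarrow> f x \<le> c) \<Longrightarrow> (\<integral>\<^sup>+x\<in>A. ennreal (f x) \<partial>M) \<le> ennreal c * emeasure M A"
proof -
  have eq: "ennreal c * emeasure M A = (\<integral>\<^sup>+x\<in>A. ennreal c \<partial>M)"
    using A by (simp add: nn_integral_cmult_indicator)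
  show "(\<And>x. x \<in> A \<Longrightarrow> c \<le> f x) \<Longrightarrow> ennreal c * emeasure M A \<le> (\<integral>\<^sup>+x\<in>A. ennreal (f x) \<partial>M)"
    unfolding eq by (intro nn_integral_mono) (auto simp: indicator_def intro: ennreal_leI)
  show "(\<And>x. x \<in> A \<Longrightarrow> f x \<le> c) \<Longrightarrow> (\<integral>\<^sup>+x\<in>A. ennreal (f x) \<partial>M) \<le> ennreal c * emeasure M A"
    unfolding eq by (intro nn_integral_mono) (auto simp: indicator_def intro: ennreal_leI)
qed

text \<open>
  This estimate contains both conditions on the weight. If the ball is far from the circle,
  \<open>8 * r \<le> defect i \<zeta>\<close>, the weight is comparable to its value at the centre. If it is near, the ball
  lies in a tube of width and height of order \<open>r\<close>, which gives the upper bound. For the lower bound a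
  thinner tube, of height \<open>k * r\<close>, is removed: it takes away at most half of the measure known
  to be there, and on the rest the weight is comparable to \<open>r powr a\<close>, whatever the sign of \<open>a\<close>.
\<close>
lemma defect_weight_ball:
  fixes i :: "'n::finite"
  assumes n: "CARD('n) > 1" and a: "a > - (real CARD('n) - 1)"
  obtains c C where "c > 0" "C > 0"
    "\<And>\<zeta> r. norm (\<zeta> :: complex ^ 'n) = 1 \<Longrightarrow> 0 < r \<Longrightarrow> r \<le> 3 \<Longrightarrow>
      ennreal (c * (r ^ CARD('n) * max r (defect i \<zeta>) powr a))
        \<le> defect_mass i a (nonisotropic_ball \<zeta> r)"
    "\<And>\<zeta> r. norm (\<zeta> :: complex ^ 'n) = 1 \<Longrightarrow> 0 < r \<Longrightarrow> r \<le> 3 \<Longrightarrow>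
      defect_mass i a (nonisotropic_ball \<zeta> r)
        \<le> ennreal (C * (r ^ CARD('n) * max r (defect i \<zeta>) powr a))"
proof -
  let ?N = "CARD('n)"
  obtain c0 C0 where c0: "c0 > 0" "C0 > 0"
    and low: "\<And>\<zeta> r. norm (\<zeta> :: complex ^ 'n) = 1 \<Longrightarrow> 0 < r \<Longrightarrow> r \<le> 3 \<Longrightarrow>
      ennreal (c0 * r ^ ?N) \<le> emeasure sphere_measure (nonisotropic_ball \<zeta> r)"
    and up: "\<And>\<zeta> r. norm (\<zeta> :: complex ^ 'n) = 1 \<Longrightarrow> 0 < r \<Longrightarrow> 
      emeasure sphere_measure (nonisotropic_ball \<zeta> r) \<le> ennreal (C0 * r ^ ?N)"
    using nonisotropic_ball_measure[OF n] by blast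
  obtain Ct where Ct: "Ct > 0" and tube: "\<And>u b t. cmod u = 1 \<Longrightarrow> b \<ge> 0 \<Longrightarrow> t \<ge> 0 \<Longrightarrow>
    emeasure sphere_measure (sphere_tube i u b t)
      \<le> ennreal (Ct * b * t ^ (?N - 1))"
    using sphere_tube_upper by blast
  obtain Cw where Cw: "Cw > 0" and wtube: "\<And>u R T. cmod u = 1 \<Longrightarrow> R \<ge> 0 \<Longrightarrow> T > 0 \<Longrightarrow>
    defect_mass i a (sphere_tube i u R T) \<le> ennreal (Cw * R * T powr (real ?N - 1 + a))"
    using defect_weight_tube[OF n a] by blast
  \<comment> \<open>Small enough for the tube of width \<open>18 * r\<close> and height \<open>k * r\<close> to have at most half of the least possible measure of the ball.\<close>
  define k where "k = min 1 (c0 / (36 * Ct))"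
  have k: "0 < k" "k \<le> 1" "36 * Ct * k \<le> c0"
    using c0 Ct by (auto simp: k_def min_def field_simps)
  \<comment> \<open>On the remaining part the defect is between \<open>k * r\<close> and \<open>36 * r\<close>, and \<open>max r (defect i \<zeta>)\<close> is between \<open>r\<close> and \<open>8 * r\<close>.\<close>
  define K where "K = 288 / k"
  have K: "K \<ge> 288" using k by (simp add: K_def field_simps)
  define c where "c = min (c0 / 4 powr \<bar>a\<bar>) (c0 / 2 / K powr \<bar>a\<bar>)"
  define C where "C = max (4 powr \<bar>a\<bar> * C0) (Cw * 18 * 36 powr (real ?N - 1 + a) * 8 powr \<bar>a\<bar>)"
  note pw = power_CARD_rec[where 'n = 'n]
  define W where "W A = defect_mass i a A" for A :: "(complex ^ 'n) set"
  have W_mono: "W A \<le> W B" if "A \<subseteq> B" for A B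
    unfolding W_def using that by (intro nn_integral_mono) (auto simp: indicator_def)
  have main: "ennreal (c * (r ^ ?N * max r (defect i \<zeta>) powr a)) \<le> W (nonisotropic_ball \<zeta> r) \<and>
    W (nonisotropic_ball \<zeta> r) \<le> ennreal (C * (r ^ ?N * max r (defect i \<zeta>) powr a))"
    if z: "norm \<zeta> = 1" and r: "0 < r" "r \<le> 3" for \<zeta> :: "complex ^ 'n" and r
  proof (cases "8 * r \<le> defect i \<zeta>")
    case True
    define h where "h = defect i \<zeta>"
    have h: "h > 0" "max r h = h" using True r by (auto simp: h_def)
    have cmp: "h powr a / 4 powr \<bar>a\<bar> \<le> defect_weight i a \<eta> \<and> defect_weight i a \<eta> \<le> 4 powr \<bar>a\<bar> * h powr a"
      if "\<eta> \<in> nonisotropic_ball \<zeta> r" for \<eta>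
      using defect_weight_compare[of h 4 i \<eta> a] defect_comparable_far[OF z True that] h by (simp add: h_def)
    have "ennreal (c * (r ^ ?N * h powr a)) \<le> ennreal (h powr a / 4 powr \<bar>a\<bar>) * ennreal (c0 * r ^ ?N)"
    proof -
      have "c * (r ^ ?N * h powr a) \<le> c0 / 4 powr \<bar>a\<bar> * (r ^ ?N * h powr a)"
        using r by (intro mult_right_mono) (auto simp: c_def)
      also have "\<dots> = h powr a / 4 powr \<bar>a\<bar> * (c0 * r ^ ?N)" by simp
      finally show ?thesis using c0 r by (subst ennreal_mult[symmetric]) (auto intro!: ennreal_leI)
    qed
    also have "\<dots> \<le> ennreal (h powr a / 4 powr \<bar>a\<bar>) * emeasure sphere_measure (nonisotropic_ball \<zeta> r)"
      by (intro mult_left_mono low z r) simp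
    also have "\<dots> \<le> W (nonisotropic_ball \<zeta> r)"
      unfolding W_def using cmp by (intro set_nn_integral_bounds sets_nonisotropic_ball) auto
    finally have 1: "ennreal (c * (r ^ ?N * h powr a)) \<le> W (nonisotropic_ball \<zeta> r)" .
    have "W (nonisotropic_ball \<zeta> r) \<le> ennreal (4 powr \<bar>a\<bar> * h powr a) * emeasure sphere_measure (nonisotropic_ball \<zeta> r)"
      unfolding W_def using cmp by (intro set_nn_integral_bounds sets_nonisotropic_ball) auto
    also have "\<dots> \<le> ennreal (4 powr \<bar>a\<bar> * h powr a) * ennreal (C0 * r ^ ?N)"
      by (intro mult_left_mono up z r) simp
    also have "\<dots> \<le> ennreal (C * (r ^ ?N * h powr a))"
    proof -
      have "4 powr \<bar>a\<bar> * h powr a * (C0 * r ^ ?N) = 4 powr \<bar>a\<bar> * C0 * (r ^ ?N * h powr a)" by simp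
      also have "\<dots> \<le> C * (r ^ ?N * h powr a)"
        using r by (intro mult_right_mono) (auto simp: C_def)
      finally show ?thesis using c0 r by (subst ennreal_mult[symmetric]) (auto intro!: ennreal_leI)
    qed
    finally have 2: "W (nonisotropic_ball \<zeta> r) \<le> ennreal (C * (r ^ ?N * h powr a))" .
    show ?thesis using 1 2 h by (simp add: h_def)
  next
    case False
    have near: "defect i \<zeta> < 8 * r" using False by (simp add: not_le)
    define m where "m = max r (defect i \<zeta>)"
    have m: "r \<le> m" "m \<le> 8 * r" "m > 0" using near r unfolding m_def by linarith+
    obtain u where u: "cmod u = 1" and sub: "nonisotropic_ball \<zeta> r \<subseteq> nonisotropic_ball (axis i u) (18 * r)"
      using nonisotropic_ball_near_circle[OF z near] by blast
    have tb: "\<bar>Im (cnj u * \<eta> $ i)\<bar> \<le> 18 * r \<and> defect i \<eta> \<le> 36 * r \<and> norm \<eta> = 1"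
      if "\<eta> \<in> nonisotropic_ball \<zeta> r" for \<eta>
      using nonisotropic_ball_axis_tube[OF u, of \<eta> i "18 * r"] sub that
      by (force simp: nonisotropic_ball_def)
    have cu: "cmod (cnj u) = 1" using u by simp
    have "W (nonisotropic_ball \<zeta> r)
      \<le> W (sphere_tube i (cnj u) (18 * r) (36 * r))"
      using tb by (intro W_mono) auto
    also have "\<dots> \<le> ennreal (Cw * (18 * r) * (36 * r) powr (real ?N - 1 + a))"
      unfolding W_def using r by (intro wtube cu) auto
    also have "\<dots> \<le> ennreal (C * (r ^ ?N * m powr a))"
    proof (rule ennreal_leI)
      have "Cw * (18 * r) * (36 * r) powr (real ?N - 1 + a)
        = Cw * 18 * 36 powr (real ?N - 1 + a) * (r ^ ?N * r powr a)"
        using r n unfolding pw[of r, symmetric]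
        by (simp add: powr_mult powr_add powr_realpow[symmetric] of_nat_diff powr_diff)
      also have "\<dots> \<le> Cw * 18 * 36 powr (real ?N - 1 + a) * (r ^ ?N * (8 powr \<bar>a\<bar> * m powr a))"
        using r m Cw powr_compare[of m 8 r a] by (intro mult_left_mono) auto
      also have "\<dots> = Cw * 18 * 36 powr (real ?N - 1 + a) * 8 powr \<bar>a\<bar> * (r ^ ?N * m powr a)" by simp
      also have "\<dots> \<le> C * (r ^ ?N * m powr a)"
        using r by (intro mult_right_mono) (auto simp: C_def)
      finally show "Cw * (18 * r) * (36 * r) powr (real ?N - 1 + a) \<le> C * (r ^ ?N * m powr a)" .
    qed
    finally have 2: "W (nonisotropic_ball \<zeta> r) \<le> ennreal (C * (r ^ ?N * m powr a))" .
    define S where "S = sphere_tube i (cnj u) (18 * r) (k * r)"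
    have "S \<in> sets borel" unfolding S_def by (rule sets_sphere_Collect) measurable
    then have mS: "S \<in> sets sphere_measure" by (auto simp: S_def sets_sphere_measure_iff)
    define B' where "B' = nonisotropic_ball \<zeta> r - S"
    have mB': "B' \<in> sets sphere_measure" unfolding B'_def using mS sets_nonisotropic_ball by blast
    have "ennreal (c0 * r ^ ?N) \<le> emeasure sphere_measure (nonisotropic_ball \<zeta> r)"
      by (rule low[OF z r])
    also have "\<dots> \<le> emeasure sphere_measure (B' \<union> S)"
      using mB' mS by (intro emeasure_mono) (auto simp: B'_def)
    also have "\<dots> \<le> emeasure sphere_measure B' + emeasure sphere_measure S"
      by (rule emeasure_subadditive[OF mB' mS])
    also have "emeasure sphere_measure S \<le> ennreal (Ct * (18 * r) * (k * r) ^ (?N - 1))"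
      unfolding S_def using r k by (intro tube cu) auto
    also have "\<dots> \<le> ennreal (c0 / 2 * r ^ ?N)"
    proof (rule ennreal_leI)
      have "k ^ (?N - 1) \<le> k ^ 1" using k n by (intro power_decreasing) auto
      then have "Ct * 18 * r ^ ?N * k ^ (?N - 1) \<le> Ct * 18 * r ^ ?N * k"
        using Ct r by (intro mult_left_mono) auto
      also have "\<dots> = 36 * Ct * k / 2 * r ^ ?N" by simp
      also have "\<dots> \<le> c0 / 2 * r ^ ?N" using k r by (intro mult_right_mono) auto
      finally show "Ct * (18 * r) * (k * r) ^ (?N - 1) \<le> c0 / 2 * r ^ ?N"
        unfolding pw[of r, symmetric] by (simp add: power_mult_distrib mult_ac)
    qed
    finally have "ennreal (c0 * r ^ ?N) \<le> emeasure sphere_measure B' + ennreal (c0 / 2 * r ^ ?N)"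
      by (simp add: add_left_mono)
    moreover have "ennreal (c0 * r ^ ?N) = ennreal (c0 / 2 * r ^ ?N) + ennreal (c0 / 2 * r ^ ?N)"
      using c0 r by (subst ennreal_plus[symmetric]) (auto simp: field_simps)
    ultimately have B'low: "ennreal (c0 / 2 * r ^ ?N) \<le> emeasure sphere_measure B'"
      by (simp add: add.commute[of "emeasure sphere_measure B'"] ennreal_add_left_cancel_le)
    have "c * (r ^ ?N * m powr a) \<le> c0 / 2 / K powr \<bar>a\<bar> * (r ^ ?N * m powr a)"
      using r by (intro mult_right_mono) (auto simp: c_def)
    also have "\<dots> = m powr a / K powr \<bar>a\<bar> * (c0 / 2 * r ^ ?N)" by (simp add: mult_ac)
    finally have "ennreal (c * (r ^ ?N * m powr a)) \<le> ennreal (m powr a / K powr \<bar>a\<bar>) * ennreal (c0 / 2 * r ^ ?N)"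
      using c0 r by (subst ennreal_mult[symmetric]) (auto intro!: ennreal_leI)
    also have "\<dots> \<le> ennreal (m powr a / K powr \<bar>a\<bar>) * emeasure sphere_measure B'"
      by (intro mult_left_mono B'low) simp
    also have "\<dots> \<le> W B'"
      unfolding W_def
    proof (intro set_nn_integral_bounds mB')
      fix \<eta> assume e: "\<eta> \<in> B'"
      then have t: "\<bar>Im (cnj u * \<eta> $ i)\<bar> \<le> 18 * r" "defect i \<eta> \<le> 36 * r" "norm \<eta> = 1" "defect i \<eta> > k * r"
        using tb[of \<eta>] by (auto simp: B'_def S_def)
      have "m / K = k * (m / 288)" by (simp add: K_def)
      also have "\<dots> \<le> k * r" using k m by (intro mult_left_mono) auto
      finally have "m / K \<le> defect i \<eta>" using t by simp
      moreover have "288 * m \<le> K * m" using K m by (intro mult_right_mono) auto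
      then have "defect i \<eta> \<le> K * m" using t m by linarith
      ultimately show "m powr a / K powr \<bar>a\<bar> \<le> defect_weight i a \<eta>"
        using m K by (intro defect_weight_compare) auto
    qed simp
    also have "\<dots> \<le> W (nonisotropic_ball \<zeta> r)" by (rule W_mono) (auto simp: B'_def)
    finally have 1: "ennreal (c * (r ^ ?N * m powr a)) \<le> W (nonisotropic_ball \<zeta> r)" .
    show ?thesis using 1 2 by (simp add: m_def)
  qed
  show thesis
  proof (rule that)
    show "c > 0" using c0 K by (simp add: c_def)
    show "C > 0" using c0 by (simp add: C_def less_max_iff_disj)
  qed (use main in \<open>auto simp: W_def\<close>)
qed

section \<open>The Muckenhoupt and doubling conditions\<close>

lemma nonisotropic_ball_eq_sphere:
  assumes "norm \<zeta> = 1" "3 \<le> r"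
  shows "nonisotropic_ball \<zeta> r = sphere 0 1"
proof -
  have "cmod (1 - cdot \<zeta> \<eta>) < 3" if "norm \<eta> = 1" for \<eta>
    using norm_triangle_ineq4[of 1 "cdot \<zeta> \<eta>"] cdot_Cauchy_Schwarz[of \<zeta> \<eta>] that assms by simp
  then show ?thesis using assms by (force simp: nonisotropic_ball_def)
qed

lemma nonisotropic_ball_min:
  "norm \<zeta> = 1 \<Longrightarrow> nonisotropic_ball \<zeta> r = nonisotropic_ball \<zeta> (min r 3)"
  using nonisotropic_ball_eq_sphere[of \<zeta>] by (cases "r \<le> 3") (auto simp: min_def)

lemma weight_defect_weight: "weight (defect_weight i a)"
  by (auto simp: weight_def intro!: less_imp_le[OF defect_weight_pos])

lemma ennreal_divide_le:
  assumes "x \<le> ennreal p" "ennreal q \<le> y" "0 \<le> p" "0 < q"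
  shows "x / y \<le> ennreal (p / q)"
proof -
  have "ennreal p = ennreal (p / q) * ennreal q"
    using assms by (subst ennreal_mult[symmetric]) auto
  also have "\<dots> \<le> ennreal (p / q) * y"
    using assms by (intro mult_left_mono) auto
  finally have "x \<le> ennreal (p / q) * y" using assms(1) by simp
  moreover have "0 < y" using assms by (metis ennreal_less_zero_iff less_le_trans)
  ultimately show ?thesis by (intro divide_le_posI_ennreal) (simp_all add: mult.commute)
qed

text \<open>
  The inverse weight is the power with exponent \<open>- a\<close>, so both means are given by the previous
  estimate, and the factors \<open>max r (defect i \<zeta>) powr a\<close> and \<open>max r (defect i \<zeta>) powr (- a)\<close>
  cancel.
\<close>
lemma A2_defect_weight:
  fixes i :: "'n::finite"
  assumes n: "CARD('n) > 1" and a: "\<bar>a\<bar> < real CARD('n) - 1"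
  shows "A2_weight (defect_weight i a)"
proof -
  let ?N = "CARD('n)"
  have a1: "a > - (real ?N - 1)" and a2: "- a > - (real ?N - 1)" using a by auto
  obtain c1 C1 where C1: "c1 > 0" "C1 > 0" and "\<And>\<zeta> r. norm (\<zeta> :: complex ^ 'n) = 1 \<Longrightarrow> 0 < r \<Longrightarrow> r \<le> 3 \<Longrightarrow>
      ennreal (c1 * (r ^ ?N * max r (defect i \<zeta>) powr a))
        \<le> defect_mass i a (nonisotropic_ball \<zeta> r)" and up1: "\<And>\<zeta> r. norm (\<zeta> :: complex ^ 'n) = 1 \<Longrightarrow> 0 < r \<Longrightarrow> r \<le> 3 \<Longrightarrow>
      defect_mass i a (nonisotropic_ball \<zeta> r)
        \<le> ennreal (C1 * (r ^ ?N * max r (defect i \<zeta>) powr a))"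
    using defect_weight_ball[OF n a1] by blast
  obtain c2 C2 where C2: "c2 > 0" "C2 > 0" and "\<And>\<zeta> r. norm (\<zeta> :: complex ^ 'n) = 1 \<Longrightarrow> 0 < r \<Longrightarrow> r \<le> 3 \<Longrightarrow>
      ennreal (c2 * (r ^ ?N * max r (defect i \<zeta>) powr (- a)))
        \<le> defect_mass i (- a) (nonisotropic_ball \<zeta> r)" and up2: "\<And>\<zeta> r. norm (\<zeta> :: complex ^ 'n) = 1 \<Longrightarrow> 0 < r \<Longrightarrow> r \<le> 3 \<Longrightarrow>
      defect_mass i (- a) (nonisotropic_ball \<zeta> r)
        \<le> ennreal (C2 * (r ^ ?N * max r (defect i \<zeta>) powr (- a)))"
    using defect_weight_ball[OF n a2] by blast
  obtain c C where c: "c > 0" "C > 0" and low: "\<And>\<zeta> r. norm (\<zeta> :: complex ^ 'n) = 1 \<Longrightarrow> 0 < r \<Longrightarrow> r \<le> 3 \<Longrightarrow>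
      ennreal (c * r ^ ?N) \<le> emeasure sphere_measure (nonisotropic_ball \<zeta> r)"
    and "\<And>\<zeta> r. norm (\<zeta> :: complex ^ 'n) = 1 \<Longrightarrow> 0 < r \<Longrightarrow>
      emeasure sphere_measure (nonisotropic_ball \<zeta> r) \<le> ennreal (C * r ^ ?N)"
    using nonisotropic_ball_measure[OF n] by blast
  have inv: "(\<integral>\<^sup>+\<eta>\<in>B. inverse (ennreal (defect_weight i a \<eta>)) \<partial>sphere_measure)
    = defect_mass i (- a) B" for B
    by (rule nn_integral_cong) (simp add: inverse_defect_weight)
  have whole: "(\<integral>\<^sup>+\<eta>. f \<eta> \<partial>sphere_measure)
    = (\<integral>\<^sup>+\<eta>\<in>nonisotropic_ball (axis i 1) 3. f \<eta> \<partial>sphere_measure)" for f :: "complex ^ 'n \<Rightarrow> ennreal"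
    by (rule nn_integral_cong) (simp add: nonisotropic_ball_eq_sphere)
  have fin1: "(\<integral>\<^sup>+\<eta>. ennreal (defect_weight i a \<eta>) \<partial>sphere_measure) < \<infinity>"
    using up1[of "axis i 1" 3] by (subst whole) (auto intro: le_less_trans)
  have fin2: "(\<integral>\<^sup>+\<eta>. inverse (ennreal (defect_weight i a \<eta>)) \<partial>sphere_measure) < \<infinity>"
    using up2[of "axis i 1" 3] by (subst whole, subst inv) (auto intro: le_less_trans)
  show ?thesis
    unfolding A2_weight_def Let_def
  proof (intro conjI weight_defect_weight fin1 fin2 exI[of _ "C1 * C2 / c\<^sup>2"] ballI allI impI)
    show "0 < C1 * C2 / c\<^sup>2" using C1 C2 c by simp
    fix \<zeta> :: "complex ^ 'n" and r' :: real assume z': "\<zeta> \<in> sphere 0 1" and r': "0 < r'"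
    then have z: "norm \<zeta> = 1" by simp
    define r where "r = min r' 3"
    have r: "0 < r" "r \<le> 3" using r' by (auto simp: r_def)
    define m where "m = max r (defect i \<zeta>)"
    have m: "m > 0" using r by (simp add: m_def)
    have B: "nonisotropic_ball \<zeta> r' = nonisotropic_ball \<zeta> r"
      unfolding r_def by (rule nonisotropic_ball_min[OF z])
    let ?B = "nonisotropic_ball \<zeta> r"
    have "(defect_mass i a ?B / emeasure sphere_measure ?B)
        \<le> ennreal (C1 * (r ^ ?N * m powr a) / (c * r ^ ?N))"
      unfolding m_def using C1 c r by (intro ennreal_divide_le up1 low z) auto
    moreover have "(defect_mass i (- a) ?B / emeasure sphere_measure ?B)
        \<le> ennreal (C2 * (r ^ ?N * m powr (- a)) / (c * r ^ ?N))"
      unfolding m_def using C2 c r by (intro ennreal_divide_le up2 low z) auto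
    ultimately have "(defect_mass i a ?B / emeasure sphere_measure ?B) *
        (defect_mass i (- a) ?B / emeasure sphere_measure ?B)
        \<le> ennreal (C1 * (r ^ ?N * m powr a) / (c * r ^ ?N)) * ennreal (C2 * (r ^ ?N * m powr (- a)) / (c * r ^ ?N))"
      by (intro mult_mono) auto
    also have "\<dots> = ennreal (C1 * C2 / c\<^sup>2)"
      using C1 C2 c r m by (subst ennreal_mult[symmetric]) (auto simp: powr_minus field_simps power2_eq_square)
    finally show "(defect_mass i a (nonisotropic_ball \<zeta> r')
        / emeasure sphere_measure (nonisotropic_ball \<zeta> r')) *
      ((\<integral>\<^sup>+\<eta>\<in>nonisotropic_ball \<zeta> r'. inverse (ennreal (defect_weight i a \<eta>)) \<partial>sphere_measure)
        / emeasure sphere_measure (nonisotropic_ball \<zeta> r')) \<le> ennreal (C1 * C2 / c\<^sup>2)"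
      unfolding B inv .
  qed
qed

text \<open>
  Enlarging the radius by a factor \<open>q\<close> multiplies \<open>r ^ CARD('n)\<close> by \<open>q ^ CARD('n)\<close> and
  \<open>max r (defect i \<zeta>)\<close> by a factor between 1 and \<open>q\<close>, so the order of doubling is \<open>CARD('n)\<close> or
  \<open>CARD('n) + a\<close>, according to the sign of \<open>a\<close>.
\<close>
lemma doubling_defect_weight:
  fixes i :: "'n::finite"
  assumes n: "CARD('n) > 1" and a: "a > - (real CARD('n) - 1)"
    and t: "real CARD('n) \<le> \<tau>" "real CARD('n) + a \<le> \<tau>"
  shows "doubling_weight \<tau> (defect_weight i a)"
proof -
  let ?N = "CARD('n)"
  obtain c C where c: "c > 0" "C > 0"
    and low: "\<And>\<zeta> r. norm (\<zeta> :: complex ^ 'n) = 1 \<Longrightarrow> 0 < r \<Longrightarrow> r \<le> 3 \<Longrightarrow>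
      ennreal (c * (r ^ ?N * max r (defect i \<zeta>) powr a))
        \<le> defect_mass i a (nonisotropic_ball \<zeta> r)"
    and up: "\<And>\<zeta> r. norm (\<zeta> :: complex ^ 'n) = 1 \<Longrightarrow> 0 < r \<Longrightarrow> r \<le> 3 \<Longrightarrow>
      defect_mass i a (nonisotropic_ball \<zeta> r)
        \<le> ennreal (C * (r ^ ?N * max r (defect i \<zeta>) powr a))"
    using defect_weight_ball[OF n a] by blast
  have W: "emeasure (weighted_measure (defect_weight i a)) (nonisotropic_ball \<zeta> r)
    = defect_mass i a (nonisotropic_ball \<zeta> r)"
    for \<zeta> :: "complex ^ 'n" and r
    unfolding weighted_measure_def
    by (rule emeasure_density) (auto simp: sets_nonisotropic_ball)
  show ?thesis
    unfolding doubling_weight_def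
  proof (intro conjI weight_defect_weight exI[of _ "C / c"] ballI allI impI)
    show "0 < C / c" using c by simp
    fix \<zeta> :: "complex ^ 'n" and r' :: real and k :: nat
    assume z': "\<zeta> \<in> sphere 0 1" and r': "0 < r'"
    then have z: "norm \<zeta> = 1" by simp
    define r R where "r = min r' 3" and "R = min (2 ^ k * r') 3"
    have kr: "r' \<le> 2 ^ k * r'" using r' by simp
    have r: "0 < r" "r \<le> 3" "0 < R" "R \<le> 3"
      using r' kr by (auto simp: r_def R_def)
    have rR: "r \<le> R" unfolding r_def R_def by (rule min.mono[OF kr order_refl])
    have Rr: "R \<le> 2 ^ k * r"
    proof (cases "r' \<le> 3")
      case True then show ?thesis by (simp add: r_def R_def)
    next
      case False
      then have r3: "r = 3" by (simp add: r_def)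
      have "R \<le> 3" by (simp add: R_def)
      also have "(3::real) \<le> 2 ^ k * 3" by simp
      finally show ?thesis unfolding r3 .
    qed
    define h where "h = defect i \<zeta>"
    define q where "q = R / r"
    have q: "1 \<le> q" "q \<le> 2 ^ k" using r rR Rr by (simp_all add: q_def field_simps)
    have R: "R = q * r" using r by (simp add: q_def)
    have m0: "max r h > 0" using r by simp
    have m1: "max r h \<le> max R h" using rR by auto
    have m2: "max R h \<le> q * max r h"
    proof -
      have "q * r \<le> q * max r h" using q by (intro mult_left_mono) auto
      moreover have "1 * h \<le> q * max r h" if "h \<ge> 0" using q that by (intro mult_mono) auto
      moreover have "0 \<le> q * max r h" using q m0 by auto
      ultimately show ?thesis unfolding R by (cases "h \<ge> 0") auto
    qed
    have "R ^ ?N * max R h powr a \<le> 2 powr (real k * \<tau>) * (r ^ ?N * max r h powr a)"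
    proof -
      have "max R h powr a \<le> q powr (max a 0) * max r h powr a"
      proof (cases "a \<ge> 0")
        case True
        have "max R h powr a \<le> (q * max r h) powr a" using m2 r True by (intro powr_mono2) auto
        also have "\<dots> = q powr a * max r h powr a" using q m0 by (simp add: powr_mult)
        finally show ?thesis using True by (simp add: max_def)
      next
        case False
        have "max R h powr a \<le> max r h powr a" using m1 m0 False by (intro powr_mono2') auto
        then show ?thesis using False q by (simp add: max_def)
      qed
      then have "R ^ ?N * max R h powr a \<le> (q * r) ^ ?N * (q powr (max a 0) * max r h powr a)"
        unfolding R[symmetric] using r by (intro mult_left_mono) auto
      also have "\<dots> = q powr (real ?N + max a 0) * (r ^ ?N * max r h powr a)"
        using q by (simp add: power_mult_distrib powr_add powr_realpow[symmetric])
      also have "\<dots> \<le> 2 powr (real k * \<tau>) * (r ^ ?N * max r h powr a)"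
      proof (intro mult_right_mono)
        have "q powr (real ?N + max a 0) \<le> q powr \<tau>" using q t by (intro powr_mono) auto
        also have "\<dots> \<le> (2 ^ k) powr \<tau>" using q t by (intro powr_mono2) auto
        also have "\<dots> = 2 powr (real k * \<tau>)" by (simp add: powr_realpow[symmetric] powr_powr)
        finally show "q powr (real ?N + max a 0) \<le> 2 powr (real k * \<tau>)" .
      qed (use r in auto)
      finally show ?thesis .
    qed
    then have le: "C * (R ^ ?N * max R h powr a) \<le> C / c * 2 powr (real k * \<tau>) * (c * (r ^ ?N * max r h powr a))"
      using c by (simp add: mult_left_mono mult.assoc)
    have "defect_mass i a (nonisotropic_ball \<zeta> R)
      \<le> ennreal (C * (R ^ ?N * max R h powr a))"
      unfolding h_def by (intro up z r)
    also have "\<dots> \<le> ennreal (C / c * 2 powr (real k * \<tau>)) * ennreal (c * (r ^ ?N * max r h powr a))"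
      using c r le by (subst ennreal_mult[symmetric]) (auto intro!: ennreal_leI)
    also have "\<dots> \<le> ennreal (C / c * 2 powr (real k * \<tau>)) *
      defect_mass i a (nonisotropic_ball \<zeta> r)"
      unfolding h_def by (intro mult_left_mono low z r) simp
    finally show "emeasure (weighted_measure (defect_weight i a)) (nonisotropic_ball \<zeta> (2 ^ k * r'))
      \<le> ennreal (C / c * 2 powr (real k * \<tau>)) *
        emeasure (weighted_measure (defect_weight i a)) (nonisotropic_ball \<zeta> r')"
      unfolding W nonisotropic_ball_min[OF z, of "2 ^ k * r'"] nonisotropic_ball_min[OF z, of r']
      by (simp add: r_def R_def)
  qed
qed

section \<open>A square integrable function with divergent potential on the circle\<close>

lemma L2_norm_finite_iff: "L2_norm M f < \<infinity> \<longleftrightarrow> (\<integral>\<^sup>+\<eta>. ennreal ((cmod (f \<eta>))\<^sup>2) \<partial>M) < \<infinity>"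
  by (auto simp: L2_norm_def Let_def less_top[symmetric])

text \<open>
  For a function \<open>g\<close> of the defect, the squared weighted norm is of the order of the integral of
  \<open>(g t)\<^sup>2 * t powr (2 * s - 1)\<close> over the unit interval, while the potential on the circle is of the
  order of the integral of \<open>g t * t powr (s - 1)\<close>. With \<open>g t = t powr (- s)\<close> both diverge
  logarithmically; dividing by \<open>1 - ln t\<close> makes the first one converge, but not the second.
\<close>
definition log_extremal :: "real \<Rightarrow> 'n \<Rightarrow> complex ^ 'n \<Rightarrow> complex" where
  "log_extremal s i \<eta> = of_real (if 0 < defect i \<eta> then defect i \<eta> powr (- s) / (1 - ln (defect i \<eta>)) else 0)"

lemma measurable_log_extremal [measurable]: "log_extremal s i \<in> borel_measurable borel"
  unfolding log_extremal_def[abs_def] by measurable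

lemma norm_log_extremal:
  assumes "0 < defect i \<eta>"
  shows "cmod (log_extremal s i \<eta>) = defect i \<eta> powr (- s) / (1 - ln (defect i \<eta>))"
proof -
  have "ln (defect i \<eta>) \<le> 0" using assms defect_le_1[of i \<eta>] by simp
  then have "\<bar>1 - ln (defect i \<eta>)\<bar> = 1 - ln (defect i \<eta>)" by (intro abs_of_nonneg) linarith
  then show ?thesis using assms by (simp add: log_extremal_def norm_divide del: of_real_divide of_real_diff)
qed

text \<open>
  On the shell where the defect is about \<open>1 / 2 ^ j\<close> the weighted square is at most a multiple of
  \<open>2 ^ (j * (CARD('n) - 1)) / (Suc j)\<^sup>2\<close>, and the first factor is cancelled by the measure of the
  tube. The series of the remaining factors converges.
\<close>
lemma log_extremal_in_L2:
  fixes i :: "'n::finite"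
  assumes n: "CARD('n) > 1" and a: "a = 2 * s - (real CARD('n) - 1)"
  shows "log_extremal s i \<in> L2_space (weighted_measure (defect_weight i a))"
proof -
  let ?N = "CARD('n)" and ?w = "defect_weight i a"
  obtain C0 where C0: "C0 > 0" and tube: "\<And>u b t. cmod u = 1 \<Longrightarrow> b \<ge> 0 \<Longrightarrow> t \<ge> 0 \<Longrightarrow>
    emeasure sphere_measure (sphere_tube i u b t)
      \<le> ennreal (C0 * b * t ^ (?N - 1))"
    using sphere_tube_upper by blast
  have cap: "emeasure sphere_measure {\<eta> :: complex ^ 'n \<in> sphere 0 1. defect i \<eta> \<le> t} \<le> ennreal (C0 * t ^ (?N - 1))"
    if "t \<ge> 0" for t
  proof -
    have "\<bar>Im (1 * \<eta> $ i)\<bar> \<le> 1" if "\<eta> \<in> sphere 0 1" for \<eta> :: "complex ^ 'n"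
      using abs_Im_le_cmod[of "\<eta> $ i"] Finite_Cartesian_Product.norm_nth_le[of \<eta> i] that by simp
    then have "{\<eta> :: complex ^ 'n \<in> sphere 0 1. defect i \<eta> \<le> t}
      = sphere_tube i 1 1 t" by auto
    then show ?thesis using tube[of 1 1 t] that by simp
  qed
  define b where "b j = (2 ^ Suc j) ^ (?N - 1) * 4 / (real (Suc j))\<^sup>2" for j
  have "(\<lambda>\<eta>. ennreal (?w \<eta>)) \<in> borel_measurable borel"
    "(\<lambda>\<eta>. ennreal ((cmod (log_extremal s i \<eta>))\<^sup>2)) \<in> borel_measurable borel"
    by measurable
  then have mw: "(\<lambda>\<eta>. ennreal (?w \<eta>)) \<in> borel_measurable sphere_measure"
    "(\<lambda>\<eta>. ennreal ((cmod (log_extremal s i \<eta>))\<^sup>2)) \<in> borel_measurable sphere_measure"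
    by (blast intro: measurable_sphere_measure)+
  have "(\<integral>\<^sup>+\<eta>. ennreal ((cmod (log_extremal s i \<eta>))\<^sup>2) \<partial>weighted_measure ?w)
    = (\<integral>\<^sup>+\<eta>. ennreal (?w \<eta>) * ennreal ((cmod (log_extremal s i \<eta>))\<^sup>2) \<partial>sphere_measure)"
    unfolding weighted_measure_def using mw by (rule nn_integral_density)
  also have "\<dots> = (\<integral>\<^sup>+\<eta>\<in>{\<eta> \<in> sphere 0 1. defect i \<eta> \<le> 1}.
      (ennreal (?w \<eta>) * ennreal ((cmod (log_extremal s i \<eta>))\<^sup>2)) \<partial>sphere_measure)"
    by (rule nn_integral_cong) (simp add: defect_le_1)
  also have "\<dots> \<le> (\<Sum>j. ennreal (b j) * emeasure sphere_measure {\<eta> \<in> sphere 0 1. defect i \<eta> \<le> 1 / 2 ^ j})"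
  proof (rule nn_integral_dyadic_le)
    show "sphere 0 1 \<in> sets (sphere_measure :: (complex ^ 'n) measure)" by (simp add: sets_sphere_measure_iff)
    have "emeasure sphere_measure {\<eta> :: complex ^ 'n \<in> sphere 0 1. defect i \<eta> \<le> 0} \<le> 0"
      using cap[of 0] n by (simp add: power_0_left)
    then show "emeasure sphere_measure {\<eta> :: complex ^ 'n \<in> sphere 0 1. defect i \<eta> \<le> 0} = 0" by simp
    fix \<eta> :: "complex ^ 'n" and j :: nat
    define h where "h = defect i \<eta>"
    assume hl: "1 / 2 ^ Suc j < defect i \<eta>" and hu: "defect i \<eta> \<le> 1 / 2 ^ j"
    have h0: "h > 0" using hl unfolding h_def by (rule less_trans[rotated]) simp
    have ln2: "ln 2 \<ge> (1/2 :: real)" using ln2_ge_two_thirds by simp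
    have "ln h \<le> ln (1 / 2 ^ j)" using h0 hu by (simp add: h_def)
    also have "\<dots> = - (real j * ln 2)" by (simp add: ln_div ln_realpow)
    finally have "1 - ln h \<ge> 1 + real j * ln 2" by simp
    moreover have "real j * ln 2 \<ge> real j * (1/2)" using ln2 by (intro mult_left_mono) auto
    ultimately have ln: "1 - ln h \<ge> real (Suc j) / 2" by (simp add: field_simps)
    have pw: "h powr a * (h powr (- s))\<^sup>2 = (1 / h) ^ (?N - 1)"
    proof -
      have "h powr a * (h powr (- s))\<^sup>2 = h powr (a - 2 * s)"
        by (simp add: power2_eq_square powr_add[symmetric])
      also have "\<dots> = h powr (- real (?N - 1))" using n by (simp add: a of_nat_diff)
      also have "\<dots> = (1 / h) ^ (?N - 1)" using h0 by (simp only: powr_minus powr_realpow) (simp add: power_one_over inverse_eq_divide)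
      finally show ?thesis .
    qed
    have "?w \<eta> * (cmod (log_extremal s i \<eta>))\<^sup>2 = h powr a * (h powr (- s))\<^sup>2 / (1 - ln h)\<^sup>2"
      using h0 norm_log_extremal[of i \<eta> s] by (simp add: defect_weight_def h_def power_divide)
    also have "\<dots> = (1 / h) ^ (?N - 1) / (1 - ln h)\<^sup>2" by (simp add: pw)
    also have "\<dots> \<le> (2 ^ Suc j) ^ (?N - 1) / (real (Suc j) / 2)\<^sup>2"
    proof (intro frac_le power_mono ln)
      show "1 / h \<le> 2 ^ Suc j" using hl h0 by (simp add: h_def field_simps)
    qed (use h0 in auto)
    also have "\<dots> = b j" by (simp add: b_def power_divide)
    finally show "ennreal (?w \<eta>) * ennreal ((cmod (log_extremal s i \<eta>))\<^sup>2) \<le> ennreal (b j)"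
      by (simp add: ennreal_mult''[symmetric] ennreal_leI)
  qed (auto simp: defect_nonneg)
  also have "\<dots> \<le> (\<Sum>j. ennreal (C0 * 2 ^ (?N - 1) * 4 * (1 / (real (Suc j))\<^sup>2)))"
  proof (intro suminf_le)
    fix j
    have "ennreal (b j) * emeasure sphere_measure {\<eta> :: complex ^ 'n \<in> sphere 0 1. defect i \<eta> \<le> 1 / 2 ^ j}
      \<le> ennreal (b j) * ennreal (C0 * (1 / 2 ^ j) ^ (?N - 1))"
      by (intro mult_left_mono cap) auto
    also have "\<dots> = ennreal (b j * (C0 * (1 / 2 ^ j) ^ (?N - 1)))"
      using C0 by (intro ennreal_mult[symmetric]) (auto simp: b_def)
    also have "b j * (C0 * (1 / 2 ^ j) ^ (?N - 1)) = C0 * 2 ^ (?N - 1) * 4 * (1 / (real (Suc j))\<^sup>2)"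
      by (simp add: b_def power_mult_distrib power_divide)
    finally show "ennreal (b j) * emeasure sphere_measure {\<eta> :: complex ^ 'n \<in> sphere 0 1. defect i \<eta> \<le> 1 / 2 ^ j}
      \<le> ennreal (C0 * 2 ^ (?N - 1) * 4 * (1 / (real (Suc j))\<^sup>2))" .
  qed auto
  also have "\<dots> < \<infinity>"
  proof -
    have "summable (\<lambda>j. 1 / (real (Suc j))\<^sup>2)"
      using inverse_power_summable[of 2, where 'a = real] summable_Suc_iff[of "\<lambda>j. 1 / (real j)\<^sup>2"]
      by (simp add: inverse_eq_divide)
    then have "summable (\<lambda>j. C0 * 2 ^ (?N - 1) * 4 * (1 / (real (Suc j))\<^sup>2))" by (rule summable_mult)
    then have "(\<Sum>j. ennreal (C0 * 2 ^ (?N - 1) * 4 * (1 / (real (Suc j))\<^sup>2))) \<noteq> top"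
      using C0 by (subst suminf_ennreal2) auto
    then show ?thesis by (simp add: less_top)
  qed
  finally have "L2_norm (weighted_measure ?w) (log_extremal s i) < \<infinity>"
    unfolding L2_norm_finite_iff .
  moreover have "log_extremal s i \<in> borel_measurable (weighted_measure ?w)"
    unfolding weighted_measure_def by simp
  ultimately show ?thesis by (simp add: L2_space_def)
qed

text \<open>
  The shells \<open>E j\<close> around the point of evaluation, of size \<open>q ^ j\<close>, are disjoint if \<open>q\<close> is smaller
  than the constant \<open>k\<close> of the shells. On \<open>E j\<close> the kernel is at least of the order
  \<open>(q ^ j) powr (s - CARD('n))\<close> and the function of the order \<open>(q ^ j) powr (- s) / Suc j\<close>, while the
  measure is of the order \<open>(q ^ j) ^ CARD('n)\<close>: the shells contribute a harmonic series.
\<close>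
lemma log_extremal_potential_diverges:
  fixes i :: "'n::finite"
  assumes n: "CARD('n) > 1" and s: "0 < s" "s < real CARD('n)" and u: "cmod u = 1"
  shows "\<not> integrable sphere_measure (potential_integrand s (log_extremal s i) (axis i u))"
proof
  let ?N = "CARD('n)"
  assume int: "integrable sphere_measure (potential_integrand s (log_extremal s i) (axis i u))"
  define G where "G \<eta> = cmod (potential_integrand s (log_extremal s i) (axis i u) \<eta>)" for \<eta>
  have fin: "(\<integral>\<^sup>+\<eta>. ennreal (G \<eta>) \<partial>sphere_measure) < \<infinity>"
    using int by (simp add: integrable_iff_bounded G_def)
  have mG: "(\<lambda>\<eta>. ennreal (G \<eta>)) \<in> borel_measurable sphere_measure"
    using borel_measurable_integrable[OF int] unfolding G_def by simp
  obtain k c where k: "0 < k" "k < 1" "0 < c" and low: "\<And>u b t. cmod u = 1 \<Longrightarrow> 0 < b \<Longrightarrow> b \<le> 1 \<Longrightarrow> 0 < t \<Longrightarrow> t \<le> 1 \<Longrightarrow>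
    ennreal (c * b * t ^ (?N - 1)) \<le> emeasure sphere_measure (tube_shell i k u b t)"
    using sphere_tube_lower[OF n] by blast
  define q where "q = k / 2"
  have q: "0 < q" "q < 1" "q < k" using k by (auto simp: q_def)
  define E where "E j = tube_shell i k (cnj u) (q ^ j) (q ^ j)" for j
  have mE: "E j \<in> sets sphere_measure" for j
  proof -
    have "E j \<in> sets borel" unfolding E_def by (rule sets_sphere_Collect) measurable
    then show ?thesis by (auto simp: E_def sets_sphere_measure_iff)
  qed
  note pw = power_CARD_rec[where 'n = 'n]
  have disj: "disjoint_family E"
  proof -
    have "E j \<inter> E l = {}" if "j < l" for j l
    proof -
      have "q ^ l \<le> q ^ Suc j" using that q by (intro power_decreasing) auto
      also have "\<dots> < k * q ^ j" using q by simp
      finally show ?thesis by (auto simp: E_def)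
    qed
    then have "E j \<inter> E l = {}" if "j \<noteq> l" for j l
      using that by (metis Int_commute nat_neq_iff)
    then show ?thesis by (auto simp: disjoint_family_on_def)
  qed
  define L where "L = 1 - ln k - ln q"
  have L: "L > 0" "- ln q \<le> L" "1 - ln k \<le> L"
  proof -
    have "ln k \<le> 0" "ln q \<le> 0" using k q by simp_all
    then show "L > 0" "- ln q \<le> L" "1 - ln k \<le> L" unfolding L_def by linarith+
  qed
  define v where "v j = (q ^ j) powr (- s) / (real (Suc j) * L) / (3 * q ^ j) powr (real ?N - s)" for j
  have v: "v j \<le> G \<eta>" if e: "\<eta> \<in> E j" for j \<eta>
  proof -
    define h where "h = defect i \<eta>"
    have h: "k * q ^ j \<le> h" "h \<le> q ^ j" using e by (auto simp: E_def h_def)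
    have h0: "h > 0" using h k q by (meson less_le_trans mult_pos_pos zero_less_power)
    have n1: "norm \<eta> = 1" using e by (simp add: E_def)
    define d where "d = cmod (1 - cdot (axis i u) \<eta>)"
    have "cmod (1 - cdot (axis i (cnj (cnj u))) \<eta>) \<le> q ^ j + 2 * q ^ j"
      using e q u by (intro nonisotropic_ball_axis_contains) (auto simp: E_def power_le_one)
    then have d3: "d \<le> 3 * q ^ j" by (simp add: d_def)
    \<comment> \<open>At zero distance the kernel would be a division by zero, which has the value 0.\<close>
    have d0: "d > 0"
    proof -
      have "d \<noteq> 0"
      proof
        assume "d = 0"
        then have "u * cnj (\<eta> $ i) = 1" by (simp add: d_def cdot_axis)
        then have "cmod (u * cnj (\<eta> $ i)) = 1" by simp
        then have "cmod (\<eta> $ i) = 1" using u by (simp add: norm_mult)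
        then show False using h0 by (simp add: h_def defect_def)
      qed
      then show ?thesis by (simp add: d_def)
    qed
    have G: "G \<eta> = h powr (- s) / (1 - ln h) / d powr (real ?N - s)"
      using norm_log_extremal[of i \<eta> s] h0
      by (simp add: G_def potential_integrand_def norm_divide h_def d_def)
    have lnh: "1 - ln h \<ge> 1" using h0 defect_le_1[of i \<eta>] by (simp add: h_def)
    then have lnh': "ln h < 1" by linarith
    have "1 - ln h \<le> real (Suc j) * L"
    proof -
      have "ln (k * q ^ j) \<le> ln h" using h h0 k q by simp
      moreover have "ln (k * q ^ j) = ln k + real j * ln q" using k q by (simp add: ln_mult ln_realpow)
      moreover have "real j * (- ln q) \<le> real j * L" using L by (intro mult_left_mono) auto
      ultimately show ?thesis using L by (simp add: algebra_simps)
    qed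
    then have le: "(q ^ j) powr (- s) / (real (Suc j) * L) \<le> h powr (- s) / (1 - ln h)"
      using lnh' h h0 s q by (intro frac_le powr_mono2') auto
    show ?thesis
      unfolding v_def G
    proof (rule frac_le)
      show "0 \<le> h powr (- s) / (1 - ln h)" using lnh' by simp
      show "d powr (real ?N - s) \<le> (3 * q ^ j) powr (real ?N - s)"
        using d0 d3 s by (intro powr_mono2) auto
    qed (use le d0 in auto)
  qed
  define c' where "c' = c / L / 3 powr (real ?N - s)"
  have c': "c' > 0" using k L by (simp add: c'_def)
  have vE: "ennreal (c' * inverse (real (Suc j))) \<le> (\<integral>\<^sup>+\<eta>\<in>E j. ennreal (G \<eta>) \<partial>sphere_measure)" for j
  proof -
    have "c' * inverse (real (Suc j)) = v j * (c * q ^ j * (q ^ j) ^ (?N - 1))"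
    proof -
      define t where "t = q ^ j"
      have t: "t > 0" using q by (simp add: t_def)
      have "t powr (- s) * (1 / t powr (real ?N - s)) * t ^ ?N = 1"
        using t by (simp add: powr_realpow[symmetric] powr_minus powr_diff field_simps)
      moreover have "v j * (c * t * t ^ (?N - 1)) = c' / real (Suc j) * (t powr (- s) * (1 / t powr (real ?N - s)) * t ^ ?N)"
        using t unfolding pw[of t, symmetric] by (simp add: v_def c'_def t_def[symmetric] powr_mult mult_ac)
      ultimately show ?thesis by (simp add: t_def[symmetric] inverse_eq_divide)
    qed
    then have "ennreal (c' * inverse (real (Suc j))) = ennreal (v j) * ennreal (c * q ^ j * (q ^ j) ^ (?N - 1))"
      using k q L by (simp only:) (intro ennreal_mult, auto simp: v_def)
    also have "\<dots> \<le> ennreal (v j) * emeasure sphere_measure (E j)"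
      unfolding E_def using q u by (intro mult_left_mono low) (auto simp: power_le_one)
    also have "\<dots> \<le> (\<integral>\<^sup>+\<eta>\<in>E j. ennreal (G \<eta>) \<partial>sphere_measure)"
      using v L q by (intro set_nn_integral_bounds mE) (auto simp: v_def)
    finally show ?thesis .
  qed
  have "(\<Sum>j. ennreal (c' * inverse (real (Suc j)))) \<le> (\<Sum>j. \<integral>\<^sup>+\<eta>\<in>E j. ennreal (G \<eta>) \<partial>sphere_measure)"
    by (intro suminf_le vE) auto
  also have "\<dots> = (\<integral>\<^sup>+\<eta>\<in>(\<Union>j. E j). ennreal (G \<eta>) \<partial>sphere_measure)"
    by (rule nn_integral_disjoint_family[symmetric]) (use mG mE disj in auto)
  also have "\<dots> \<le> (\<integral>\<^sup>+\<eta>. ennreal (G \<eta>) \<partial>sphere_measure)"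
    by (intro nn_integral_mono) (auto simp: indicator_def)
  finally have "(\<Sum>j. ennreal (c' * inverse (real (Suc j)))) \<noteq> top"
    using fin by (auto simp: top_unique)
  then have "summable (\<lambda>j. c' * inverse (real (Suc j)))"
    using c' by (intro summable_suminf_not_top) auto
  then have "summable (\<lambda>j. inverse (real (Suc j)))" using c' by (simp add: summable_cmult_iff)
  then show False
    using not_summable_harmonic[where 'a = real] summable_Suc_iff[of "\<lambda>n. inverse (real n)"] by simp
qed

text \<open>
  Normalized arc length on the circle in which the complex line of the coordinate \<open>i\<close> meets the sphere.
\<close>
definition circle_measure :: "'n \<Rightarrow> (complex ^ 'n) measure" where
  "circle_measure i = distr (uniform_measure lborel {0..1}) (restrict_space borel (sphere 0 1))
     (\<lambda>t. axis i (cis (2 * pi * t)))"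

lemma Borel_circle_measure: "Borel_measure_on_sphere (circle_measure i)"
  by (simp add: Borel_measure_on_sphere_def circle_measure_def)

lemma measurable_circle:
  "(\<lambda>t. axis i (cis (2 * pi * t)) :: complex ^ 'n) \<in> borel \<rightarrow>\<^sub>M restrict_space borel (sphere 0 1)"
proof (rule measurable_restrict_space2)
  have "continuous_on UNIV (\<lambda>t. axis i (cis (2 * pi * t)) :: complex ^ 'n)"
    unfolding axis_def
  proof (rule continuous_on_vec_lambda)
    fix j
    show "continuous_on UNIV (\<lambda>t. if j = i then cis (2 * pi * t) else 0)"
      by (cases "j = i") (auto simp: cis_conv_exp intro!: continuous_intros)
  qed
  then show "(\<lambda>t. axis i (cis (2 * pi * t)) :: complex ^ 'n) \<in> borel_measurable borel"
    by (rule borel_measurable_continuous_onI)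
qed auto

lemma not_Carleson_potential_circle_measure:
  fixes i :: "'n::finite"
  assumes n: "CARD('n) > 1" and s: "0 < s" "s < real CARD('n)"
    and a: "a = 2 * s - (real CARD('n) - 1)"
  shows "\<not> Carleson_potential s (defect_weight i a) (circle_measure i)"
proof
  assume "Carleson_potential s (defect_weight i a) (circle_measure i)"
  then have "AE z in circle_measure i. integrable sphere_measure (potential_integrand s (log_extremal s i) z)"
    using log_extremal_in_L2[OF n a] unfolding Carleson_potential_def by blast
  then have "AE t in uniform_measure lborel {0..1::real}.
    integrable sphere_measure (potential_integrand s (log_extremal s i) (axis i (cis (2 * pi * t))))"
    unfolding circle_measure_def
    by (rule AE_distrD[rotated]) (use measurable_circle[of i] in \<open>simp add: measurable_def space_uniform_measure\<close>)
  then have "AE t in uniform_measure lborel {0..1::real}. False"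
    using log_extremal_potential_diverges[OF n s] by simp
  then have "emeasure (uniform_measure lborel {0..1::real}) UNIV = 0"
    by (auto elim!: AE_E simp: top.extremum_unique)
  then show False by simp
qed

section \<open>Homogeneous expansions on the ball\<close>

lemma holomorphic_Cn_slice:
  fixes f :: "complex ^ 'n \<Rightarrow> complex"
  assumes f: "holomorphic_Cn f U" and S: "\<And>x. x \<in> S \<Longrightarrow> a + x *s b \<in> U"
  shows "(\<lambda>x. f (a + x *s b)) holomorphic_on S"
proof (rule holomorphic_onI)
  fix x assume "x \<in> S"
  then obtain D where D: "(f has_derivative D) (at (a + x *s b))" "\<And>c v. D (c *s v) = c * D v"
    using f S unfolding holomorphic_Cn_def by blast
  have lin: "bounded_linear (\<lambda>x. x *s b)"
  proof (rule bounded_linear_intro[where K = "norm b"])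
    show "(x + y) *s b = x *s b + y *s b" for x y by (simp add: vec_eq_iff distrib_right)
    show "(r *\<^sub>R x) *s b = r *\<^sub>R (x *s b)" for r x by (simp add: vec_eq_iff)
  qed (simp add: norm_smult)
  have "((\<lambda>x. a + x *s b) has_derivative (\<lambda>x. x *s b)) (at x)"
    by (rule has_derivative_eq_rhs[OF has_derivative_add[OF has_derivative_const bounded_linear_imp_has_derivative[OF lin]]]) simp
  then have "((\<lambda>x. f (a + x *s b)) has_derivative (\<lambda>h. D (h *s b))) (at x)"
    using D(1) by (rule has_derivative_compose)
  then have "((\<lambda>x. f (a + x *s b)) has_field_derivative D b) (at x)"
    unfolding has_field_derivative_def D(2) by (rule has_derivative_eq_rhs) (simp add: fun_eq_iff mult.commute)
  then show "(\<lambda>x. f (a + x *s b)) field_differentiable at x within S"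
    using field_differentiable_at_within field_differentiable_def by blast
qed

text \<open>
  The Taylor coefficients of the restriction of \<open>f\<close> to the complex line through \<open>z\<close>. Near 0 this
  restriction is defined for every \<open>z\<close>, also outside the ball.
\<close>
definition hom_part :: "(complex ^ 'n \<Rightarrow> complex) \<Rightarrow> nat \<Rightarrow> complex ^ 'n \<Rightarrow> complex" where
  "hom_part f k z = (deriv ^^ k) (\<lambda>x. f (x *s z)) 0 / fact k"

lemma slice_radius:
  fixes z :: "complex ^ 'n"
  assumes "t * norm z < 1" "0 \<le> t"
  obtains R where "t < R" "\<And>x. x \<in> ball 0 R \<Longrightarrow> x *s z \<in> ball 0 1"
proof (cases "z = 0")
  case True
  then show ?thesis using that[of "t + 1"] by simp
next
  case False
  then show ?thesis
    using assms by (intro that[of "1 / norm z"]) (auto simp: field_simps norm_smult)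
qed

lemma slice_holomorphic:
  assumes "holomorphic_Cn f (ball 0 1)" "\<And>x. x \<in> S \<Longrightarrow> x *s z \<in> ball 0 1"
  shows "(\<lambda>x. f (x *s z)) holomorphic_on S"
  using holomorphic_Cn_slice[OF assms(1), of S 0 z] assms(2) by simp

lemma hom_part_sums:
  assumes f: "holomorphic_Cn f (ball 0 1)" and x: "cmod x * norm z < 1"
  shows "(\<lambda>k. hom_part f k z * x ^ k) sums f (x *s z)"
proof -
  obtain R where R: "cmod x < R" "\<And>x. x \<in> ball 0 R \<Longrightarrow> x *s z \<in> ball 0 1"
    using slice_radius[of "cmod x" z] x by auto
  have "(\<lambda>x. f (x *s z)) holomorphic_on ball 0 R"
    using R by (intro slice_holomorphic[OF f]) auto
  from holomorphic_power_series[OF this, of x] R(1) show ?thesis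
    by (simp add: hom_part_def)
qed

lemma hom_part_smult:
  assumes f: "holomorphic_Cn f (ball 0 1)"
  shows "hom_part f k (c *s z) = c ^ k * hom_part f k z"
proof -
  obtain R where R: "0 < R" "\<And>x. x \<in> ball 0 R \<Longrightarrow> x *s z \<in> ball 0 1"
    using slice_radius[of 0 z] by auto
  obtain R' where R': "0 < R'" "\<And>x. x \<in> ball 0 R' \<Longrightarrow> x * c \<in> ball 0 R"
  proof
    show "0 < R / (cmod c + 1)" using R by (simp add: add_nonneg_pos)
    fix x :: complex assume "x \<in> ball 0 (R / (cmod c + 1))"
    then have "cmod x * (cmod c + 1) < R"
      by (simp add: add_nonneg_pos pos_less_divide_eq)
    moreover have "cmod x * cmod c \<le> cmod x * (cmod c + 1)" by (intro mult_left_mono) auto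
    ultimately have "cmod x * cmod c < R" by linarith
    then show "x * c \<in> ball 0 R" by (simp add: norm_mult)
  qed
  have "(deriv ^^ k) (\<lambda>x. (\<lambda>x. f (x *s z)) (c * x)) 0 = c ^ k * (deriv ^^ k) (\<lambda>x. f (x *s z)) (c * 0)"
  proof (rule higher_deriv_compose_linear)
    show "(\<lambda>x. f (x *s z)) holomorphic_on ball 0 R"
      using R by (intro slice_holomorphic[OF f]) auto
    show "0 \<in> ball (0::complex) R'" "open (ball (0::complex) R')" "open (ball (0::complex) R)" using R' by auto
    show "c * w \<in> ball 0 R" if "w \<in> ball 0 R'" for w using R'(2)[OF that] by (simp add: mult.commute)
  qed
  then show ?thesis by (simp add: hom_part_def mult.commute)
qed

text \<open>
  Cauchy's inequality for the restriction to a line, on the circle of radius \<open>\<rho> / norm z\<close>.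
\<close>
lemma hom_part_Cauchy:
  assumes f: "holomorphic_Cn f (ball 0 1)" and \<rho>: "0 < \<rho>" "\<rho> < 1"
    and M: "\<And>y. norm y \<le> \<rho> \<Longrightarrow> cmod (f y) \<le> M"
  shows "cmod (hom_part f k z) \<le> M * (norm z / \<rho>) ^ k"
proof (cases "z = 0")
  case True
  have 0: "cmod (f 0) \<le> M" using M[of 0] \<rho> by simp
  then show ?thesis
    using True hom_part_smult[OF f, of k 0 0] by (cases k) (auto simp: hom_part_def)
next
  case False
  then have z: "norm z > 0" by simp
  have "(\<lambda>x. f (x *s z)) holomorphic_on cball 0 (\<rho> / norm z)"
    using z \<rho> by (intro slice_holomorphic[OF f]) (auto simp: norm_smult field_simps)
  then have "norm ((deriv ^^ k) (\<lambda>x. f (x *s z)) 0) \<le> fact k * M / (\<rho> / norm z) ^ k"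
    using z \<rho> by (intro Cauchy_inequality holomorphic_on_imp_continuous_on M)
      (auto intro: holomorphic_on_subset simp: norm_smult)
  then show ?thesis
    by (simp add: hom_part_def norm_divide field_simps)
qed

lemma holomorphic_Cn_continuous: "holomorphic_Cn f U \<Longrightarrow> continuous_on U f"
  unfolding holomorphic_Cn_def
  by (intro continuous_at_imp_continuous_on) (metis has_derivative_continuous)

lemma holomorphic_Cn_bounded:
  assumes f: "holomorphic_Cn f (ball 0 1)" and \<rho>: "\<rho> < 1"
  obtains M where "M \<ge> 0" "\<And>y. norm y \<le> \<rho> \<Longrightarrow> cmod (f y) \<le> M"
proof -
  have "continuous_on (ball 0 1) f"
    by (rule holomorphic_Cn_continuous[OF f])
  then have "continuous_on (cball 0 \<rho>) f"
    using \<rho> by (elim continuous_on_subset) auto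
  then have "bounded (f ` cball 0 \<rho>)"
    by (intro compact_imp_bounded compact_continuous_image) auto
  then obtain M where "\<forall>y\<in>cball 0 \<rho>. cmod (f y) \<le> M" by (auto simp: bounded_iff)
  then show thesis using that[of "max M 0"] by (auto simp: le_max_iff_disj)
qed

lemma power_series_remainder:
  fixes p :: "nat \<Rightarrow> complex" and A M :: real and t :: complex
  assumes p: "\<And>j. cmod (p j) \<le> M * A ^ j" and A: "0 \<le> A" "A * cmod t \<le> 1 / 2" and sums: "(\<lambda>j. p j * t ^ j) sums S"
  shows "cmod (S - (\<Sum>j\<le>k. p j * t ^ j)) \<le> 2 * M * (A * cmod t) ^ Suc k"
proof -
  have M: "M \<ge> 0" using p[of 0] by (simp add: order_trans[OF norm_ge_zero])
  have bd: "cmod (p (j + Suc k) * t ^ (j + Suc k)) \<le> M * (A * cmod t) ^ Suc k * (1/2) ^ j" for j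
  proof -
    have "cmod (p (j + Suc k) * t ^ (j + Suc k)) \<le> M * A ^ (j + Suc k) * cmod t ^ (j + Suc k)"
      unfolding norm_mult norm_power by (intro mult_right_mono p) auto
    also have "\<dots> = M * (A * cmod t) ^ Suc k * (A * cmod t) ^ j"
      by (simp add: power_mult_distrib power_add mult_ac)
    also have "\<dots> \<le> M * (A * cmod t) ^ Suc k * (1/2) ^ j"
      using A M by (intro mult_left_mono power_mono) auto
    finally show ?thesis .
  qed
  have tail: "(\<lambda>j. p (j + Suc k) * t ^ (j + Suc k)) sums (S - (\<Sum>j<Suc k. p j * t ^ j))"
    by (rule sums_split_initial_segment[OF sums])
  have geo: "(\<lambda>j. M * (A * cmod t) ^ Suc k * (1/2) ^ j) sums (M * (A * cmod t) ^ Suc k * (1 / (1 - 1/2)))"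
    by (intro sums_mult geometric_sums) simp
  have "cmod (S - (\<Sum>j<Suc k. p j * t ^ j)) \<le> M * (A * cmod t) ^ Suc k * (1 / (1 - 1/2))"
  proof -
    have "norm (\<Sum>j. p (j + Suc k) * t ^ (j + Suc k)) \<le> (\<Sum>j. M * (A * cmod t) ^ Suc k * (1/2) ^ j)"
      by (intro norm_suminf_le bd sums_summable[OF geo])
    then show ?thesis by (simp only: sums_unique[OF tail, symmetric] sums_unique[OF geo, symmetric])
  qed
  then show ?thesis by (simp add: lessThan_Suc_atMost)
qed

text \<open>
  The part of degree \<open>k\<close> is the limit, as \<open>t\<close> tends to 0, of \<open>f (t * y)\<close> minus its expansion below
  degree \<open>k\<close>, divided by \<open>t ^ k\<close>. By Cauchy's inequality the limit is uniform for bounded \<open>y\<close>, and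
  the approximating functions are holomorphic on complex lines by induction, so the limit is
  holomorphic on them as well.
\<close>
lemma hom_part_slice_entire:
  assumes f: "holomorphic_Cn f (ball 0 1)"
  shows "(\<lambda>x. hom_part f k (u + x *s v)) holomorphic_on UNIV"
proof (induction k rule: less_induct)
  case (less k)
  obtain M where M: "M \<ge> 0" "\<And>y. norm y \<le> 1/2 \<Longrightarrow> cmod (f y) \<le> M"
    using holomorphic_Cn_bounded[OF f, of "1/2"] by auto
  have bd: "cmod (hom_part f j y) \<le> M * (2 * norm y) ^ j" for j y
    using hom_part_Cauchy[OF f, of "1/2" M j y] M by (simp add: mult.commute)
  have "(\<lambda>x. hom_part f k (u + x *s v)) holomorphic_on ball 0 X" if X: "X > 0" for X
  proof -
    define Y where "Y = norm u + X * norm v + 1"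
    have Y: "Y \<ge> 1" using X by (simp add: Y_def)
    have nY: "norm (u + x *s v) \<le> Y" if "cmod x \<le> X" for x
    proof -
      have "norm (u + x *s v) \<le> norm u + cmod x * norm v"
        using norm_triangle_ineq[of u "x *s v"] by (simp add: norm_smult)
      also have "cmod x * norm v \<le> X * norm v" using that by (intro mult_right_mono) auto
      finally show ?thesis by (simp add: Y_def)
    qed
    define t :: "nat \<Rightarrow> real" where "t n = 1 / (4 * Y * real (Suc n))" for n
    have t: "t n > 0" "t n * Y \<le> 1/4" for n
    proof -
      show "t n > 0" using Y unfolding t_def by (intro divide_pos_pos mult_pos_pos) auto
      have "t n * Y = 1 / (4 * real (Suc n))" using Y by (simp add: t_def del: of_nat_Suc)
      also have "\<dots> \<le> 1 / (4 * 1)" by (intro divide_left_mono) auto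
      finally show "t n * Y \<le> 1/4" by simp
    qed
    define g where "g n x = (f (complex_of_real (t n) *s (u + x *s v))
       - (\<Sum>j<k. hom_part f j (u + x *s v) * of_real (t n) ^ j)) / of_real (t n) ^ k" for n x
    have g_hol: "g n holomorphic_on cball 0 X" for n
    proof -
      have eq: "complex_of_real (t n) *s (u + x *s v) = complex_of_real (t n) *s u + x *s (complex_of_real (t n) *s v)" for x
        by (simp add: vec_eq_iff algebra_simps)
      have "(\<lambda>x. f (complex_of_real (t n) *s u + x *s (complex_of_real (t n) *s v))) holomorphic_on cball 0 X"
      proof (rule holomorphic_Cn_slice[OF f])
        fix x :: complex assume "x \<in> cball 0 X"
        then have "norm (u + x *s v) \<le> Y" by (intro nY) simp
        then have "t n * norm (u + x *s v) \<le> t n * Y" using t[of n] by (intro mult_left_mono) auto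
        then have "norm (complex_of_real (t n) *s (u + x *s v)) < 1"
          using t[of n] unfolding norm_smult norm_of_real abs_of_pos[OF t(1)] by linarith
        then show "complex_of_real (t n) *s u + x *s (complex_of_real (t n) *s v) \<in> ball 0 1"
          unfolding eq by simp
      qed
      then have "(\<lambda>x. f (complex_of_real (t n) *s (u + x *s v))) holomorphic_on cball 0 X"
        unfolding eq .
      moreover have "(\<lambda>x. hom_part f j (u + x *s v)) holomorphic_on cball 0 X" if "j < k" for j
        using less.IH[OF that] by (rule holomorphic_on_subset) simp
      ultimately show ?thesis
        unfolding g_def using t[of n] by (intro holomorphic_intros) auto
    qed
    have close: "cmod (g n x - hom_part f k (u + x *s v)) \<le> 2 * M * (2 * Y) ^ Suc k * t n"
      if x: "x \<in> cball 0 X" for n x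
    proof -
      define y where "y = u + x *s v"
      have y: "norm y \<le> Y" using x by (simp add: y_def nY)
      have ty: "t n * norm y \<le> 1/4"
        using mult_left_mono[OF y, of "t n"] t[of n] by linarith
      have "cmod (f (complex_of_real (t n) *s y) - (\<Sum>j\<le>k. hom_part f j y * complex_of_real (t n) ^ j))
          \<le> 2 * M * ((2 * norm y) * cmod (complex_of_real (t n))) ^ Suc k"
        using ty t[of n]
        by (intro power_series_remainder bd hom_part_sums[OF f]) (simp_all add: mult_ac)
      also have "\<dots> \<le> 2 * M * ((2 * Y) * t n) ^ Suc k"
        using y t[of n] M Y by (intro mult_left_mono power_mono mult_right_mono) auto
      also have "\<dots> = 2 * M * (2 * Y) ^ Suc k * t n * t n ^ k"
        by (simp add: power_mult_distrib mult_ac)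
      finally have A: "cmod (f (complex_of_real (t n) *s y) - (\<Sum>j\<le>k. hom_part f j y * complex_of_real (t n) ^ j))
        \<le> 2 * M * (2 * Y) ^ Suc k * t n * t n ^ k" .
      have "g n x - hom_part f k y
        = (f (complex_of_real (t n) *s y) - (\<Sum>j\<le>k. hom_part f j y * complex_of_real (t n) ^ j)) / of_real (t n) ^ k"
        unfolding lessThan_Suc_atMost[symmetric] sum.lessThan_Suc
        using t[of n] by (simp add: g_def y_def diff_divide_distrib add_divide_distrib)
      then have "cmod (g n x - hom_part f k y)
        = cmod (f (complex_of_real (t n) *s y) - (\<Sum>j\<le>k. hom_part f j y * complex_of_real (t n) ^ j)) / t n ^ k"
        using t[of n] by (simp add: norm_divide norm_power)
      also have "\<dots> \<le> 2 * M * (2 * Y) ^ Suc k * t n"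
        using A t[of n] by (simp add: pos_divide_le_eq)
      finally show ?thesis by (simp add: y_def)
    qed
    have "t = (\<lambda>n. 1 / (4 * Y) * inverse (real (Suc n)))"
      unfolding t_def by (rule ext) (simp only: divide_inverse inverse_mult_distrib mult_1_left mult.assoc)
    moreover have "(\<lambda>n. 1 / (4 * Y) * inverse (real (Suc n))) \<longlonglongrightarrow> 1 / (4 * Y) * 0"
      by (intro tendsto_mult_left LIMSEQ_inverse_real_of_nat)
    ultimately have "t \<longlonglongrightarrow> 0" by simp
    then have lim: "(\<lambda>n. 2 * M * (2 * Y) ^ Suc k * t n) \<longlonglongrightarrow> 0"
      by (rule tendsto_mult_right_zero)
    have ul: "uniform_limit (cball 0 X) g (\<lambda>x. hom_part f k (u + x *s v)) sequentially"
    proof (rule uniform_limitI)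
      fix e :: real assume "e > 0"
      then have "\<forall>\<^sub>F n in sequentially. 2 * M * (2 * Y) ^ Suc k * t n < e"
        using lim by (rule order_tendstoD(2)[rotated])
      then show "\<forall>\<^sub>F n in sequentially. \<forall>x\<in>cball 0 X. dist (g n x) (hom_part f k (u + x *s v)) < e"
        by eventually_elim (auto simp: dist_norm intro: le_less_trans[OF close])
    qed
    have ev: "\<forall>\<^sub>F n in sequentially. continuous_on (cball 0 X) (g n) \<and> g n holomorphic_on ball 0 X"
      by (intro always_eventually allI conjI holomorphic_on_imp_continuous_on g_hol
          holomorphic_on_subset[OF g_hol ball_subset_cball])
    show ?thesis
      by (rule holomorphic_uniform_limit[OF ev ul trivial_limit_sequentially])
  qed note * = this
  show ?case
  proof (rule holomorphic_onI)
    fix x :: complex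
    have "x \<in> ball 0 (cmod x + 1)" by simp
    then show "(\<lambda>x. hom_part f k (u + x *s v)) field_differentiable at x within UNIV"
      using *[of "cmod x + 1"] holomorphic_on_imp_differentiable_at[of _ "ball 0 (cmod x + 1)" x]
      by (simp add: add_nonneg_pos)
  qed
qed

text \<open>
  An entire function of growth at most \<open>cmod x ^ k\<close> is a polynomial of degree at most \<open>k\<close>.
\<close>
lemma hom_part_slice_polynomial:
  assumes f: "holomorphic_Cn f (ball 0 1)"
  shows "\<exists>c. \<forall>x. hom_part f k (u + x *s v) = (\<Sum>l\<le>k. c l * x ^ l)"
proof -
  obtain M where M: "M \<ge> 0" "\<And>y. norm y \<le> 1/2 \<Longrightarrow> cmod (f y) \<le> M"
    using holomorphic_Cn_bounded[OF f, of "1/2"] by auto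
  have "cmod (hom_part f k (u + x *s v)) \<le> M * (2 * (norm u + norm v)) ^ k * cmod x ^ k" if "1 \<le> cmod x" for x
  proof -
    have "norm (u + x *s v) \<le> norm u * 1 + cmod x * norm v"
      using norm_triangle_ineq[of u "x *s v"] by (simp add: norm_smult)
    also have "\<dots> \<le> norm u * cmod x + cmod x * norm v"
      using that by (intro add_mono mult_left_mono) auto
    finally have le: "norm (u + x *s v) \<le> (norm u + norm v) * cmod x" by (simp add: algebra_simps)
    have "cmod (hom_part f k (u + x *s v)) \<le> M * (2 * norm (u + x *s v)) ^ k"
      using hom_part_Cauchy[OF f, of "1/2" M k "u + x *s v"] M by (simp add: mult_ac)
    also have "\<dots> \<le> M * (2 * ((norm u + norm v) * cmod x)) ^ k"
      using M le by (intro mult_left_mono power_mono) auto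
    finally show ?thesis by (simp add: power_mult_distrib mult_ac)
  qed
  then show ?thesis
    by (intro exI allI) (rule Liouville_polynomial[OF hom_part_slice_entire[OF f]])
qed

definition polynomial_fun :: "(complex ^ 'n \<Rightarrow> complex) \<Rightarrow> bool" where
  "polynomial_fun p \<longleftrightarrow> (\<exists>(A :: ('n \<Rightarrow> nat) set) a. finite A \<and> (\<forall>z. p z = (\<Sum>\<alpha>\<in>A. a \<alpha> * (\<Prod>i\<in>UNIV. (z $ i) ^ \<alpha> i))))"

lemma polynomial_fun_const: "polynomial_fun (\<lambda>z :: complex ^ 'n. c)"
  unfolding polynomial_fun_def
  by (intro exI[of _ "{\<lambda>_. 0}"] exI[of _ "\<lambda>_. c"]) simp

lemma polynomial_fun_coord: "polynomial_fun (\<lambda>z :: complex ^ 'n. z $ i)"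
proof -
  have "(\<Prod>j\<in>UNIV. (z $ j) ^ (if j = i then 1 else 0)) = z $ i" for z :: "complex ^ 'n"
    using prod.delta[of UNIV i "\<lambda>j. z $ j"] by (simp add: if_distrib[of "\<lambda>k. _ ^ k"] cong: if_cong)
  then show ?thesis
    unfolding polynomial_fun_def
    by (intro exI[of _ "{\<lambda>j. if j = i then 1 else 0}"] exI[of _ "\<lambda>_. 1"]) simp
qed

lemma polynomial_fun_add:
  assumes "polynomial_fun p" "polynomial_fun q"
  shows "polynomial_fun (\<lambda>z. p z + q z)"
proof -
  obtain A a where A: "finite A" "\<And>z. p z = (\<Sum>\<alpha>\<in>A. a \<alpha> * (\<Prod>i\<in>UNIV. (z $ i) ^ \<alpha> i))"
    using assms(1) unfolding polynomial_fun_def by blast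
  obtain B b where B: "finite B" "\<And>z. q z = (\<Sum>\<alpha>\<in>B. b \<alpha> * (\<Prod>i\<in>UNIV. (z $ i) ^ \<alpha> i))"
    using assms(2) unfolding polynomial_fun_def by blast
  have "p z = (\<Sum>\<alpha>\<in>A \<union> B. (if \<alpha> \<in> A then a \<alpha> else 0) * (\<Prod>i\<in>UNIV. (z $ i) ^ \<alpha> i))" for z
    unfolding A(2) using A(1) B(1) by (intro sum.mono_neutral_cong_left) auto
  moreover have "q z = (\<Sum>\<alpha>\<in>A \<union> B. (if \<alpha> \<in> B then b \<alpha> else 0) * (\<Prod>i\<in>UNIV. (z $ i) ^ \<alpha> i))" for z
    unfolding B(2) using A(1) B(1) by (intro sum.mono_neutral_cong_left) auto
  ultimately show ?thesis
    unfolding polynomial_fun_def using A(1) B(1)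
    by (intro exI[of _ "A \<union> B"] exI[of _ "\<lambda>\<alpha>. (if \<alpha> \<in> A then a \<alpha> else 0) + (if \<alpha> \<in> B then b \<alpha> else 0)"])
       (simp add: distrib_right sum.distrib)
qed

lemma polynomial_fun_sum:
  "(\<And>j. j \<in> J \<Longrightarrow> polynomial_fun (p j)) \<Longrightarrow> polynomial_fun (\<lambda>z. \<Sum>j\<in>J. p j z)"
  by (induction J rule: infinite_finite_induct) (auto intro: polynomial_fun_add polynomial_fun_const)

lemma polynomial_fun_monomial: "polynomial_fun (\<lambda>z. c * (\<Prod>i\<in>UNIV. (z $ i) ^ \<alpha> i))"
  unfolding polynomial_fun_def by (intro exI[of _ "{\<alpha>}"] exI[of _ "\<lambda>_. c"]) simp

lemma polynomial_fun_mult: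
  assumes "polynomial_fun p" "polynomial_fun q"
  shows "polynomial_fun (\<lambda>z. p z * q z)"
proof -
  obtain A a where A: "finite A" "\<And>z. p z = (\<Sum>\<alpha>\<in>A. a \<alpha> * (\<Prod>i\<in>UNIV. (z $ i) ^ \<alpha> i))"
    using assms(1) unfolding polynomial_fun_def by blast
  obtain B b where B: "finite B" "\<And>z. q z = (\<Sum>\<alpha>\<in>B. b \<alpha> * (\<Prod>i\<in>UNIV. (z $ i) ^ \<alpha> i))"
    using assms(2) unfolding polynomial_fun_def by blast
  have "p z * q z = (\<Sum>\<alpha>\<in>A. \<Sum>\<beta>\<in>B. (a \<alpha> * b \<beta>) * (\<Prod>i\<in>UNIV. (z $ i) ^ (\<alpha> i + \<beta> i)))" for z
    unfolding A(2) B(2) sum_product by (simp add: power_add prod.distrib mult_ac)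
  then show ?thesis
    by (simp only:) (intro polynomial_fun_sum polynomial_fun_monomial)
qed

lemma polynomial_fun_prod:
  "(\<And>j. j \<in> J \<Longrightarrow> polynomial_fun (p j)) \<Longrightarrow> polynomial_fun (\<lambda>z. \<Prod>j\<in>J. p j z)"
  by (induction J rule: infinite_finite_induct) (auto intro: polynomial_fun_mult polynomial_fun_const)

definition lagrange_basis :: "nat \<Rightarrow> nat \<Rightarrow> complex \<Rightarrow> complex" where
  "lagrange_basis k j x = (\<Prod>m\<in>{..k} - {j}. (x - of_nat m) / (of_nat j - of_nat m))"

lemma lagrange_interpolation:
  fixes c :: "nat \<Rightarrow> complex" and k :: nat
  defines "q \<equiv> \<lambda>x. \<Sum>l\<le>k. c l * x ^ l"
  shows "q x = (\<Sum>j\<le>k. q (of_nat j) * lagrange_basis k j x)"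
proof -
  define P where "P = (\<Sum>l\<le>k. monom (c l) l)"
  define L where "L j = (\<Prod>m\<in>{..k} - {j}. smult (1 / (of_nat j - of_nat m)) [:- of_nat m, 1 :: complex:])" for j :: nat
  define Q where "Q = (\<Sum>j\<le>k. smult (q (of_nat j)) (L j))"
  have poly_P: "poly P x = q x" for x by (simp add: P_def q_def poly_sum poly_monom)
  have poly_L: "poly (L j) x = lagrange_basis k j x" for j x
    by (simp add: L_def lagrange_basis_def poly_prod diff_divide_distrib)
  have poly_Q: "poly Q x = (\<Sum>j\<le>k. q (of_nat j) * lagrange_basis k j x)" for x
    by (simp add: Q_def poly_sum poly_L)
  have "degree P \<le> k" unfolding P_def
    by (intro degree_sum_le) (auto intro: order_trans[OF degree_monom_le])
  moreover have "degree Q \<le> k"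
    unfolding Q_def
  proof (intro degree_sum_le)
    fix j assume j: "j \<in> {..k}"
    have "degree (L j) \<le> (\<Sum>m\<in>{..k} - {j}. degree (smult (1 / (of_nat j - of_nat m)) [:- of_nat m, 1:] :: complex poly))"
      unfolding L_def by (rule order_trans[OF degree_prod_sum_le]) (simp_all add: o_def)
    also have "\<dots> \<le> (\<Sum>m\<in>{..k} - {j}. 1)" by (intro sum_mono) (auto simp: degree_smult_eq)
    also have "\<dots> = k" using j by simp
    finally show "degree (smult (q (of_nat j)) (L j)) \<le> k" using degree_smult_le le_trans by blast
  qed simp
  moreover have "poly P y = poly Q y" if y: "y \<in> of_nat ` {..k}" for y
  proof -
    obtain m where m: "y = of_nat m" "m \<le> k" using y by (elim imageE) simp
    have "lagrange_basis k j (of_nat m) = (if j = m then 1 else 0)" if "j \<le> k" for j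
    proof (cases "j = m")
      case True
      then show ?thesis by (auto simp: lagrange_basis_def intro!: prod.neutral)
    next
      case False
      then show ?thesis using m by (auto simp: lagrange_basis_def intro!: prod_zero bexI[of _ m])
    qed
    then have "poly Q y = (\<Sum>j\<le>k. if j = m then q (of_nat j) else 0)"
      unfolding poly_Q m by (intro sum.cong) auto
    then show ?thesis using m by (simp add: poly_P)
  qed
  moreover have "card ((of_nat :: nat \<Rightarrow> complex) ` {..k}) = Suc k"
    by (subst card_image) (auto simp: inj_on_def)
  ultimately have "P = Q"
    by (intro poly_eqI_degree[of "of_nat ` {..k}"]) auto
  then show ?thesis using poly_P[of x] poly_Q[of x] by simp
qed

text \<open>
  A function that is a polynomial of degree at most \<open>k\<close> on every line is a polynomial in all
  variables: Lagrange interpolation at \<open>0, \<dots>, k\<close> in one coordinate after the other expresses it by its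
  values at finitely many points.
\<close>
lemma polynomial_fun_of_separate:
  fixes p :: "complex ^ 'n \<Rightarrow> complex"
  assumes sep: "\<And>u v. \<exists>c. \<forall>x. p (u + x *s v) = (\<Sum>l\<le>k. c l * x ^ l)"
  shows "polynomial_fun p"
proof -
  have "finite S \<Longrightarrow> (\<And>u v. \<exists>c. \<forall>x. p (u + x *s v) = (\<Sum>l\<le>k. c l * x ^ l)) \<Longrightarrow>
      polynomial_fun (\<lambda>z. p (\<chi> i. if i \<in> S then z $ i else 0))" for S and p :: "complex ^ 'n \<Rightarrow> complex"
  proof (induction S arbitrary: p rule: finite_induct)
    case empty
    then show ?case by (simp add: polynomial_fun_const)
  next
    case (insert i S)
    have eq: "p (\<chi> m. if m \<in> insert i S then z $ m else 0)
      = (\<Sum>j\<le>k. p ((\<chi> m. if m \<in> S then z $ m else 0) + of_nat j *s axis i 1) * lagrange_basis k j (z $ i))" for z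
    proof -
      define u where "u = (\<chi> m. if m \<in> S then z $ m else 0)"
      obtain c where c: "\<And>x. p (u + x *s axis i 1) = (\<Sum>l\<le>k. c l * x ^ l)"
        using insert.prems[of u "axis i 1"] by blast
      have "(\<chi> m. if m \<in> insert i S then z $ m else 0) = u + (z $ i) *s axis i 1"
        using insert.hyps by (auto simp: vec_eq_iff u_def axis_def)
      then show ?thesis
        using lagrange_interpolation[where c = c and k = k and x = "z $ i"] by (simp add: c u_def[symmetric])
    qed
    have "polynomial_fun (\<lambda>z. p ((\<chi> m. if m \<in> S then z $ m else 0) + of_nat j *s axis i 1))" for j
    proof (rule insert.IH)
      fix u v
      have "p ((u + x *s v) + of_nat j *s axis i 1) = p ((u + of_nat j *s axis i 1) + x *s v)" for x
        by (simp add: add_ac)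
      then show "\<exists>c. \<forall>x. p ((u + x *s v) + of_nat j *s axis i 1) = (\<Sum>l\<le>k. c l * x ^ l)"
        using insert.prems[of "u + of_nat j *s axis i 1" v] by simp
    qed
    moreover have "polynomial_fun (\<lambda>z. lagrange_basis k j (z $ i))" for j
    proof -
      have "lagrange_basis k j (z $ i) = (\<Prod>m\<in>{..k} - {j}. (1 / (of_nat j - of_nat m)) * (z $ i + (- of_nat m)))" for z :: "complex ^ 'n"
        by (simp add: lagrange_basis_def)
      then show ?thesis
        by (simp only:) (intro polynomial_fun_prod polynomial_fun_mult polynomial_fun_add polynomial_fun_const polynomial_fun_coord)
    qed
    ultimately show ?case
      unfolding eq by (intro polynomial_fun_sum polynomial_fun_mult)
  qed
  from this[OF finite[of UNIV] sep] show ?thesis by simp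
qed

lemma finite_multi_indices: "finite {\<alpha> :: 'n::finite \<Rightarrow> nat. sum \<alpha> UNIV = k}"
proof (rule finite_subset)
  show "{\<alpha> :: 'n \<Rightarrow> nat. sum \<alpha> UNIV = k} \<subseteq> PiE UNIV (\<lambda>_. {..k})"
  proof
    fix \<alpha> :: "'n \<Rightarrow> nat" assume "\<alpha> \<in> {\<alpha>. sum \<alpha> UNIV = k}"
    then have "\<alpha> i \<le> k" for i using member_le_sum[of i UNIV \<alpha>] by auto
    then show "\<alpha> \<in> PiE UNIV (\<lambda>_. {..k})" by auto
  qed
qed (auto intro: finite_PiE)

text \<open>
  Along the line through \<open>z\<close> the monomial sum is a polynomial in the scalar \<open>c\<close> that equals
  \<open>p z * c ^ k\<close>; comparing the coefficients of \<open>c ^ k\<close> leaves the monomials of degree \<open>k\<close>.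
\<close>
lemma homogeneous_poly_of_polynomial_fun:
  fixes p :: "complex ^ 'n \<Rightarrow> complex"
  assumes p: "polynomial_fun p" and hom: "\<And>c z. p (c *s z) = c ^ k * p z"
  shows "homogeneous_poly k p"
proof -
  obtain A a where A: "finite A" "\<And>z. p z = (\<Sum>\<alpha>\<in>A. a \<alpha> * (\<Prod>i\<in>UNIV. (z $ i) ^ \<alpha> i))"
    using p unfolding polynomial_fun_def by blast
  define m where "m \<alpha> z = (\<Prod>i\<in>UNIV. (z $ i) ^ \<alpha> i)" for \<alpha> and z :: "complex ^ 'n"
  have mc: "m \<alpha> (c *s z) = c ^ sum \<alpha> UNIV * m \<alpha> z" for \<alpha> c and z :: "complex ^ 'n"
    by (simp add: m_def power_mult_distrib prod.distrib power_sum)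
  have Am: "p z = (\<Sum>\<alpha>\<in>A. a \<alpha> * m \<alpha> z)" for z by (simp add: A(2) m_def)
  define S where "S = {\<alpha> :: 'n \<Rightarrow> nat. sum \<alpha> UNIV = k}"
  have fS: "finite S" unfolding S_def by (rule finite_multi_indices)
  have "p z = (\<Sum>\<alpha>\<in>S. (if \<alpha> \<in> A then a \<alpha> else 0) * m \<alpha> z)" for z
  proof -
    have "poly (\<Sum>\<alpha>\<in>A. monom (a \<alpha> * m \<alpha> z) (sum \<alpha> UNIV)) c = poly (monom (p z) k) c" for c
      using hom[of c z] Am[of "c *s z"]
      by (simp add: poly_sum poly_monom mc mult_ac)
    then have "(\<Sum>\<alpha>\<in>A. monom (a \<alpha> * m \<alpha> z) (sum \<alpha> UNIV)) = monom (p z) k"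
      by (subst poly_eq_poly_eq_iff[symmetric]) auto
    then have "coeff (\<Sum>\<alpha>\<in>A. monom (a \<alpha> * m \<alpha> z) (sum \<alpha> UNIV)) k = p z" by simp
    then have "p z = (\<Sum>\<alpha>\<in>A. if sum \<alpha> UNIV = k then a \<alpha> * m \<alpha> z else 0)"
      by (simp add: coeff_sum cong: if_cong)
    also have "\<dots> = (\<Sum>\<alpha>\<in>A \<inter> S. a \<alpha> * m \<alpha> z)"
      using A(1) by (subst sum.inter_restrict) (auto simp: S_def)
    also have "\<dots> = (\<Sum>\<alpha>\<in>S. (if \<alpha> \<in> A then a \<alpha> else 0) * m \<alpha> z)"
      using fS by (intro sum.mono_neutral_cong_left) auto
    finally show ?thesis .
  qed
  then show ?thesis
    unfolding homogeneous_poly_def S_def m_def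
    by (intro exI[of _ "\<lambda>\<alpha>. if \<alpha> \<in> A then a \<alpha> else 0"] allI)
qed

lemma homogeneous_poly_hom_part:
  "holomorphic_Cn f (ball 0 1) \<Longrightarrow> homogeneous_poly k (hom_part f k)"
  by (rule homogeneous_poly_of_polynomial_fun[OF polynomial_fun_of_separate[OF hom_part_slice_polynomial] hom_part_smult])

lemma homogeneous_poly_smult:
  assumes "homogeneous_poly k p"
  shows "p (c *s z) = c ^ k * p z"
proof -
  obtain a where a: "\<And>z. p z = (\<Sum>\<alpha> | sum \<alpha> UNIV = k. a \<alpha> * (\<Prod>i\<in>UNIV. (z $ i) ^ \<alpha> i))"
    using assms unfolding homogeneous_poly_def by blast
  show ?thesis
    unfolding a sum_distrib_left
    by (intro sum.cong) (auto simp: power_mult_distrib prod.distrib power_sum[symmetric])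
qed

lemma power_series_zero_imp_zero:
  fixes a :: "nat \<Rightarrow> complex"
  assumes r: "0 < r" and s: "\<And>x. cmod x < r \<Longrightarrow> (\<lambda>n. a n * x ^ n) sums 0"
  shows "a n = 0"
proof (rule ccontr)
  assume an: "a n \<noteq> 0"
  show False
  proof (cases "n = 0")
    case True
    have "(\<lambda>n. a n * 0 ^ n) sums 0" using s[of 0] r by simp
    then show False using an True powser_sums_zero_iff[of a 0] by simp
  next
    case False
    obtain e :: real where "0 < e" "\<And>z. z \<in> cball (0::complex) e - {0} \<Longrightarrow> (0::complex) \<noteq> 0"
    proof (rule powser_0_nonzero[of r 0 a "\<lambda>_. 0" n])
      show "(\<lambda>n. a n * (x - 0) ^ n) sums 0" if "cmod (x - 0) < r" for x using s[of x] that by simp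
    qed (use r an False in auto)
    moreover from this(1) have "complex_of_real e \<in> cball 0 e - {0}" by simp
    ultimately show False by blast
  qed
qed

text \<open>
  Existence and uniqueness of the homogeneous expansion. For uniqueness, two expansions restricted to
  the line through \<open>z\<close> are power series with the same sum.
\<close>
lemma homogeneous_parts_eq_hom_part:
  fixes f :: "complex ^ 'n \<Rightarrow> complex"
  assumes f: "holomorphic_Cn f (ball 0 1)"
  shows "homogeneous_parts f = hom_part f"
  unfolding homogeneous_parts_def
proof (rule the_equality)
  show "(\<forall>k. homogeneous_poly k (hom_part f k)) \<and> (\<forall>z\<in>ball 0 1. (\<lambda>k. hom_part f k z) sums f z)"
    using homogeneous_poly_hom_part[OF f] hom_part_sums[OF f, of 1] by simp
  fix F assume F: "(\<forall>k. homogeneous_poly k (F k)) \<and> (\<forall>z\<in>ball 0 1. (\<lambda>k. F k z) sums f z)"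
  have Fh: "F n (c *s z) = c ^ n * F n z" for n c and z :: "complex ^ 'n"
    using F by (intro homogeneous_poly_smult) auto
  have ball: "F k z = hom_part f k z" if z: "z \<in> ball 0 1" for k and z :: "complex ^ 'n"
  proof -
    have "(\<lambda>n. (F n z - hom_part f n z) * x ^ n) sums 0" if x: "cmod x < 1" for x
    proof -
      have "cmod x * norm z \<le> 1 * norm z" using x by (intro mult_right_mono) auto
      then have lt: "cmod x * norm z < 1" using z by simp
      have "(\<lambda>n. F n (x *s z)) sums f (x *s z)"
        using F lt by (simp add: norm_smult)
      then have "(\<lambda>n. F n z * x ^ n) sums f (x *s z)"
        by (simp add: Fh mult.commute)
      from sums_diff[OF this hom_part_sums[OF f lt]] show ?thesis by (simp add: left_diff_distrib)
    qed
    then have "F k z - hom_part f k z = 0"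
      by (intro power_series_zero_imp_zero[of 1 "\<lambda>n. F n z - hom_part f n z"]) auto
    then show ?thesis by simp
  qed
  show "F = hom_part f"
  proof (intro ext)
    fix k and z :: "complex ^ 'n"
    define c where "c = complex_of_real (1 / (norm z + 1))"
    have nz: "norm z + 1 > 0" by (simp add: add_nonneg_pos)
    have c: "c \<noteq> 0" unfolding c_def of_real_eq_0_iff using nz by simp
    have "cmod c = 1 / (norm z + 1)" using nz unfolding c_def norm_of_real by simp
    then have "c *s z \<in> ball 0 1" using nz by (simp add: norm_smult)
    then have "F k (c *s z) = hom_part f k (c *s z)" by (rule ball)
    then have "c ^ k * F k z = c ^ k * hom_part f k z"
      by (simp add: Fh hom_part_smult[OF f])
    then show "F k z = hom_part f k z" using c by simp
  qed
qed

section \<open>Orthogonality of monomials in the weighted space\<close>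

lemma L2_norm_le_iff:
  assumes "c \<ge> 0"
  shows "L2_norm M g \<le> ennreal c \<longleftrightarrow> (\<integral>\<^sup>+\<eta>. ennreal ((cmod (g \<eta>))\<^sup>2) \<partial>M) \<le> ennreal (c\<^sup>2)"
proof -
  define I where "I = (\<integral>\<^sup>+\<eta>. ennreal ((cmod (g \<eta>))\<^sup>2) \<partial>M)"
  show ?thesis
  proof (cases "I = \<infinity>")
    case True
    then show ?thesis by (simp add: L2_norm_def I_def[symmetric] top_unique)
  next
    case False
    then obtain x where x: "I = ennreal x" "x \<ge> 0" by (cases I) auto
    have "sqrt x \<le> c \<longleftrightarrow> x \<le> c\<^sup>2" using assms x(2) by (auto simp: real_sqrt_le_iff' real_le_rsqrt sqrt_le_D intro: real_le_lsqrt)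
    then show ?thesis using assms x by (simp add: L2_norm_def I_def[symmetric])
  qed
qed

text \<open>
  The squared distance of \<open>G\<close> from its projection to the span of \<open>e 0, \<dots>, e K\<close> is nonnegative.
\<close>
lemma Bessel_inequality:
  fixes e :: "nat \<Rightarrow> 'a \<Rightarrow> complex"
  assumes G2: "integrable M (\<lambda>x. G x * cnj (G x))"
    and Ge: "\<And>k. integrable M (\<lambda>x. G x * cnj (e k x))"
    and ee: "\<And>k l. integrable M (\<lambda>x. e k x * cnj (e l x))"
    and I1: "\<And>k. (LINT x|M. G x * cnj (e k x)) = d k * of_real (N k)"
    and I2: "\<And>k l. (LINT x|M. e k x * cnj (e l x)) = (if k = l then of_real (N k) else 0)"
  shows "(\<Sum>k\<le>K. (cmod (d k))\<^sup>2 * N k) \<le> Re (LINT x|M. G x * cnj (G x))"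
proof -
  define P where "P x = (\<Sum>k\<le>K. d k * e k x)" for x
  define S where "S = (\<Sum>k\<le>K. (cmod (d k))\<^sup>2 * N k)"
  have intGP: "integrable M (\<lambda>x. G x * cnj (P x))"
    and GP: "(LINT x|M. G x * cnj (P x)) = of_real S"
  proof -
    have eq: "G x * cnj (P x) = (\<Sum>k\<le>K. cnj (d k) * (G x * cnj (e k x)))" for x
      by (simp add: P_def sum_distrib_left mult_ac)
    show "integrable M (\<lambda>x. G x * cnj (P x))" unfolding eq using Ge by simp
    have "(LINT x|M. G x * cnj (P x)) = (\<Sum>k\<le>K. cnj (d k) * (d k * of_real (N k)))"
      unfolding eq by (subst Bochner_Integration.integral_sum) (simp_all add: Ge I1)
    also have "\<dots> = of_real S"
      unfolding S_def of_real_sum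
      by (intro sum.cong) (simp_all add: complex_mult_cnj_norm[symmetric] mult_ac)
    finally show "(LINT x|M. G x * cnj (P x)) = of_real S" .
  qed
  have intPG: "integrable M (\<lambda>x. P x * cnj (G x))"
    and PG: "(LINT x|M. P x * cnj (G x)) = of_real S"
  proof -
    have eq: "P x * cnj (G x) = cnj (G x * cnj (P x))" for x by simp
    show "integrable M (\<lambda>x. P x * cnj (G x))" unfolding eq using intGP by (simp only: integrable_cnj)
    have "(LINT x|M. P x * cnj (G x)) = (LINT x|M. cnj (G x * cnj (P x)))" by (simp only: eq)
    also have "\<dots> = cnj (LINT x|M. G x * cnj (P x))" by (rule Bochner_Integration.integral_cnj)
    finally show "(LINT x|M. P x * cnj (G x)) = of_real S" by (simp add: GP)
  qed
  have intPP: "integrable M (\<lambda>x. P x * cnj (P x))"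
    and PP: "(LINT x|M. P x * cnj (P x)) = of_real S"
  proof -
    have eq: "P x * cnj (P x) = (\<Sum>k\<le>K. \<Sum>l\<le>K. d k * cnj (d l) * (e k x * cnj (e l x)))" for x
      by (simp add: P_def sum_product mult_ac)
    show "integrable M (\<lambda>x. P x * cnj (P x))" unfolding eq using ee by simp
    have "(LINT x|M. P x * cnj (P x)) = (\<Sum>k\<le>K. \<Sum>l\<le>K. d k * cnj (d l) * (if k = l then of_real (N k) else 0))"
      unfolding eq by (subst Bochner_Integration.integral_sum, simp add: ee)+ (simp add: ee I2)
    also have "\<dots> = (\<Sum>k\<le>K. d k * cnj (d k) * of_real (N k))"
      by (intro sum.cong) (simp_all add: if_distrib[of "\<lambda>x. _ * x"] sum.delta cong: if_cong)
    also have "\<dots> = of_real S"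
      unfolding S_def of_real_sum
      by (intro sum.cong) (simp_all add: complex_mult_cnj_norm[symmetric] mult_ac)
    finally show "(LINT x|M. P x * cnj (P x)) = of_real S" .
  qed
  have "(LINT x|M. of_real ((cmod (G x - P x))\<^sup>2)) = (LINT x|M. G x * cnj (G x) - G x * cnj (P x) - P x * cnj (G x) + P x * cnj (P x))"
    by (intro Bochner_Integration.integral_cong refl) (simp only: complex_norm_square, simp add: algebra_simps)
  also have "\<dots> = (LINT x|M. G x * cnj (G x)) - of_real S"
    using G2 intGP intPG intPP by (simp add: GP PG PP)
  finally have "Re (LINT x|M. of_real ((cmod (G x - P x))\<^sup>2)) = Re (LINT x|M. G x * cnj (G x)) - S" by simp
  moreover have "Re (LINT x|M. of_real ((cmod (G x - P x))\<^sup>2)) = (LINT x|M. (cmod (G x - P x))\<^sup>2)"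
    by (simp only: integral_complex_of_real Re_complex_of_real)
  moreover have "0 \<le> (LINT x|M. (cmod (G x - P x))\<^sup>2)" by simp
  ultimately show ?thesis unfolding S_def[symmetric] by linarith
qed

lemma measurable_cnj [measurable (raw), simp]:
  "f \<in> borel_measurable M \<Longrightarrow> (\<lambda>x. cnj (f x)) \<in> borel_measurable M"
  by (rule borel_measurable_continuous_on[of cnj]) (intro continuous_intros)

lemma space_weighted_measure [simp]: "space (weighted_measure w :: (complex ^ 'n) measure) = sphere 0 1"
  by (simp add: weighted_measure_def)

lemma measurable_weighted_measure [simp]:
  "f \<in> borel_measurable borel \<Longrightarrow> f \<in> borel_measurable (weighted_measure w :: (complex ^ 'n) measure)"
  by (simp add: weighted_measure_def)

lemma finite_measure_defect_weight:
  fixes i :: "'n::finite"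
  assumes n: "CARD('n) > 1" and a: "\<bar>a\<bar> < real CARD('n) - 1"
  shows "finite_measure (weighted_measure (defect_weight i a))"
proof (rule finite_measureI)
  have "emeasure (weighted_measure (defect_weight i a)) (sphere 0 1)
    = (\<integral>\<^sup>+\<eta>. ennreal (defect_weight i a \<eta>) * indicator (sphere 0 1) \<eta> \<partial>sphere_measure)"
    unfolding weighted_measure_def by (rule emeasure_density) (auto simp: sets_sphere_measure_iff)
  also have "\<dots> = (\<integral>\<^sup>+\<eta>. ennreal (defect_weight i a \<eta>) \<partial>sphere_measure)"
    by (rule nn_integral_cong) simp
  also have "\<dots> < \<infinity>" using A2_defect_weight[OF n a, of i] by (simp add: A2_weight_def)
  finally show "emeasure (weighted_measure (defect_weight i a)) (space (weighted_measure (defect_weight i a))) \<noteq> \<infinity>"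
    by simp
qed

lemma integral_weighted_rotation:
  fixes i :: "'n::finite" and g :: "complex ^ 'n \<Rightarrow> complex"
  assumes c: "\<And>j. cmod (c j) = 1" and g: "g \<in> borel_measurable borel"
  shows "(LINT \<eta>|weighted_measure (defect_weight i a). g (\<chi> j. c j * \<eta> $ j))
    = (LINT \<eta>|weighted_measure (defect_weight i a). g \<eta>)"
proof -
  let ?w = "defect_weight i a"
  have U: "unitary_map (\<lambda>\<eta> :: complex ^ 'n. \<chi> j. c j * \<eta> $ j)" by (rule unitary_map_rotations[OF c])
  have gU: "(\<lambda>\<eta>. g (\<chi> j. c j * \<eta> $ j)) \<in> borel_measurable borel"
    using measurable_comp[OF unitary_map_measurable[OF U] g] by (simp add: o_def)
  have w: "?w (\<chi> j. c j * \<eta> $ j) = ?w \<eta>" for \<eta> by (simp add: defect_weight_def defect_rotation c)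
  have wg: "(\<lambda>\<eta>. ?w \<eta> *\<^sub>R g \<eta>) \<in> borel_measurable borel" using g by measurable
  have pos: "AE \<eta> in sphere_measure. 0 \<le> ?w \<eta>"
    by (rule AE_I2) (simp add: less_imp_le[OF defect_weight_pos])
  have dens: "(LINT \<eta>|weighted_measure ?w. h \<eta>) = (LINT \<eta>|sphere_measure. ?w \<eta> *\<^sub>R h \<eta>)"
    if "h \<in> borel_measurable borel" for h :: "complex ^ 'n \<Rightarrow> complex"
    unfolding weighted_measure_def using that pos by (intro integral_density) simp_all
  have "(LINT \<eta>|weighted_measure ?w. g (\<chi> j. c j * \<eta> $ j))
    = (LINT \<eta>|sphere_measure. ?w (\<chi> j. c j * \<eta> $ j) *\<^sub>R g (\<chi> j. c j * \<eta> $ j))"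
    unfolding dens[OF gU] by (simp add: w)
  also have "\<dots> = (LINT \<eta>|sphere_measure. ?w \<eta> *\<^sub>R g \<eta>)"
    using integral_sphere_unitary[OF U, of "\<lambda>\<eta>. ?w \<eta> *\<^sub>R g \<eta>"] wg by simp
  finally show ?thesis using dens[OF g] by simp
qed

text \<open>
  The weighted measure is invariant under independent rotations of the coordinates. If the exponents
  of a coordinate \<open>l\<close> differ, a rotation of this coordinate alone by the angle
  \<open>pi / (\<alpha> l - \<beta> l)\<close> changes the sign of the integrand.
\<close>
lemma monomials_orthogonal:
  fixes i :: "'n::finite" and \<alpha> \<beta> :: "'n \<Rightarrow> nat"
  assumes ne: "\<alpha> \<noteq> \<beta>"
  shows "(LINT \<eta>|weighted_measure (defect_weight i a).
    (\<Prod>j\<in>UNIV. (\<eta> $ j) ^ \<alpha> j) * cnj (\<Prod>j\<in>UNIV. (\<eta> $ j) ^ \<beta> j)) = 0"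
proof -
  let ?M = "weighted_measure (defect_weight i a)"
  obtain l where l: "\<alpha> l \<noteq> \<beta> l" using ne by blast
  define \<phi> where "\<phi> = pi / (real (\<alpha> l) - real (\<beta> l))"
  define c where "c j = (if j = l then cis \<phi> else 1)" for j
  define g where "g \<eta> = (\<Prod>j\<in>UNIV. (\<eta> $ j) ^ \<alpha> j) * cnj (\<Prod>j\<in>UNIV. (\<eta> $ j) ^ \<beta> j)" for \<eta> :: "complex ^ 'n"
  have "continuous_on UNIV g" unfolding g_def by (intro continuous_intros)
  then have mg: "g \<in> borel_measurable borel" by (rule borel_measurable_continuous_onI)
  have pr: "(\<Prod>j\<in>UNIV. (c j * \<eta> $ j) ^ \<gamma> j) = cis \<phi> ^ \<gamma> l * (\<Prod>j\<in>UNIV. (\<eta> $ j) ^ \<gamma> j)"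
    for \<gamma> :: "'n \<Rightarrow> nat" and \<eta> :: "complex ^ 'n"
  proof -
    have "(\<Prod>j\<in>UNIV. c j ^ \<gamma> j) = (\<Prod>j\<in>UNIV. if j = l then cis \<phi> ^ \<gamma> j else 1)"
      by (intro prod.cong) (auto simp: c_def)
    then show ?thesis by (simp add: power_mult_distrib prod.distrib)
  qed
  have "cis \<phi> ^ \<alpha> l * cnj (cis \<phi> ^ \<beta> l) = cis (real (\<alpha> l) * \<phi> - real (\<beta> l) * \<phi>)"
    by (simp add: Complex.DeMoivre cis_cnj cis_mult)
  also have "real (\<alpha> l) * \<phi> - real (\<beta> l) * \<phi> = pi"
  proof -
    have "real (\<alpha> l) - real (\<beta> l) \<noteq> 0" using l by simp
    then show ?thesis unfolding \<phi>_def left_diff_distrib[symmetric] by simp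
  qed
  finally have m1: "cis \<phi> ^ \<alpha> l * cnj (cis \<phi> ^ \<beta> l) = -1" by simp
  have "g (\<chi> j. c j * \<eta> $ j) = (cis \<phi> ^ \<alpha> l * cnj (cis \<phi> ^ \<beta> l)) * g \<eta>" for \<eta>
    by (simp add: g_def pr)
  then have rot: "g (\<chi> j. c j * \<eta> $ j) = - g \<eta>" for \<eta> by (simp only: m1) simp
  have c1: "cmod (c j) = 1" for j by (simp add: c_def)
  have "(LINT \<eta>|?M. g \<eta>) = (LINT \<eta>|?M. g (\<chi> j. c j * \<eta> $ j))"
    by (rule integral_weighted_rotation[symmetric, OF c1 mg])
  also have "\<dots> = - (LINT \<eta>|?M. g \<eta>)" by (simp add: rot)
  finally have "(LINT \<eta>|?M. g \<eta>) = 0" by simp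
  then show ?thesis by (simp add: g_def)
qed

lemma homogeneous_poly_continuous:
  assumes "homogeneous_poly k p" shows "continuous_on S p"
proof -
  obtain c where c: "\<And>z. p z = (\<Sum>\<alpha> | sum \<alpha> UNIV = k. c \<alpha> * (\<Prod>j\<in>UNIV. (z $ j) ^ \<alpha> j))"
    using assms unfolding homogeneous_poly_def by blast
  have "p = (\<lambda>z. \<Sum>\<alpha> | sum \<alpha> UNIV = k. c \<alpha> * (\<Prod>j\<in>UNIV. (z $ j) ^ \<alpha> j))"
    using c by (rule ext)
  then show ?thesis by (simp only:) (intro continuous_intros)
qed

lemma integrable_weighted:
  fixes i :: "'n::finite" and g :: "complex ^ 'n \<Rightarrow> complex"
  assumes n: "CARD('n) > 1" and a: "\<bar>a\<bar> < real CARD('n) - 1"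
    and g: "g \<in> borel_measurable (weighted_measure (defect_weight i a))"
    and b: "\<And>\<eta>. norm \<eta> = 1 \<Longrightarrow> cmod (g \<eta>) \<le> B"
  shows "integrable (weighted_measure (defect_weight i a)) g"
  by (rule finite_measure.integrable_const_bound[OF finite_measure_defect_weight[OF n a], where B = B])
     (use b g in \<open>auto intro!: AE_I2\<close>)

lemma integrable_weighted_continuous:
  fixes i :: "'n::finite" and g :: "complex ^ 'n \<Rightarrow> complex"
  assumes n: "CARD('n) > 1" and a: "\<bar>a\<bar> < real CARD('n) - 1" and g: "continuous_on UNIV g"
  shows "integrable (weighted_measure (defect_weight i a)) g"
proof -
  have "bounded (g ` sphere 0 1)"
    by (intro compact_imp_bounded compact_continuous_image continuous_on_subset[OF g]) auto
  then obtain B where "\<forall>y\<in>sphere 0 1. cmod (g y) \<le> B" by (auto simp: bounded_iff)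
  then show ?thesis
    using borel_measurable_continuous_onI[OF g] by (intro integrable_weighted[OF n a, of _ i B]) auto
qed

text \<open>
  Only the monomial \<open>(\<eta> $ i) ^ k\<close> itself contributes, and its coefficient in a homogeneous polynomial
  of degree \<open>k\<close> is the value at \<open>axis i 1\<close>, where all other monomials of this degree vanish.
\<close>
lemma integral_homogeneous_poly:
  fixes i :: "'n::finite" and p :: "complex ^ 'n \<Rightarrow> complex"
  assumes n: "CARD('n) > 1" and a: "\<bar>a\<bar> < real CARD('n) - 1" and p: "homogeneous_poly m p"
  shows "(LINT \<eta>|weighted_measure (defect_weight i a). p \<eta> * cnj ((\<eta> $ i) ^ k))
    = (if m = k then p (axis i 1) * of_real (LINT \<eta>|weighted_measure (defect_weight i a). cmod (\<eta> $ i) ^ (2 * k)) else 0)"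
proof -
  let ?M = "weighted_measure (defect_weight i a)"
  obtain c where c: "\<And>z. p z = (\<Sum>\<alpha> | sum \<alpha> UNIV = m. c \<alpha> * (\<Prod>j\<in>UNIV. (z $ j) ^ \<alpha> j))"
    using p unfolding homogeneous_poly_def by blast
  define \<beta> where "\<beta> j = (if j = i then k else 0)" for j
  have sb: "sum \<beta> UNIV = k" by (simp add: \<beta>_def)
  have eb: "(\<Prod>j\<in>UNIV. (\<eta> $ j) ^ \<beta> j) = (\<eta> $ i) ^ k" for \<eta> :: "complex ^ 'n"
    using prod.delta[of UNIV i "\<lambda>j. (\<eta> $ j) ^ k"]
    by (simp add: \<beta>_def if_distrib[of "\<lambda>k. _ ^ k"] cong: if_cong)
  have int: "integrable ?M (\<lambda>\<eta>. (\<Prod>j\<in>UNIV. (\<eta> $ j) ^ \<alpha> j) * cnj ((\<eta> $ i) ^ k))" for \<alpha>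
    by (intro integrable_weighted_continuous n a continuous_intros)
  define J where "J \<alpha> = (LINT \<eta>|?M. (\<Prod>j\<in>UNIV. (\<eta> $ j) ^ \<alpha> j) * cnj ((\<eta> $ i) ^ k))" for \<alpha>
  have J0: "J \<alpha> = 0" if "\<alpha> \<noteq> \<beta>" for \<alpha>
    using monomials_orthogonal[OF that, of i a] by (simp add: J_def eb)
  have Jb: "J \<beta> = of_real (LINT \<eta>|?M. cmod (\<eta> $ i) ^ (2 * k))"
  proof -
    have "J \<beta> = (LINT \<eta>|?M. complex_of_real (cmod (\<eta> $ i) ^ (2 * k)))"
      unfolding J_def eb
      by (intro Bochner_Integration.integral_cong refl)
         (simp only: complex_mult_cnj_norm norm_power of_real_power power_mult[symmetric] mult.commute[of k 2])
    then show ?thesis by (simp only: integral_complex_of_real)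
  qed
  have "(LINT \<eta>|?M. p \<eta> * cnj ((\<eta> $ i) ^ k))
    = (LINT \<eta>|?M. (\<Sum>\<alpha> | sum \<alpha> UNIV = m. c \<alpha> * ((\<Prod>j\<in>UNIV. (\<eta> $ j) ^ \<alpha> j) * cnj ((\<eta> $ i) ^ k))))"
    unfolding c sum_distrib_right by (simp only: mult.assoc)
  also have "\<dots> = (\<Sum>\<alpha> | sum \<alpha> UNIV = m. c \<alpha> * J \<alpha>)"
    unfolding J_def using int by (subst Bochner_Integration.integral_sum) (simp_all del: complex_cnj_power)
  also have "\<dots> = (\<Sum>\<alpha> | sum \<alpha> UNIV = m. if \<alpha> = \<beta> then c \<beta> * J \<beta> else 0)"
    by (intro sum.cong) (auto simp: J0)
  also have "\<dots> = (if m = k then c \<beta> * J \<beta> else 0)"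
    by (subst sum.delta[OF finite_multi_indices]) (auto simp: sb)
  finally have 1: "(LINT \<eta>|?M. p \<eta> * cnj ((\<eta> $ i) ^ k)) = (if m = k then c \<beta> * J \<beta> else 0)" .
  have "p (axis i 1) = c \<beta>" if "m = k"
  proof -
    have "(\<Prod>j\<in>UNIV. (axis i 1 $ j) ^ \<alpha> j) = (if \<alpha> = \<beta> then 1 else (0::complex))" if "sum \<alpha> UNIV = k" for \<alpha>
    proof (cases "\<alpha> = \<beta>")
      case True
      then show ?thesis by (simp only: eb) (simp add: axis_def)
    next
      case False
      then obtain j where j: "\<alpha> j \<noteq> \<beta> j" by blast
      have "\<exists>j. j \<noteq> i \<and> \<alpha> j \<noteq> 0"
      proof (rule ccontr)
        assume "\<not> ?thesis"
        then have z: "\<alpha> j = 0" if "j \<noteq> i" for j using that by blast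
        then have "sum \<alpha> UNIV = \<alpha> i" by (subst sum.remove[of _ i]) auto
        then have "\<alpha> = \<beta>" using z that by (auto simp: \<beta>_def fun_eq_iff)
        then show False using False by simp
      qed
      then obtain j where "j \<noteq> i" "\<alpha> j \<noteq> 0" by blast
      then have "(axis i (1::complex) $ j) ^ \<alpha> j = 0" by (simp add: axis_def)
      then have "(\<Prod>j\<in>UNIV. (axis i (1::complex) $ j) ^ \<alpha> j) = 0" by (intro prod_zero) auto
      then show ?thesis using False by simp
    qed
    then have "p (axis i 1) = (\<Sum>\<alpha> | sum \<alpha> UNIV = m. if \<alpha> = \<beta> then c \<beta> else 0)"
      unfolding c using \<open>m = k\<close> by (intro sum.cong) auto
    then show ?thesis
      by (subst (asm) sum.delta[OF finite_multi_indices]) (simp add: sb \<open>m = k\<close>)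
  qed
  then show ?thesis using 1 Jb by simp
qed

section \<open>The Carleson embedding on the circle\<close>

text \<open>
  Here the choice of the exponent matters. The modulus of \<open>\<eta> $ i\<close> to the power \<open>2 * k\<close> is at least
  1/2 where the defect is at most \<open>1 / (2 * (1 + k))\<close>, and the weighted measure of the shell at this
  defect is of the order \<open>(1 + k) powr (- (CARD('n) - 1 + a)) = (1 + k) powr (- 2 * s)\<close>.
\<close>
lemma moment_lower_bound:
  fixes i :: "'n::finite"
  assumes n: "CARD('n) > 1" and a: "\<bar>a\<bar> < real CARD('n) - 1" "a = 2 * s - (real CARD('n) - 1)"
  obtains c where "c > 0" "\<And>k. c \<le> (1 + real k) powr (2 * s) *
    (LINT \<eta> :: complex ^ 'n|weighted_measure (defect_weight i a). cmod (\<eta> $ i) ^ (2 * k))"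
proof -
  let ?N = "CARD('n)" and ?w = "defect_weight i a"
  let ?M = "weighted_measure ?w"
  obtain q c0 where q: "0 < q" "q < 1" "0 < c0" and low: "\<And>u b t. cmod u = 1 \<Longrightarrow> 0 < b \<Longrightarrow> b \<le> 1 \<Longrightarrow> 0 < t \<Longrightarrow> t \<le> 1 \<Longrightarrow>
    ennreal (c0 * b * t ^ (?N - 1)) \<le> emeasure sphere_measure (tube_shell i q u b t)"
    using sphere_tube_lower[OF n] by blast
  define c where "c = c0 / 2 / (1 / q) powr \<bar>a\<bar> * (1 / 2) powr (2 * s)"
  show thesis
  proof (rule that)
    show "c > 0" using q by (simp add: c_def)
    fix k :: nat
    define t where "t = 1 / (2 * (1 + real k))"
    have t: "0 < t" "t \<le> 1" by (simp_all add: t_def field_simps)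
    define E where "E = tube_shell i q 1 1 t"
    have "E \<in> sets borel" unfolding E_def by (rule sets_sphere_Collect) measurable
    then have mE: "E \<in> sets sphere_measure" by (auto simp: E_def sets_sphere_measure_iff)
    have lowE: "ennreal (c0 * t ^ (?N - 1)) \<le> emeasure sphere_measure E"
      using low[of 1 1 t] t by (simp add: E_def)
    define h where "h = (\<lambda>\<eta> :: complex ^ 'n. cmod (\<eta> $ i) ^ (2 * k))"
    have mh: "h \<in> borel_measurable borel" unfolding h_def by measurable
    have bnd: "t powr a / (1 / q) powr \<bar>a\<bar> * (1 / 2) \<le> ?w \<eta> * h \<eta>" if e: "\<eta> \<in> E" for \<eta>
    proof (intro mult_mono)
      have d: "q * t \<le> defect i \<eta>" "defect i \<eta> \<le> t" using e by (auto simp: E_def)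
      have "t * 1 \<le> t * (1 / q)" using t q by (intro mult_left_mono) auto
      then show "t powr a / (1 / q) powr \<bar>a\<bar> \<le> ?w \<eta>"
        using d t q by (intro defect_weight_compare) (auto simp: mult.commute)
      have "1/2 \<le> 1 + real k * (- t)" by (simp add: t_def field_simps)
      also have "\<dots> \<le> (1 + (- t)) ^ k" using t by (intro Bernoulli_inequality) auto
      also have "\<dots> \<le> ((cmod (\<eta> $ i))\<^sup>2) ^ k" using d t by (intro power_mono) (auto simp: defect_def)
      finally show "1/2 \<le> h \<eta>" by (simp add: h_def power_mult)
      show "0 \<le> ?w \<eta>" using e by (intro less_imp_le defect_weight_pos) (auto simp: E_def)
    qed simp
    have "ennreal (t powr a / (1 / q) powr \<bar>a\<bar> * (1 / 2) * (c0 * t ^ (?N - 1)))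
      = ennreal (t powr a / (1 / q) powr \<bar>a\<bar> * (1 / 2)) * ennreal (c0 * t ^ (?N - 1))"
      using q t by (intro ennreal_mult) auto
    also have "\<dots> \<le> ennreal (t powr a / (1 / q) powr \<bar>a\<bar> * (1 / 2)) * emeasure sphere_measure E"
      by (intro mult_left_mono lowE) simp
    also have "\<dots> \<le> (\<integral>\<^sup>+\<eta>\<in>E. ennreal (?w \<eta> * h \<eta>) \<partial>sphere_measure)"
      by (intro set_nn_integral_bounds mE bnd) auto
    also have "\<dots> \<le> (\<integral>\<^sup>+\<eta>. ennreal (?w \<eta>) * ennreal (h \<eta>) \<partial>sphere_measure)"
      by (intro nn_integral_mono) (auto simp: indicator_def ennreal_mult'' h_def)
    also have "\<dots> = (\<integral>\<^sup>+\<eta>. ennreal (h \<eta>) \<partial>?M)"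
      unfolding weighted_measure_def using mh by (intro nn_integral_density[symmetric]) simp_all
    also have "\<dots> = ennreal (LINT \<eta>|?M. h \<eta>)"
    proof (rule nn_integral_eq_integral)
      show "integrable ?M h"
      proof (rule finite_measure.integrable_const_bound[OF finite_measure_defect_weight[OF n a(1)], where B = 1])
        show "AE x in ?M. norm (h x) \<le> 1"
        proof (rule AE_I2)
          fix x :: "complex ^ 'n" assume "x \<in> space ?M"
          then have "cmod (x $ i) \<le> 1" using Finite_Cartesian_Product.norm_nth_le[of x i] by simp
          then show "norm (h x) \<le> 1" by (simp add: h_def power_le_one)
        qed
      qed (use mh in simp)
    qed (simp add: h_def)
    finally have le: "t powr a / (1 / q) powr \<bar>a\<bar> * (1 / 2) * (c0 * t ^ (?N - 1)) \<le> (LINT \<eta>|?M. h \<eta>)"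
      by (subst (asm) ennreal_le_iff) (auto simp: h_def)
    have "t powr a * t ^ (?N - 1) = t powr (2 * s)"
      using t n a(2) by (simp add: powr_realpow[symmetric] powr_add[symmetric] of_nat_diff)
    moreover have "t powr a / (1 / q) powr \<bar>a\<bar> * (1 / 2) * (c0 * t ^ (?N - 1))
      = c0 / 2 / (1 / q) powr \<bar>a\<bar> * (t powr a * t ^ (?N - 1))"
      by (simp only: divide_inverse mult_ac)
    ultimately have eq1: "t powr a / (1 / q) powr \<bar>a\<bar> * (1 / 2) * (c0 * t ^ (?N - 1))
      = c0 / 2 / (1 / q) powr \<bar>a\<bar> * t powr (2 * s)"
      by (simp only:)
    have eq2: "t powr (2 * s) * (1 + real k) powr (2 * s) = (1 / 2) powr (2 * s)"
    proof -
      have "t * (1 + real k) = 1 / 2" by (simp add: t_def field_simps)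
      moreover have "t powr (2 * s) * (1 + real k) powr (2 * s) = (t * (1 + real k)) powr (2 * s)"
        using t by (simp add: powr_mult)
      ultimately show ?thesis by (simp only:)
    qed
    have "c = (1 + real k) powr (2 * s) * (t powr a / (1 / q) powr \<bar>a\<bar> * (1 / 2) * (c0 * t ^ (?N - 1)))"
      unfolding eq1 c_def eq2[symmetric] by (simp only: mult_ac)
    also have "\<dots> \<le> (1 + real k) powr (2 * s) * (LINT \<eta>|?M. h \<eta>)"
      by (intro mult_left_mono le) simp
    finally show "c \<le> (1 + real k) powr (2 * s) * (LINT \<eta> :: complex ^ 'n|?M. cmod (\<eta> $ i) ^ (2 * k))"
      by (simp add: h_def)
  qed
qed

lemma summable_powr_power:
  assumes "0 \<le> q" "q < 1"
  shows "summable (\<lambda>k. (1 + real k) powr s * q ^ k)"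
proof (cases "q = 0")
  case True
  then show ?thesis by (intro summable_finite[of "{0}"]) auto
next
  case False
  then have q: "0 < q" using assms by simp
  define r where "r = (1 + q) / 2"
  have r: "q < r" "r < 1" using assms by (auto simp: r_def)
  have lim: "(\<lambda>k. ((2 + real k) / (1 + real k)) powr s * q) \<longlonglongrightarrow> 1 powr s * q"
  proof (intro tendsto_intros)
    have "(\<lambda>k. 1 + inverse (real (Suc k))) \<longlonglongrightarrow> 1 + 0"
      by (intro tendsto_intros LIMSEQ_inverse_real_of_nat)
    moreover have "1 + inverse (real (Suc k)) = (2 + real k) / (1 + real k)" for k
      by (simp add: field_simps)
    ultimately show "(\<lambda>k. (2 + real k) / (1 + real k)) \<longlonglongrightarrow> 1" by simp
  qed simp
  then have "eventually (\<lambda>k. ((2 + real k) / (1 + real k)) powr s * q < r) sequentially"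
    using r by (intro order_tendstoD) auto
  then obtain K where K: "\<And>k. k \<ge> K \<Longrightarrow> ((2 + real k) / (1 + real k)) powr s * q < r"
    by (auto simp: eventually_sequentially)
  show ?thesis
  proof (rule summable_ratio_test[of r K])
    fix k assume k: "K \<le> k"
    have "(1 + real (Suc k)) powr s * q ^ Suc k = ((2 + real k) / (1 + real k)) powr s * q * ((1 + real k) powr s * q ^ k)"
      by (simp add: powr_divide)
    also have "\<dots> \<le> r * ((1 + real k) powr s * q ^ k)"
      using K[OF k] q by (intro mult_right_mono) auto
    finally show "norm ((1 + real (Suc k)) powr s * q ^ Suc k) \<le> r * norm ((1 + real k) powr s * q ^ k)"
      using q by simp
  qed (use r in auto)
qed

text \<open>
  Bessel's inequality for \<open>radial_power s f\<close> on the sphere of radius \<open>\<rho>\<close> and the functions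
  \<open>(\<eta> $ i) ^ k\<close>. The expansion converges uniformly on the unit sphere by Cauchy's inequality at a
  radius between \<open>\<rho>\<close> and 1, and may be integrated term by term.
\<close>
lemma coefficient_bound:
  fixes i :: "'n::finite" and f :: "complex ^ 'n \<Rightarrow> complex"
  assumes n: "CARD('n) > 1" and a: "\<bar>a\<bar> < real CARD('n) - 1"
    and f: "holomorphic_Cn f (ball 0 1)" and \<rho>: "0 < \<rho>" "\<rho> < 1" and N: "N \<ge> 0"
    and bound: "L2_norm (weighted_measure (defect_weight i a)) (\<lambda>\<eta>. radial_power s f (\<rho> *\<^sub>R \<eta>)) \<le> ennreal N"
  shows "(\<Sum>k\<le>K. (cmod (hom_part f k (axis i 1)))\<^sup>2 * \<rho> ^ (2 * k) * ((1 + real k) powr (2 * s) *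
    (LINT \<eta> :: complex ^ 'n|weighted_measure (defect_weight i a). cmod (\<eta> $ i) ^ (2 * k)))) \<le> N\<^sup>2"
proof -
  let ?M = "weighted_measure (defect_weight i a)"
  define Nk where "Nk k = (LINT \<eta> :: complex ^ 'n|?M. cmod (\<eta> $ i) ^ (2 * k))" for k
  define b where "b k = complex_of_real ((1 + real k) powr s * \<rho> ^ k)" for k
  define G where "G \<eta> = (\<Sum>k. b k * hom_part f k \<eta>)" for \<eta> :: "complex ^ 'n"
  have scale: "hom_part f k (\<rho> *\<^sub>R \<eta>) = of_real \<rho> ^ k * hom_part f k \<eta>" for k \<eta>
  proof -
    have "\<rho> *\<^sub>R \<eta> = complex_of_real \<rho> *s \<eta>" by (simp add: vec_eq_iff scaleR_conv_of_real[where 'a = complex])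
    then show ?thesis by (simp add: hom_part_smult[OF f])
  qed
  have G: "radial_power s f (\<rho> *\<^sub>R \<eta>) = G \<eta>" for \<eta>
    by (simp add: radial_power_def homogeneous_parts_eq_hom_part[OF f] G_def b_def scale mult.assoc)
  define r where "r = (1 + \<rho>) / 2"
  have r: "0 < r" "r < 1" "\<rho> < r" using \<rho> by (auto simp: r_def)
  obtain B where B: "B \<ge> 0" "\<And>y. norm y \<le> r \<Longrightarrow> cmod (f y) \<le> B"
    using holomorphic_Cn_bounded[OF f r(2)] by blast
  define T where "T k = B * ((1 + real k) powr s * (\<rho> / r) ^ k)" for k
  have sT: "summable T"
    unfolding T_def using \<rho> r by (intro summable_mult summable_powr_power) auto
  have bterm: "cmod (b k * hom_part f k \<eta>) \<le> T k" if "norm \<eta> = 1" for k \<eta>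
  proof -
    have "cmod (hom_part f k \<eta>) \<le> B * (1 / r) ^ k"
      using hom_part_Cauchy[OF f r(1,2) B(2), of k \<eta>] that by simp
    then have "cmod (b k * hom_part f k \<eta>) \<le> (1 + real k) powr s * \<rho> ^ k * (B * (1 / r) ^ k)"
      using \<rho> by (simp add: b_def norm_mult norm_power mult_left_mono)
    then show ?thesis by (simp add: T_def power_divide mult_ac)
  qed
  have cont: "continuous_on UNIV (hom_part f k)" for k
    by (rule homogeneous_poly_continuous[OF homogeneous_poly_hom_part[OF f]])
  have mF: "hom_part f k \<in> borel_measurable ?M" for k
    using borel_measurable_continuous_onI[OF cont] by simp
  have mG: "G \<in> borel_measurable ?M"
    unfolding G_def using mF by (intro borel_measurable_suminf) simp
  have Gb: "cmod (G \<eta>) \<le> suminf T" if "norm \<eta> = 1" for \<eta>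
    unfolding G_def by (intro norm_suminf_le bterm that sT)
  have mi: "(\<lambda>\<eta>. (\<eta> $ i) ^ k) \<in> borel_measurable ?M" for k
    by (intro measurable_weighted_measure borel_measurable_continuous_onI continuous_intros)
  have coord: "cmod ((\<eta> $ i) ^ k) \<le> 1" if "norm \<eta> = 1" for \<eta> :: "complex ^ 'n" and k
    using Finite_Cartesian_Product.norm_nth_le[of \<eta> i] that by (simp add: norm_power power_le_one)
  have T0: "suminf T \<ge> 0" using \<rho> r B(1) by (intro suminf_nonneg sT) (simp add: T_def)
  have iGG: "integrable ?M (\<lambda>\<eta>. G \<eta> * cnj (G \<eta>))"
    using mG Gb T0 by (intro integrable_weighted[OF n a, where B = "suminf T * suminf T"])
      (auto simp: norm_mult intro!: mult_mono)
  have iGe: "integrable ?M (\<lambda>\<eta>. G \<eta> * cnj ((\<eta> $ i) ^ k))" for k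
  proof (rule integrable_weighted[OF n a, where B = "suminf T * 1"])
    show "(\<lambda>\<eta>. G \<eta> * cnj ((\<eta> $ i) ^ k)) \<in> borel_measurable ?M"
      by (rule borel_measurable_times[OF mG measurable_cnj[OF mi]])
    show "cmod (G \<eta> * cnj ((\<eta> $ i) ^ k)) \<le> suminf T * 1" if "norm \<eta> = 1" for \<eta>
      unfolding norm_mult complex_mod_cnj using Gb[OF that] coord[OF that] T0 by (intro mult_mono) auto
  qed
  have iee: "integrable ?M (\<lambda>\<eta>. (\<eta> $ i) ^ k * cnj ((\<eta> $ i) ^ l))" for k l
    by (intro integrable_weighted_continuous n a continuous_intros)
  have Ge: "(LINT \<eta>|?M. G \<eta> * cnj ((\<eta> $ i) ^ k)) = b k * hom_part f k (axis i 1) * of_real (Nk k)" for k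
  proof -
    define g where "g m \<eta> = b m * hom_part f m \<eta> * cnj ((\<eta> $ i) ^ k)" for m and \<eta> :: "complex ^ 'n"
    have gb: "cmod (g m \<eta>) \<le> T m" if "norm \<eta> = 1" for m \<eta>
    proof -
      have "cmod (g m \<eta>) \<le> T m * 1"
        unfolding g_def norm_mult[of "b m * hom_part f m \<eta>"] complex_mod_cnj
        using bterm[OF that, of m] coord[OF that, of k] order_trans[OF norm_ge_zero bterm[OF that, of m]]
        by (intro mult_mono) auto
      then show ?thesis by simp
    qed
    have gi: "integrable ?M (g m)" for m
    proof (rule integrable_weighted[OF n a _ gb])
      show "g m \<in> borel_measurable ?M"
        unfolding g_def
        by (rule borel_measurable_times[OF borel_measurable_times[OF borel_measurable_const mF] measurable_cnj[OF mi]])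
    qed
    have sg: "summable (\<lambda>m. cmod (g m \<eta>))" if "norm \<eta> = 1" for \<eta>
      using gb[OF that] by (intro summable_comparison_test'[OF sT, of 0]) simp
    have eq: "G \<eta> * cnj ((\<eta> $ i) ^ k) = (\<Sum>m. g m \<eta>)" if "norm \<eta> = 1" for \<eta>
    proof -
      have "summable (\<lambda>m. b m * hom_part f m \<eta>)"
        using bterm[OF that] by (intro summable_comparison_test'[OF sT, of 0])
      then show ?thesis unfolding G_def g_def by (rule suminf_mult2)
    qed
    have fin: "finite_measure ?M" by (rule finite_measure_defect_weight[OF n a])
    have "(LINT \<eta>|?M. G \<eta> * cnj ((\<eta> $ i) ^ k)) = (LINT \<eta>|?M. (\<Sum>m. g m \<eta>))"
      using eq by (intro Bochner_Integration.integral_cong) auto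
    also have "\<dots> = (\<Sum>m. LINT \<eta>|?M. g m \<eta>)"
    proof (rule integral_suminf)
      show "integrable ?M (g m)" for m by (rule gi)
      show "AE \<eta> in ?M. summable (\<lambda>m. norm (g m \<eta>))" using sg by (intro AE_I2) simp
      show "summable (\<lambda>m. LINT \<eta>|?M. norm (g m \<eta>))"
      proof (rule summable_comparison_test'[OF summable_mult[OF sT, of "measure ?M (space ?M)"], of 0])
        fix m
        have "(LINT \<eta>|?M. norm (g m \<eta>)) \<le> (LINT \<eta>|?M. T m)"
          using gi gb by (intro integral_mono finite_measure.integrable_const[OF fin]) auto
        then show "norm (LINT \<eta>|?M. norm (g m \<eta>)) \<le> measure ?M (space ?M) * T m" by simp
      qed
    qed
    also have "\<dots> = (\<Sum>m. if m = k then b k * hom_part f k (axis i 1) * of_real (Nk k) else 0)"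
    proof (rule suminf_cong)
      fix m
      have "(LINT \<eta>|?M. g m \<eta>) = b m * (LINT \<eta>|?M. hom_part f m \<eta> * cnj ((\<eta> $ i) ^ k))"
        unfolding g_def mult.assoc by (rule integral_mult_right_zero)
      then show "(LINT \<eta>|?M. g m \<eta>) = (if m = k then b k * hom_part f k (axis i 1) * of_real (Nk k) else 0)"
        unfolding integral_homogeneous_poly[OF n a homogeneous_poly_hom_part[OF f]] Nk_def by simp
    qed
    also have "\<dots> = b k * hom_part f k (axis i 1) * of_real (Nk k)"
      by (subst suminf_finite[of "{k}"]) auto
    finally show ?thesis .
  qed
  have ee: "(LINT \<eta>|?M. (\<eta> $ i) ^ k * cnj ((\<eta> $ i) ^ l)) = (if k = l then of_real (Nk k) else 0)" for k l
  proof -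
    have "homogeneous_poly k (\<lambda>\<eta> :: complex ^ 'n. (\<eta> $ i) ^ k)"
    proof (rule homogeneous_poly_of_polynomial_fun)
      have "polynomial_fun (\<lambda>\<eta> :: complex ^ 'n. \<Prod>j\<in>{..<k}. \<eta> $ i)"
        by (intro polynomial_fun_prod polynomial_fun_coord)
      then show "polynomial_fun (\<lambda>\<eta> :: complex ^ 'n. (\<eta> $ i) ^ k)" by simp
    qed (simp add: power_mult_distrib)
    from integral_homogeneous_poly[OF n a this, of i l] show ?thesis by (simp add: Nk_def axis_def)
  qed
  have "(\<Sum>k\<le>K. (cmod (b k * hom_part f k (axis i 1)))\<^sup>2 * Nk k) \<le> Re (LINT \<eta>|?M. G \<eta> * cnj (G \<eta>))"
    by (rule Bessel_inequality[where e = "\<lambda>k \<eta>. (\<eta> $ i) ^ k", OF iGG iGe iee Ge ee])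
  also have "\<dots> \<le> N\<^sup>2"
  proof -
    have GG: "(LINT \<eta>|?M. G \<eta> * cnj (G \<eta>)) = of_real (LINT \<eta>|?M. (cmod (G \<eta>))\<^sup>2)"
      unfolding integral_complex_of_real[symmetric] by (intro Bochner_Integration.integral_cong refl) (simp only: complex_norm_square)
    have i2: "integrable ?M (\<lambda>\<eta>. (cmod (G \<eta>))\<^sup>2)"
    proof -
      have "integrable ?M (\<lambda>\<eta>. complex_of_real ((cmod (G \<eta>))\<^sup>2))"
        using iGG by (simp only: complex_norm_square)
      then show ?thesis by (simp only: complex_of_real_integrable_eq)
    qed
    have "(\<integral>\<^sup>+\<eta>. ennreal ((cmod (G \<eta>))\<^sup>2) \<partial>?M) \<le> ennreal (N\<^sup>2)"
      using bound unfolding G L2_norm_le_iff[OF N] .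
    then have "ennreal (LINT \<eta>|?M. (cmod (G \<eta>))\<^sup>2) \<le> ennreal (N\<^sup>2)"
      by (subst nn_integral_eq_integral[OF i2, symmetric]) auto
    then show ?thesis unfolding GG by simp
  qed
  also have "(\<Sum>k\<le>K. (cmod (b k * hom_part f k (axis i 1)))\<^sup>2 * Nk k)
    = (\<Sum>k\<le>K. (cmod (hom_part f k (axis i 1)))\<^sup>2 * \<rho> ^ (2 * k) * ((1 + real k) powr (2 * s) * Nk k))"
  proof (rule sum.cong[OF refl])
    fix k
    have "((1 + real k) powr s)\<^sup>2 = (1 + real k) powr (2 * s)"
      by (simp add: power2_eq_square powr_add[symmetric])
    then show "(cmod (b k * hom_part f k (axis i 1)))\<^sup>2 * Nk k
      = (cmod (hom_part f k (axis i 1)))\<^sup>2 * \<rho> ^ (2 * k) * ((1 + real k) powr (2 * s) * Nk k)"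
      using \<rho> by (simp add: b_def norm_mult norm_power power_mult_distrib power_mult[symmetric] mult_ac)
  qed
  finally show ?thesis by (simp only: Nk_def)
qed

lemma has_integral_cis:
  "((\<lambda>t. cis (2 * pi * real_of_int m * t)) has_integral (if m = 0 then 1 else 0)) {0..1}"
proof (cases "m = 0")
  case True
  then show ?thesis using has_integral_const_real[of "1::complex" 0 1] by simp
next
  case False
  define A where "A = 2 * pi * real_of_int m"
  have A: "A \<noteq> 0" using False by (simp add: A_def)
  have "((\<lambda>t. cis (A * t)) has_integral (cis (A * 1) / (\<i> * of_real A) - cis (A * 0) / (\<i> * of_real A))) {0..1}"
  proof (rule fundamental_theorem_of_calculus)
    fix t :: real
    have "((\<lambda>z. exp (\<i> * of_real A * z) / (\<i> * of_real A)) has_field_derivative exp (\<i> * of_real A * of_real t)) (at (of_real t))"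
      using A by (auto intro!: derivative_eq_intros)
    from has_vector_derivative_real_field[OF this, of "{0..1}"]
    show "((\<lambda>t. cis (A * t) / (\<i> * of_real A)) has_vector_derivative cis (A * t)) (at t within {0..1})"
      by (simp add: cis_conv_exp mult_ac)
  qed simp
  moreover have "cis (A * 1) = 1" using cis_multiple_2pi[of "real_of_int m"] by (simp add: A_def)
  ultimately show ?thesis using False by (simp add: A_def)
qed

lemma Parseval_trig_polynomial:
  "(\<integral>\<^sup>+t\<in>{0..1}. ennreal ((cmod (\<Sum>k\<le>K. d k * cis (2 * pi * t) ^ k))\<^sup>2) \<partial>lborel) = ennreal (\<Sum>k\<le>K. (cmod (d k))\<^sup>2)"
proof (rule nn_integral_has_integral_lebesgue')
  define S where "S t = (\<Sum>k\<le>K. d k * cis (2 * pi * t) ^ k)" for t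
  have eq: "S t * cnj (S t) = (\<Sum>k\<le>K. \<Sum>l\<le>K. d k * cnj (d l) * cis (2 * pi * real_of_int (int k - int l) * t))" for t
  proof -
    have "d k * cis (2 * pi * t) ^ k * cnj (d l * cis (2 * pi * t) ^ l)
      = d k * cnj (d l) * cis (2 * pi * real_of_int (int k - int l) * t)" for k l
    proof -
      have "cis (2 * pi * t) ^ k * cnj (cis (2 * pi * t) ^ l) = cis (2 * pi * real_of_int (int k - int l) * t)"
        by (simp add: Complex.DeMoivre cis_cnj cis_mult algebra_simps)
      then show ?thesis by (simp only: complex_cnj_mult mult_ac)
    qed
    then show ?thesis unfolding S_def cnj_sum sum_product by (simp only:)
  qed
  have "((\<lambda>t. S t * cnj (S t)) has_integral (\<Sum>k\<le>K. \<Sum>l\<le>K. d k * cnj (d l) * (if int k - int l = 0 then 1 else 0))) {0..1}"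
    unfolding eq by (intro has_integral_sum has_integral_mult_right has_integral_cis) auto
  also have "(\<Sum>k\<le>K. \<Sum>l\<le>K. d k * cnj (d l) * (if int k - int l = 0 then 1 else 0)) = (\<Sum>k\<le>K. d k * cnj (d k))"
    by (intro sum.cong) (simp_all add: if_distrib[of "\<lambda>x. _ * x"] sum.delta cong: if_cong)
  finally have "((\<lambda>t. Re (S t * cnj (S t))) has_integral Re (\<Sum>k\<le>K. d k * cnj (d k))) {0..1}"
    by (rule has_integral_Re)
  then show "((\<lambda>t. (cmod (S t))\<^sup>2) has_integral (\<Sum>k\<le>K. (cmod (d k))\<^sup>2)) {0..1}"
    by (simp add: complex_mult_cnj_norm flip: of_real_power)
qed simp

lemma nn_integral_circle_measure:
  assumes g: "g \<in> borel_measurable (restrict_space borel (sphere 0 1))"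
  shows "(\<integral>\<^sup>+\<eta>. g \<eta> \<partial>circle_measure i) = (\<integral>\<^sup>+t\<in>{0..1}. g (axis i (cis (2 * pi * t))) \<partial>lborel)"
proof -
  have m: "(\<lambda>t. axis i (cis (2 * pi * t))) \<in> uniform_measure lborel {0..1} \<rightarrow>\<^sub>M restrict_space borel (sphere 0 1)"
    using measurable_circle[of i] by (simp add: measurable_def)
  have m2: "(\<lambda>t. g (axis i (cis (2 * pi * t)))) \<in> borel_measurable lborel"
    using measurable_compose[OF measurable_circle g] by simp
  have "(\<integral>\<^sup>+\<eta>. g \<eta> \<partial>circle_measure i) = (\<integral>\<^sup>+t. g (axis i (cis (2 * pi * t))) \<partial>uniform_measure lborel {0..1})"
    unfolding circle_measure_def by (rule nn_integral_distr[OF m]) (simp add: g)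
  also have "\<dots> = (\<integral>\<^sup>+t\<in>{0..1}. g (axis i (cis (2 * pi * t))) \<partial>lborel) / emeasure lborel {0..1::real}"
    by (rule nn_integral_uniform_measure[OF m2]) simp
  finally show ?thesis by (simp add: divide_ennreal_def)
qed

text \<open>
  On the circle of radius \<open>\<rho>\<close> the function is the Fourier series with coefficients
  \<open>hom_part f k (axis i 1) * \<rho> ^ k\<close>. In the sum over their squares that Bessel's inequality provides,
  the factor \<open>(1 + k) powr (2 * s)\<close> of the Hardy-Sobolev norm compensates the decay of the moments.
  Fatou's lemma passes from the partial sums to the function.
\<close>
lemma Carleson_Hardy_Sobolev_circle_measure:
  fixes i :: "'n::finite"
  assumes n: "CARD('n) > 1" and a: "\<bar>a\<bar> < real CARD('n) - 1" "a = 2 * s - (real CARD('n) - 1)"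
  shows "Carleson_Hardy_Sobolev s (defect_weight i a) (circle_measure i)"
proof -
  let ?M = "weighted_measure (defect_weight i a)"
  obtain c where c: "c > 0" "\<And>k. c \<le> (1 + real k) powr (2 * s) *
    (LINT \<eta> :: complex ^ 'n|?M. cmod (\<eta> $ i) ^ (2 * k))"
    using moment_lower_bound[OF n a, of i] by blast
  show ?thesis
    unfolding Carleson_Hardy_Sobolev_def
  proof (intro exI[of _ "1 / sqrt c"] conjI ballI)
    show "0 < 1 / sqrt c" using c by simp
    fix f :: "complex ^ 'n \<Rightarrow> complex" assume "f \<in> Hardy_Sobolev s (defect_weight i a)"
    then have f: "holomorphic_Cn f (ball 0 1)" and fin: "Hardy_Sobolev_norm s (defect_weight i a) f < \<infinity>"
      by (auto simp: Hardy_Sobolev_def)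
    obtain N where N: "N \<ge> 0" "Hardy_Sobolev_norm s (defect_weight i a) f = ennreal N"
      using fin by (cases "Hardy_Sobolev_norm s (defect_weight i a) f") auto
    have bound: "L2_norm (circle_measure i) (\<lambda>\<eta>. f (\<rho> *\<^sub>R \<eta>)) \<le> ennreal (N / sqrt c)"
      if \<rho>: "\<rho> \<in> {0<..<1}" for \<rho>
    proof -
      have \<rho>': "0 < \<rho>" "\<rho> < 1" using \<rho> by auto
      define d where "d k = hom_part f k (axis i 1) * of_real \<rho> ^ k" for k
      have "L2_norm ?M (\<lambda>\<eta>. radial_power s f (\<rho> *\<^sub>R \<eta>)) \<le> ennreal N"
        unfolding N(2)[symmetric] Hardy_Sobolev_norm_def using \<rho> by (rule SUP_upper)
      note coef = coefficient_bound[OF n a(1) f \<rho>' N(1) this]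
      have dsum: "(\<Sum>k\<le>K. (cmod (d k))\<^sup>2) \<le> N\<^sup>2 / c" for K
      proof -
        have "c * (\<Sum>k\<le>K. (cmod (d k))\<^sup>2)
          = (\<Sum>k\<le>K. (cmod (hom_part f k (axis i 1)))\<^sup>2 * \<rho> ^ (2 * k) * c)"
          unfolding sum_distrib_left
          using \<rho>' by (intro sum.cong) (simp_all add: d_def norm_mult norm_power power_mult_distrib power_mult[symmetric] mult_ac)
        also have "\<dots> \<le> (\<Sum>k\<le>K. (cmod (hom_part f k (axis i 1)))\<^sup>2 * \<rho> ^ (2 * k) * ((1 + real k) powr (2 * s) *
            (LINT \<eta> :: complex ^ 'n|?M. cmod (\<eta> $ i) ^ (2 * k))))"
          using \<rho>' c by (intro sum_mono mult_left_mono) auto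
        also have "\<dots> \<le> N\<^sup>2" by (rule coef)
        finally show ?thesis using c by (simp add: pos_le_divide_eq mult.commute)
      qed
      have conv: "(\<lambda>K. \<Sum>k\<le>K. d k * cis (2 * pi * t) ^ k) \<longlonglongrightarrow> f (\<rho> *\<^sub>R axis i (cis (2 * pi * t)))" for t
      proof -
        have "(\<lambda>k. hom_part f k (axis i 1) * (of_real \<rho> * cis (2 * pi * t)) ^ k) sums f ((of_real \<rho> * cis (2 * pi * t)) *s axis i 1)"
          using \<rho>' by (intro hom_part_sums[OF f]) (simp add: norm_mult)
        moreover have "(of_real \<rho> * cis (2 * pi * t)) *s axis i 1 = \<rho> *\<^sub>R axis i (cis (2 * pi * t))"
          by (simp add: vec_eq_iff axis_def scaleR_conv_of_real[where 'a = complex])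
        ultimately show ?thesis by (simp add: sums_def_le d_def power_mult_distrib mult.assoc)
      qed
      have contf: "continuous_on (sphere 0 1) (\<lambda>\<eta>. f (\<rho> *\<^sub>R \<eta>))"
      proof (rule continuous_on_compose2[of "ball 0 1" f])
        show "continuous_on (ball 0 1) f" by (rule holomorphic_Cn_continuous[OF f])
      qed (use \<rho>' in \<open>auto intro!: continuous_intros\<close>)
      have "(\<integral>\<^sup>+\<eta>. ennreal ((cmod (f (\<rho> *\<^sub>R \<eta>)))\<^sup>2) \<partial>circle_measure i)
        = (\<integral>\<^sup>+t\<in>{0..1}. ennreal ((cmod (f (\<rho> *\<^sub>R axis i (cis (2 * pi * t)))))\<^sup>2) \<partial>lborel)"
        using borel_measurable_continuous_on_restrict[OF contf]
        by (intro nn_integral_circle_measure) measurable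
      also have "\<dots> = (\<integral>\<^sup>+t. liminf (\<lambda>K. ennreal ((cmod (\<Sum>k\<le>K. d k * cis (2 * pi * t) ^ k))\<^sup>2) * indicator {0..1} t) \<partial>lborel)"
      proof (rule nn_integral_cong)
        fix t :: real
        have "(\<lambda>K. ennreal ((cmod (\<Sum>k\<le>K. d k * cis (2 * pi * t) ^ k))\<^sup>2) * indicator {0..1} t)
          \<longlonglongrightarrow> ennreal ((cmod (f (\<rho> *\<^sub>R axis i (cis (2 * pi * t)))))\<^sup>2) * indicator {0..1} t"
          using tendsto_ennrealI[OF tendsto_power[OF tendsto_norm[OF conv[of t]]], of 2]
          by (cases "t \<in> {0..1}") auto
        then show "ennreal ((cmod (f (\<rho> *\<^sub>R axis i (cis (2 * pi * t)))))\<^sup>2) * indicator {0..1} t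
          = liminf (\<lambda>K. ennreal ((cmod (\<Sum>k\<le>K. d k * cis (2 * pi * t) ^ k))\<^sup>2) * indicator {0..1} t)"
          by (rule lim_imp_Liminf[OF trivial_limit_sequentially, symmetric])
      qed
      also have "\<dots> \<le> liminf (\<lambda>K. \<integral>\<^sup>+t. ennreal ((cmod (\<Sum>k\<le>K. d k * cis (2 * pi * t) ^ k))\<^sup>2) * indicator {0..1} t \<partial>lborel)"
      proof (rule nn_integral_liminf)
        fix K
        have "continuous_on UNIV (\<lambda>t::real. (cmod (\<Sum>k\<le>K. d k * cis (2 * pi * t) ^ k))\<^sup>2)"
          unfolding cis_conv_exp by (intro continuous_intros)
        then have [measurable]: "(\<lambda>t::real. (cmod (\<Sum>k\<le>K. d k * cis (2 * pi * t) ^ k))\<^sup>2) \<in> borel_measurable borel"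
          by (rule borel_measurable_continuous_onI)
        show "(\<lambda>t. ennreal ((cmod (\<Sum>k\<le>K. d k * cis (2 * pi * t) ^ k))\<^sup>2) * indicator {0..1} t) \<in> borel_measurable lborel"
          by measurable
      qed
      also have "\<dots> = liminf (\<lambda>K. ennreal (\<Sum>k\<le>K. (cmod (d k))\<^sup>2))"
        by (simp only: Parseval_trig_polynomial)
      also have "\<dots> \<le> ennreal (N\<^sup>2 / c)"
      proof (rule Liminf_le)
        show "\<forall>\<^sub>F K in sequentially. ennreal (\<Sum>k\<le>K. (cmod (d k))\<^sup>2) \<le> ennreal (N\<^sup>2 / c)"
          by (intro always_eventually allI ennreal_leI dsum)
      qed simp
      also have "N\<^sup>2 / c = (N / sqrt c)\<^sup>2" using c by (simp add: power_divide)
      finally show ?thesis using N c by (subst L2_norm_le_iff) auto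
    qed
    have "(SUP r\<in>{0<..<1}. L2_norm (circle_measure i) (\<lambda>\<eta>. f (r *\<^sub>R \<eta>))) \<le> ennreal (N / sqrt c)"
      by (rule SUP_least) (rule bound)
    also have "\<dots> = ennreal (1 / sqrt c) * ennreal N"
      using N c by (subst ennreal_mult[symmetric]) auto
    finally show "(SUP r\<in>{0<..<1}. L2_norm (circle_measure i) (\<lambda>\<eta>. f (r *\<^sub>R \<eta>)))
      \<le> ennreal (1 / sqrt c) * Hardy_Sobolev_norm s (defect_weight i a) f"
      unfolding N(2) .
  qed
qed

section \<open>The counterexample\<close>

theorem proposition3p6:
  fixes \<tau> s :: real
  assumes "CARD('n::finite) > 1"
    and "\<tau> \<ge> 0" and "s > 0" and "\<tau> > 1 + 2 * s"
    and "real CARD('n) < \<tau>" and "\<tau> < real CARD('n) + 1"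
  shows "\<exists>(w :: complex ^ 'n \<Rightarrow> real) (\<mu> :: (complex ^ 'n) measure).
           A2_weight w \<and> doubling_weight \<tau> w \<and> Borel_measure_on_sphere \<mu> \<and>
           Carleson_Hardy_Sobolev s w \<mu> \<and> \<not> Carleson_potential s w \<mu>"
proof -
  define a where "a = 2 * s - (real CARD('n) - 1)"
  fix i :: 'n
  have n2: "real CARD('n) \<ge> 2" using assms(1) by simp
  have a: "\<bar>a\<bar> < real CARD('n) - 1" "a > - (real CARD('n) - 1)" "real CARD('n) + a \<le> \<tau>" "s < real CARD('n)"
    using assms n2 unfolding a_def by linarith+
  show ?thesis
  proof (intro exI conjI)
    show "A2_weight (defect_weight i a)" by (rule A2_defect_weight[OF assms(1) a(1)])
    show "doubling_weight \<tau> (defect_weight i a)"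
      using assms a by (intro doubling_defect_weight) auto
    show "Borel_measure_on_sphere (circle_measure i)" by (rule Borel_circle_measure)
    show "Carleson_Hardy_Sobolev s (defect_weight i a) (circle_measure i)"
      by (rule Carleson_Hardy_Sobolev_circle_measure[OF assms(1) a(1) a_def])
    show "\<not> Carleson_potential s (defect_weight i a) (circle_measure i)"
      by (rule not_Carleson_potential_circle_measure[OF assms(1,3) a(4) a_def])
  qed
qed

end
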